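(* Let $\mu(\zeta)=\tanh(\epsilon\zeta)$ and consider, on $\zeta\in\mathbb R$, $t>0$, the equation $$u_t=u_{\zeta\zeta}-cu_\zeta+\mu(\zeta)u-u^3 .$$ For each fixed $c\in[0,2)$ and all sufficiently small $\epsilon>0$, the stationary front solution $u^*(\zeta)$ described in the context is exponentially asymptotically stable, that is, it attracts all nearby initial conditions exponentially: there exist constants $\delta_0,K,\kappa>0$ (depending on $c,\epsilon$) such that every solution with initial condition $u(\cdot,0)=u_0$, $u_0-u^*\in BC^0(\mathbb R)$ and $\|u_0-u^*\|_{BC^0}\le\delta_0$ exists for all $t\ge0$ and satisfies $\|u(\cdot,t)-u^*\|_{BC^0}\le K e^{-\kappa t}\|u_0-u^*\|_{BC^0}$.
   Context: $BC^0(\mathbb R)$ denotes bounded continuous functions with the supremum norm. The fronts $u^*$ are the following positive, monotone increasing stationary solutions. Case $c\in(0,2)$: for $\epsilon$ small, $u^*$ is the first component of the heteroclinic orbit $\Gamma_\epsilon$ of $u_\zeta=v,\ v_\zeta=cv-\mu u+u^3,\ \mu_\zeta=\epsilon(1-\mu^2)$ (with $\mu(0)=0$) from $(0,0,-1)$ to $(1,0,1)$, lying in the transverse intersection of $W^{\mathrm u}(0,0,-1)$ and $W^{\mathrm s}(1,0,1)$, along which $u$ is monotone increasing and for which $\inf\{\mu:u>c/4\}=\frac{c^2}{4}+\Omega_0(1-\frac{c^4}{16})^{2/3}\epsilon^{2/3}+\mathcal O(\epsilon\ln\epsilon)$, with $\Omega_0$ the smallest positive zero of $J_{-1/3}(2z^{3/2}/3)+J_{1/3}(2z^{3/2}/3)$.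 Case $c=0$: for $\epsilon$ small, $u^*$ is the first component of the heteroclinic orbit of the same system with $c=0$ from $(0,0,-1)$ to $(1,0,1)$, lying in the transverse intersection of the unstable manifold of $(0,0,-1)$ and the stable manifold of $(1,0,1)$, which satisfies $u^*(\zeta)=\sqrt2\epsilon^{1/3}w_{HM}(-\epsilon^{1/3}\zeta)+\mathcal O(\epsilon^{2/3})$ for $|\zeta|\le\rho\epsilon^{-1/3}$ with some $\rho>0$ independent of $\epsilon$; here $w_{HM}$ is the unique positive monotone solution of $w''=\eta w+2w^3$ with $w\sim\mathrm{Ai}(\eta)$ as $\eta\to+\infty$ and $w\sim\sqrt{-\eta/2}$ as $\eta\to-\infty$. These fronts exist for all sufficiently small $\epsilon>0$. *)

theory Defs
  imports "HOL-Analysis.Analysis" "HOL-Library.Landau_Symbols"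
begin

text \<open>Stable and unstable manifolds of an equilibrium \<open>p\<close> of \<open>X' = F X\<close>. The flow need not be
  complete, so trajectories are only required on a half line.\<close>

definition forward_trajectory :: "('a::real_normed_vector \<Rightarrow> 'a) \<Rightarrow> (real \<Rightarrow> 'a) \<Rightarrow> bool" where
  "forward_trajectory F X \<longleftrightarrow>
     (\<forall>t\<ge>0. (X has_vector_derivative F (X t)) (at t within {0..}))"

definition stable_manifold :: "('a::real_normed_vector \<Rightarrow> 'a) \<Rightarrow> 'a \<Rightarrow> 'a set" where
  "stable_manifold F p =
     {x. \<exists>X. forward_trajectory F X \<and> X 0 = x \<and> (X \<longlongrightarrow> p) at_top}"

text \<open>The tangent space of the stable manifold at \<open>x\<close> consists of the velocities \<open>w\<close> at \<open>x\<close> of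
  \<open>C\<^sup>1\<close> curves \<open>s \<mapsto> \<Phi> s 0\<close> in the manifold. The stable manifold is in general only
  immersed: it is the increasing union of the preimages, under the time-\<open>T\<close> flow, of an embedded
  local stable manifold near \<open>p\<close>. Convergence of \<open>\<Phi> s t\<close> to \<open>p\<close> uniformly in \<open>s\<close> says
  that the curve lies in one of these embedded pieces, i.e. does not jump between sheets that
  accumulate on each other.\<close>

definition stable_tangent_space :: "('a::real_normed_vector \<Rightarrow> 'a) \<Rightarrow> 'a \<Rightarrow> 'a \<Rightarrow> 'a set" where
  "stable_tangent_space F p x =
     {w. \<exists>d>0. \<exists>\<Phi> :: real \<Rightarrow> real \<Rightarrow> 'a. \<exists>\<gamma>' :: real \<Rightarrow> 'a.
        (\<forall>s\<in>{-d<..<d}. forward_trajectory F (\<Phi> s)) \<and>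
        uniform_limit {-d<..<d} (\<lambda>t s. \<Phi> s t) (\<lambda>_. p) at_top \<and>
        (\<forall>s\<in>{-d<..<d}. ((\<lambda>r. \<Phi> r 0) has_vector_derivative \<gamma>' s) (at s)) \<and>
        continuous_on {-d<..<d} \<gamma>' \<and>
        \<Phi> 0 0 = x \<and> \<gamma>' 0 = w}"

definition unstable_manifold :: "('a::real_normed_vector \<Rightarrow> 'a) \<Rightarrow> 'a \<Rightarrow> 'a set" where
  "unstable_manifold F p = stable_manifold (\<lambda>x. - F x) p"

definition unstable_tangent_space :: "('a::real_normed_vector \<Rightarrow> 'a) \<Rightarrow> 'a \<Rightarrow> 'a \<Rightarrow> 'a set" where
  "unstable_tangent_space F p x = stable_tangent_space (\<lambda>x. - F x) p x"

definition transverse_intersection ::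
    "('a::real_normed_vector \<Rightarrow> 'a) \<Rightarrow> 'a \<Rightarrow> 'a \<Rightarrow> 'a set" where
  "transverse_intersection F p q =
     {x \<in> unstable_manifold F p \<inter> stable_manifold F q.
        {a + b | a b. a \<in> unstable_tangent_space F p x \<and> b \<in> stable_tangent_space F q x} = UNIV}"


definition front_field :: "real \<Rightarrow> real \<Rightarrow> real \<times> real \<times> real \<Rightarrow> real \<times> real \<times> real" where
  "front_field c \<epsilon> = (\<lambda>(u, v, \<mu>). (v, c * v - \<mu> * u + u ^ 3, \<epsilon> * (1 - \<mu>\<^sup>2)))"

definition heteroclinic_front :: "real \<Rightarrow> real \<Rightarrow> (real \<Rightarrow> real \<times> real \<times> real) \<Rightarrow> bool" where
  "heteroclinic_front c \<epsilon> X \<longleftrightarrow>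
     (\<forall>\<zeta>. (X has_vector_derivative front_field c \<epsilon> (X \<zeta>)) (at \<zeta>)) \<and>
     snd (snd (X 0)) = 0 \<and>
     (X \<longlongrightarrow> (0, 0, -1)) at_bot \<and>
     (X \<longlongrightarrow> (1, 0, 1)) at_top \<and>
     range X \<subseteq> transverse_intersection (front_field c \<epsilon>) (0, 0, -1) (1, 0, 1) \<and>
     (\<forall>\<zeta>. 0 < fst (X \<zeta>)) \<and>
     mono (\<lambda>\<zeta>. fst (X \<zeta>))"


text \<open>For \<open>x > 0\<close>.\<close>

definition Bessel_J :: "real \<Rightarrow> real \<Rightarrow> real" where
  "Bessel_J \<nu> x =
     (x / 2) powr \<nu> * (\<Sum>m. (-1) ^ m / fact m * rGamma (of_nat m + \<nu> + 1) * (x / 2) ^ (2 * m))"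

definition Omega0 :: real where
  "Omega0 = (LEAST z. 0 < z \<and>
     Bessel_J (-1/3) (2 * z powr (3/2) / 3) + Bessel_J (1/3) (2 * z powr (3/2) / 3) = 0)"

definition Airy_Ai :: "real \<Rightarrow> real" where
  "Airy_Ai x = Lim at_top (\<lambda>R. integral {0..R} (\<lambda>t. cos (t ^ 3 / 3 + x * t))) / pi"

definition Hastings_McLeod :: "real \<Rightarrow> real" where
  "Hastings_McLeod = (THE w.
     (\<exists>w'. \<forall>\<eta>. (w has_real_derivative w' \<eta>) (at \<eta>) \<and>
                (w' has_real_derivative \<eta> * w \<eta> + 2 * w \<eta> ^ 3) (at \<eta>)) \<and>
     (\<forall>\<eta>. 0 < w \<eta>) \<and> (mono w \<or> antimono w) \<and>
     w \<sim>[at_top] Airy_Ai \<and>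
     w \<sim>[at_bot] (\<lambda>\<eta>. sqrt (- \<eta> / 2)))"


text \<open>The asymptotic expansions that single out the fronts concern \<open>\<epsilon> \<rightarrow> 0\<close>, so they are
  conditions on a family \<open>\<epsilon> \<mapsto> X \<epsilon>\<close> of orbits, not on a single orbit.\<close>

definition front_family :: "real \<Rightarrow> (real \<Rightarrow> real \<Rightarrow> real \<times> real \<times> real) \<Rightarrow> bool" where
  "front_family c X \<longleftrightarrow>
     (\<forall>\<^sub>F \<epsilon> in at_right 0. heteroclinic_front c \<epsilon> (X \<epsilon>)) \<and>
     (0 < c \<longrightarrow>
        (\<lambda>\<epsilon>. Inf {snd (snd (X \<epsilon> \<zeta>)) | \<zeta>. fst (X \<epsilon> \<zeta>) > c / 4}
              - (c\<^sup>2 / 4 + Omega0 * (1 - c ^ 4 / 16) powr (2/3) * \<epsilon> powr (2/3)))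
          \<in> O[at_right 0](\<lambda>\<epsilon>. \<epsilon> * ln \<epsilon>)) \<and>
     (c = 0 \<longrightarrow>
        (\<exists>\<rho>>0. \<exists>C. \<forall>\<^sub>F \<epsilon> in at_right 0. \<forall>\<zeta>. \<bar>\<zeta>\<bar> \<le> \<rho> * \<epsilon> powr (-1/3) \<longrightarrow>
           \<bar>fst (X \<epsilon> \<zeta>) - sqrt 2 * \<epsilon> powr (1/3) * Hastings_McLeod (- (\<epsilon> powr (1/3)) * \<zeta>)\<bar>
             \<le> C * \<epsilon> powr (2/3)))"


text \<open>Classical solutions on \<open>[0, T)\<close>, \<open>T \<le> \<infinity>\<close>, of
  \<open>u\<^sub>t = u\<^sub>\<zeta>\<^sub>\<zeta> - c u\<^sub>\<zeta> + tanh(\<epsilon> \<zeta>) u - u\<^sup>3\<close> in the class \<open>BC\<^sup>0\<close>. The initial value is attained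
  locally uniformly only: for bounded continuous, not uniformly continuous, initial data a
  solution is not norm continuous at \<open>t = 0\<close>.\<close>

definition classical_solution ::
    "real \<Rightarrow> real \<Rightarrow> ereal \<Rightarrow> (real \<Rightarrow> real) \<Rightarrow> (real \<Rightarrow> real \<Rightarrow> real) \<Rightarrow> bool" where
  "classical_solution c \<epsilon> T u0 u \<longleftrightarrow>
     u 0 = u0 \<and>
     continuous_on ({t. 0 \<le> t \<and> ereal t < T} \<times> UNIV) (\<lambda>(t, \<zeta>). u t \<zeta>) \<and>
     (\<forall>S. 0 \<le> S \<and> ereal S < T \<longrightarrow> bounded ((\<lambda>(t, \<zeta>). u t \<zeta>) ` ({0..S} \<times> UNIV))) \<and>
     (\<exists>ut uz uzz :: real \<Rightarrow> real \<Rightarrow> real.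
        continuous_on ({t. 0 < t \<and> ereal t < T} \<times> UNIV) (\<lambda>(t, \<zeta>). ut t \<zeta>) \<and>
        continuous_on ({t. 0 < t \<and> ereal t < T} \<times> UNIV) (\<lambda>(t, \<zeta>). uz t \<zeta>) \<and>
        continuous_on ({t. 0 < t \<and> ereal t < T} \<times> UNIV) (\<lambda>(t, \<zeta>). uzz t \<zeta>) \<and>
        (\<forall>t \<zeta>. 0 < t \<and> ereal t < T \<longrightarrow>
           ((\<lambda>s. u s \<zeta>) has_real_derivative ut t \<zeta>) (at t) \<and>
           (u t has_real_derivative uz t \<zeta>) (at \<zeta>) \<and>
           (uz t has_real_derivative uzz t \<zeta>) (at \<zeta>) \<and>
           ut t \<zeta> = uzz t \<zeta> - c * uz t \<zeta> + tanh (\<epsilon> * \<zeta>) * u t \<zeta> - u t \<zeta> ^ 3))"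

text \<open>Meaningful for \<open>f \<in> bcontfun\<close> only.\<close>

definition BC0_norm :: "(real \<Rightarrow> real) \<Rightarrow> real" where
  "BC0_norm f = norm (Bcontfun f)"

text \<open>``Every solution exists for all times'' means that initial data admit a global solution and
  that any solution on some \<open>[0, T)\<close> extends to a global one.\<close>

definition exponentially_asymptotically_stable :: "real \<Rightarrow> real \<Rightarrow> (real \<Rightarrow> real) \<Rightarrow> bool" where
  "exponentially_asymptotically_stable c \<epsilon> ustar \<longleftrightarrow>
     (\<exists>\<delta>0>0. \<exists>K>0. \<exists>\<kappa>>0. \<forall>u0.
        (\<lambda>\<zeta>. u0 \<zeta> - ustar \<zeta>) \<in> bcontfun \<and> BC0_norm (\<lambda>\<zeta>. u0 \<zeta> - ustar \<zeta>) \<le> \<delta>0 \<longrightarrow>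
          (\<exists>u. classical_solution c \<epsilon> \<infinity> u0 u) \<and>
          (\<forall>T>0. \<forall>u. classical_solution c \<epsilon> T u0 u \<longrightarrow>
             (\<exists>w. classical_solution c \<epsilon> \<infinity> u0 w \<and>
                  (\<forall>t \<zeta>. 0 \<le> t \<and> ereal t < T \<longrightarrow> w t \<zeta> = u t \<zeta>) \<and>
                  (\<forall>t\<ge>0. (\<lambda>\<zeta>. w t \<zeta> - ustar \<zeta>) \<in> bcontfun \<and>
                     BC0_norm (\<lambda>\<zeta>. w t \<zeta> - ustar \<zeta>)
                       \<le> K * exp (- \<kappa> * t) * BC0_norm (\<lambda>\<zeta>. u0 \<zeta> - ustar \<zeta>)))))"

end

theory Submission
  imports Defs "HOL-Probability.Distributions"
begin

text \<open>The front \<open>U\<close> is positive and monotone, and \<open>\<mu>\<close> is near \<open>-1\<close> where \<open>U\<close> is small.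
  Hence, for a small constant \<open>\<eta> > 0\<close>, the linearisation
  \<open>L = \<partial>\<^sub>x\<^sub>x - c \<partial>\<^sub>x + \<mu> - 3 U\<^sup>2\<close> satisfies \<open>L (U + \<eta>) \<le> - 2 \<kappa> (U + \<eta>)\<close>
  everywhere with some \<open>\<kappa> > 0\<close>, and
  \<open>U \<plusminus> A exp (- \<kappa> t) (U + \<eta>)\<close> is a super- resp. subsolution of the nonlinear equation for small \<open>A\<close>.
  The parabolic comparison principle gives uniqueness and the exponential decay.
  Global solutions are constructed for a truncated cubic, which is globally Lipschitz, as fixed points
  of the Duhamel formula in an exponentially weighted space of bounded continuous functions;
  the barriers show that such a solution never leaves the range where the truncation is inactive.\<close>

section \<open>Comparison principle\<close>

text \<open>The difficulty lies at -\<infinity>: applied to \<open>U\<close> itself the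
  linearisation gives -2 U^3, a gain that vanishes together with \<open>U\<close>, and a multiple of
  \<open>U\<close> cannot bound perturbations that are small only in the supremum norm. The constant
  \<eta> repairs both: it yields a gain where \<mu> < 0 and a weight bounded away from 0. Half of
  the rate 2 \<kappa> becomes decay in time, the other half is reserved for the nonlinear terms. The
  barriers stay in [-2, 2], hence a truncation at 2, with slope at most 12 = 3 * 2^2. The other
  obstacle is regularity. The Duhamel source is only known to be continuous in time, and two
  derivatives on the heat kernel cost r^(-1), which is not integrable. So one derivative falls on
  the kernel, at the price r^(-1/2), and one on the source, whose gradient blows up like s^(-1/2)
  because the data are merely continuous. These singularities sit at opposite ends of the Duhamel
  integral and combine to the arcsine density, whose mass does not depend on t. Since bounded
  continuous data need not evolve continuously in norm at t = 0, the fixed point is sought among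
  functions on space-time, not among curves in the function space.\<close>

lemma second_derivative_at_max_le_0:
  fixes q :: "real \<Rightarrow> real"
  assumes d1: "\<And>x. (q has_real_derivative q' x) (at x)"
    and d2: "(q' has_real_derivative m) (at x0)"
    and max: "\<And>x. q x \<le> q x0"
  shows "q' x0 = 0" and "m \<le> 0"
proof -
  show q0: "q' x0 = 0"
    by (rule DERIV_local_max[OF d1, of 1]) (use max in auto)
  show "m \<le> 0"
  proof (rule ccontr)
    assume "\<not> m \<le> 0"
    then obtain d where d: "d > 0" "\<And>h. 0 < h \<Longrightarrow> h < d \<Longrightarrow> q' x0 < q' (x0 + h)"
      using DERIV_pos_inc_right[OF d2] by auto
    obtain z where z: "x0 < z" "z < x0 + d / 2" "q (x0 + d / 2) - q x0 = (x0 + d / 2 - x0) * q' z"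
      using MVT2[of x0 "x0 + d / 2" q q'] d1 d(1) by auto
    have "q' z > 0"
      using d(2)[of "z - x0"] z q0 d(1) by auto
    with z d(1) have "q (x0 + d / 2) - q x0 > 0" by (metis add_diff_cancel_left' half_gt_zero mult_pos_pos)
    with max[of "x0 + d/2"] show False by simp
  qed
qed

text \<open>Subtracting the unbounded function \<open>\<eta> (1 + x\<^sup>2)\<close> forces the maximum to be attained.\<close>

lemma parabolic_maximum_principle:
  fixes z zt zx zxx :: "real \<Rightarrow> real \<Rightarrow> real"
  assumes cont: "continuous_on ({0..S} \<times> UNIV) (\<lambda>(t, x). z t x)"
    and bdd: "\<And>t x. 0 \<le> t \<Longrightarrow> t \<le> S \<Longrightarrow> z t x \<le> B"
    and init: "\<And>x. z 0 x \<le> 0"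
    and dt: "\<And>t x. 0 < t \<Longrightarrow> t \<le> S \<Longrightarrow> ((\<lambda>s. z s x) has_real_derivative zt t x) (at t)"
    and dx: "\<And>t x. 0 < t \<Longrightarrow> t \<le> S \<Longrightarrow> (z t has_real_derivative zx t x) (at x)"
    and dxx: "\<And>t x. 0 < t \<Longrightarrow> t \<le> S \<Longrightarrow> (zx t has_real_derivative zxx t x) (at x)"
    and ineq: "\<And>t x. 0 < t \<Longrightarrow> t \<le> S \<Longrightarrow> 0 < z t x \<Longrightarrow> zt t x \<le> zxx t x - c * zx t x + k * z t x"
    and t: "0 \<le> t" "t \<le> S"
  shows "z t x \<le> 0"
proof -
  \<comment> \<open>In the weight exp (- \<Lambda> t) the summand |k| absorbs the zero order term, 2
    the second derivative 2 \<eta> of the penalty \<eta> (1 + y^2), and |c| its drift term, by 2 |y|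
    \<le> 1 + y^2.\<close>
  define \<Lambda> where "\<Lambda> = \<bar>k\<bar> + 2 + \<bar>c\<bar>"
  have "\<Lambda> > 0" unfolding \<Lambda>_def by simp
  have main: "z t x * exp (- \<Lambda> * t) \<le> \<eta> * (1 + x\<^sup>2)" if \<eta>: "\<eta> > 0" for \<eta>
  proof (rule ccontr)
    assume neg: "\<not> ?thesis"
    define h where "h = (\<lambda>(s, y). z s y * exp (- \<Lambda> * s) - \<eta> * (1 + y\<^sup>2))"
    have hpos: "h (t, x) > 0" using neg unfolding h_def by simp
    \<comment> \<open>For |y| \<ge> \<open>R\<close> the penalty exceeds |B| and \<open>h\<close> is
      negative, and |x| \<le> \<open>R\<close> puts the point with \<open>h\<close> > 0 into the
      rectangle. Hence the maximum over the compact rectangle is one over the whole strip.\<close>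
    define R where "R = max \<bar>x\<bar> (\<bar>B\<bar> / \<eta> + 1)"
    have hneg: "h (s, y) < 0" if "0 \<le> s" "s \<le> S" "R \<le> \<bar>y\<bar>" for s y
    proof -
      have "1 \<le> \<bar>y\<bar>" using that(3) divide_nonneg_pos[OF abs_ge_zero \<eta>, of B] unfolding R_def by linarith
      then have "\<bar>y\<bar> \<le> y\<^sup>2" using power_increasing[of 1 2 "\<bar>y\<bar>"] by simp
      moreover have "\<bar>B\<bar> \<le> \<eta> * \<bar>y\<bar>"
        using that \<eta> unfolding R_def by (simp add: field_simps)
      ultimately have "\<bar>B\<bar> < \<eta> * (1 + y\<^sup>2)" using \<eta>
        using mult_left_mono[of "\<bar>y\<bar>" "y\<^sup>2" \<eta>] unfolding distrib_left by linarith
      moreover have "z s y * exp (- \<Lambda> * s) \<le> \<bar>B\<bar>"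
      proof -
        have "z s y * exp (- \<Lambda> * s) \<le> \<bar>B\<bar> * exp (- \<Lambda> * s)"
          using bdd[OF that(1,2), of y] by (intro mult_right_mono) auto
        also have "\<dots> \<le> \<bar>B\<bar> * 1" using \<open>\<Lambda> > 0\<close> that(1) by (intro mult_left_mono) auto
        finally show ?thesis by simp
      qed
      ultimately show ?thesis unfolding h_def by simp
    qed
    have "compact ({0..S} \<times> {-R..R})" by (intro compact_Times) auto
    moreover have tx: "(t, x) \<in> {0..S} \<times> {-R..R}"
      using t unfolding R_def by auto
    moreover have "continuous_on ({0..S} \<times> {-R..R}) h"
    proof -
      have "continuous_on ({0..S} \<times> {-R..R}) (\<lambda>p. (\<lambda>(t, x). z t x) p)"
        by (rule continuous_on_subset[OF cont]) auto
      then show ?thesis unfolding h_def case_prod_beta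
        by (intro continuous_intros)
    qed
    ultimately obtain p where p: "p \<in> {0..S} \<times> {-R..R}"
      "\<And>q. q \<in> {0..S} \<times> {-R..R} \<Longrightarrow> h q \<le> h p"
      using continuous_attains_sup[of "{0..S} \<times> {-R..R}" h] by (metis empty_iff)
    obtain s y where sy: "p = (s, y)" by force
    have max: "h (s', y') \<le> h (s, y)" if "0 \<le> s'" "s' \<le> S" for s' y'
    proof (cases "R \<le> \<bar>y'\<bar>")
      case True
      with hneg[OF that True] p(2)[OF tx] hpos sy show ?thesis by simp
    next
      case False
      then have "(s', y') \<in> {0..S} \<times> {-R..R}" using that by auto
      from p(2)[OF this] show ?thesis by (simp add: sy)
    qed
    have hsy: "h (s, y) > 0" using p(2)[OF tx] hpos sy by simp
    have s: "0 \<le> s" "s \<le> S" using p sy by auto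
    have "s \<noteq> 0"
    proof
      assume "s = 0"
      moreover have "0 \<le> \<eta> * (1 + y\<^sup>2)" using \<eta> by simp
      ultimately have "h (s, y) \<le> 0" using init[of y] unfolding h_def by simp
      with hsy show False by simp
    qed
    with s have s0: "0 < s" by simp
    define e where "e = exp (- \<Lambda> * s)"
    have e: "e > 0" unfolding e_def by simp
    have zpos: "z s y * e > \<eta> * (1 + y\<^sup>2)" using hsy unfolding h_def e_def by simp
    have "\<eta> * (1 + y\<^sup>2) > 0" using \<eta> by (simp add: add_pos_nonneg)
    with zpos have "0 < z s y * e" by linarith
    with e have zp: "z s y > 0" by (simp add: zero_less_mult_iff)
    \<comment> \<open>The maximum may sit at the final time s = S, so only this sign is available;
      the contradiction looks at earlier times alone.\<close>
    have "zt s y * e - \<Lambda> * z s y * e \<ge> 0"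
    proof (rule ccontr)
      assume "\<not> ?thesis"
      then have neg: "zt s y * e - \<Lambda> * z s y * e < 0" by simp
      have "((\<lambda>r. h (r, y)) has_real_derivative (zt s y * e - \<Lambda> * z s y * e)) (at s)"
        unfolding h_def split e_def
        by (auto intro!: derivative_eq_intros dt[OF s0 s(2)] simp: algebra_simps)
      from DERIV_neg_dec_left[OF this neg] obtain d where
        d: "d > 0" "\<And>r. 0 < r \<Longrightarrow> r < d \<Longrightarrow> h (s, y) < h (s - r, y)"
        by blast
      have "h (s, y) < h (s - min (d / 2) (s / 2), y)" using d s0 by auto
      moreover have "h (s - min (d / 2) (s / 2), y) \<le> h (s, y)" using d s0 s(2) by (intro max) auto
      ultimately show False by simp
    qed
    moreover have "zx s y * e - \<eta> * (2 * y) = 0" "zxx s y * e - \<eta> * 2 \<le> 0"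
    proof -
      have "((\<lambda>y. h (s, y)) has_real_derivative zx s y * e - \<eta> * (2 * y)) (at y)" for y
        unfolding h_def split e_def
        by (auto intro!: derivative_eq_intros dx[OF s0 s(2)])
      moreover have "((\<lambda>y. zx s y * e - \<eta> * (2 * y)) has_real_derivative zxx s y * e - \<eta> * 2) (at y)"
        by (auto intro!: derivative_eq_intros dxx[OF s0 s(2)])
      ultimately show "zx s y * e - \<eta> * (2 * y) = 0" "zxx s y * e - \<eta> * 2 \<le> 0"
        using second_derivative_at_max_le_0[of "\<lambda>y. h (s, y)" "\<lambda>y. zx s y * e - \<eta> * (2 * y)"] max[OF s]
        by blast+
    qed
    moreover have "zt s y * e \<le> (zxx s y - c * zx s y + k * z s y) * e"
      using ineq[OF s0 s(2) zp] e by (intro mult_right_mono) auto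
    ultimately have "\<Lambda> * z s y * e \<le> \<eta> * 2 - c * (\<eta> * (2 * y)) + k * z s y * e"
      by (simp add: algebra_simps)
    moreover have "- c * (\<eta> * (2 * y)) \<le> \<bar>c\<bar> * (\<eta> * (1 + y\<^sup>2))"
    proof -
      have "- c * (2 * y) \<le> \<bar>c\<bar> * (2 * \<bar>y\<bar>)" using abs_ge_minus_self[of "c * (2 * y)"] by (simp add: abs_mult)
      also have "2 * \<bar>y\<bar> \<le> 1 + y\<^sup>2" using sum_squares_bound[of 1 "\<bar>y\<bar>"] by simp
      then have "\<bar>c\<bar> * (2 * \<bar>y\<bar>) \<le> \<bar>c\<bar> * (1 + y\<^sup>2)" by (intro mult_left_mono) auto
      finally have "\<eta> * (- c * (2 * y)) \<le> \<eta> * (\<bar>c\<bar> * (1 + y\<^sup>2))" using \<eta> by (intro mult_left_mono) auto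
      then show ?thesis by (simp add: algebra_simps)
    qed
    moreover have "\<eta> * 2 \<le> 2 * (\<eta> * (1 + y\<^sup>2))" using \<eta> by simp
    moreover have "k * z s y * e \<le> \<bar>k\<bar> * (z s y * e)" using zp e by (simp add: mult.assoc mult_right_mono)
    moreover have "\<Lambda> * z s y * e = (2 + \<bar>c\<bar>) * (z s y * e) + \<bar>k\<bar> * (z s y * e)"
      unfolding \<Lambda>_def by (simp add: algebra_simps)
    ultimately have "(2 + \<bar>c\<bar>) * (z s y * e) \<le> (2 + \<bar>c\<bar>) * (\<eta> * (1 + y\<^sup>2))"
      by (simp add: algebra_simps)
    then have "z s y * e \<le> \<eta> * (1 + y\<^sup>2)" by (rule mult_left_le_imp_le) auto
    with zpos show False by simp
  qed
  have "z t x * exp (- \<Lambda> * t) \<le> 0"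
  proof (rule field_le_epsilon)
    fix e :: real assume "e > 0"
    have "1 + x\<^sup>2 > 0" by (simp add: add_pos_nonneg)
    then show "z t x * exp (- \<Lambda> * t) \<le> 0 + e"
      using main[of "e / (1 + x\<^sup>2)"] \<open>e > 0\<close> by simp
  qed
  then show ?thesis by (simp add: mult_le_0_iff)
qed

text \<open>Existence is first proved for a truncated cubic \<open>g\<close>.\<close>

definition reaction_solution ::
    "(real \<Rightarrow> real) \<Rightarrow> real \<Rightarrow> real \<Rightarrow> ereal \<Rightarrow> (real \<Rightarrow> real) \<Rightarrow> (real \<Rightarrow> real \<Rightarrow> real) \<Rightarrow> bool" where
  "reaction_solution g c \<epsilon> T u0 u \<longleftrightarrow>
     u 0 = u0 \<and>
     continuous_on ({t. 0 \<le> t \<and> ereal t < T} \<times> UNIV) (\<lambda>(t, \<zeta>). u t \<zeta>) \<and>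
     (\<forall>S. 0 \<le> S \<and> ereal S < T \<longrightarrow> bounded ((\<lambda>(t, \<zeta>). u t \<zeta>) ` ({0..S} \<times> UNIV))) \<and>
     (\<exists>ut uz uzz :: real \<Rightarrow> real \<Rightarrow> real.
        continuous_on ({t. 0 < t \<and> ereal t < T} \<times> UNIV) (\<lambda>(t, \<zeta>). ut t \<zeta>) \<and>
        continuous_on ({t. 0 < t \<and> ereal t < T} \<times> UNIV) (\<lambda>(t, \<zeta>). uz t \<zeta>) \<and>
        continuous_on ({t. 0 < t \<and> ereal t < T} \<times> UNIV) (\<lambda>(t, \<zeta>). uzz t \<zeta>) \<and>
        (\<forall>t \<zeta>. 0 < t \<and> ereal t < T \<longrightarrow>
           ((\<lambda>s. u s \<zeta>) has_real_derivative ut t \<zeta>) (at t) \<and>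
           (u t has_real_derivative uz t \<zeta>) (at \<zeta>) \<and>
           (uz t has_real_derivative uzz t \<zeta>) (at \<zeta>) \<and>
           ut t \<zeta> = uzz t \<zeta> - c * uz t \<zeta> + tanh (\<epsilon> * \<zeta>) * u t \<zeta> - g (u t \<zeta>)))"

lemma reaction_solution_cube:
  "reaction_solution (\<lambda>v. v ^ 3) = classical_solution"
  by (simp add: fun_eq_iff reaction_solution_def classical_solution_def)

lemma abs_tanh_le_1: "\<bar>tanh x\<bar> \<le> (1::real)"
  using tanh_real_bounds[of x] by auto

lemma reaction_comparison:
  fixes u p :: "real \<Rightarrow> real \<Rightarrow> real"
  assumes g: "mono g"
    and contu: "continuous_on ({0..S} \<times> UNIV) (\<lambda>(t, x). u t x)"
    and contp: "continuous_on ({0..S} \<times> UNIV) (\<lambda>(t, x). p t x)"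
    and bdd: "\<And>t x. 0 \<le> t \<Longrightarrow> t \<le> S \<Longrightarrow> u t x - p t x \<le> B"
    and init: "\<And>x. u 0 x \<le> p 0 x"
    and u: "\<And>t x. 0 < t \<Longrightarrow> t \<le> S \<Longrightarrow> ((\<lambda>s. u s x) has_real_derivative ut t x) (at t) \<and>
        (u t has_real_derivative ux t x) (at x) \<and> (ux t has_real_derivative uxx t x) (at x) \<and>
        ut t x \<le> uxx t x - c * ux t x + tanh (\<epsilon> * x) * u t x - g (u t x)"
    and p: "\<And>t x. 0 < t \<Longrightarrow> t \<le> S \<Longrightarrow> ((\<lambda>s. p s x) has_real_derivative pt t x) (at t) \<and>
        (p t has_real_derivative px t x) (at x) \<and> (px t has_real_derivative pxx t x) (at x) \<and>
        pt t x \<ge> pxx t x - c * px t x + tanh (\<epsilon> * x) * p t x - g (p t x)"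
    and t: "0 \<le> t" "t \<le> S"
  shows "u t x \<le> p t x"
proof -
  have "u t x - p t x \<le> 0"
  proof (rule parabolic_maximum_principle[where z = "\<lambda>t x. u t x - p t x" and S = S and B = B and k = 1
      and c = c and zt = "\<lambda>t x. ut t x - pt t x" and zx = "\<lambda>t x. ux t x - px t x"
      and zxx = "\<lambda>t x. uxx t x - pxx t x"])
    show "continuous_on ({0..S} \<times> UNIV) (\<lambda>(t, x). u t x - p t x)"
      using continuous_on_diff[OF contu contp] by (simp add: case_prod_beta)
    show "u t x - p t x \<le> B" if "0 \<le> t" "t \<le> S" for t x using bdd that .
    show "u 0 x - p 0 x \<le> 0" for x using init[of x] by simp
    fix t x assume t: "0 < t" "t \<le> S"
    show "((\<lambda>s. u s x - p s x) has_real_derivative ut t x - pt t x) (at t)"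
      "((\<lambda>x. u t x - p t x) has_real_derivative ux t x - px t x) (at x)"
      "((\<lambda>x. ux t x - px t x) has_real_derivative uxx t x - pxx t x) (at x)"
      using u[OF t, of x] p[OF t, of x] by (simp_all add: DERIV_diff)
    assume pos: "0 < u t x - p t x"
    have "g (p t x) \<le> g (u t x)" using monoD[OF g] pos by simp
    moreover have "tanh (\<epsilon> * x) * (u t x - p t x) \<le> 1 * (u t x - p t x)"
      using pos abs_tanh_le_1[of "\<epsilon> * x"] by (intro mult_right_mono) auto
    moreover have "ut t x \<le> uxx t x - c * ux t x + tanh (\<epsilon> * x) * u t x - g (u t x)"
      using u[OF t] by blast
    moreover have "pt t x \<ge> pxx t x - c * px t x + tanh (\<epsilon> * x) * p t x - g (p t x)"
      using p[OF t] by blast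
    ultimately show "ut t x - pt t x \<le> uxx t x - pxx t x - c * (ux t x - px t x) + 1 * (u t x - p t x)"
      unfolding right_diff_distrib by linarith
  qed (use t in auto)
  then show ?thesis by simp
qed

section \<open>Uniqueness of solutions bounded on compact time intervals\<close>

lemma reaction_solution_bounded_on:
  assumes "reaction_solution g c \<epsilon> T u0 u" "0 \<le> S" "ereal S < T"
  obtains B where "\<And>t x. 0 \<le> t \<Longrightarrow> t \<le> S \<Longrightarrow> \<bar>u t x\<bar> \<le> B"
proof -
  from assms obtain B where "\<forall>y\<in>(\<lambda>(t, \<zeta>). u t \<zeta>) ` ({0..S} \<times> UNIV). norm y \<le> B"
    unfolding reaction_solution_def bounded_iff by blast
  then show ?thesis by (intro that[of B]) force
qed

lemma ereal_less_le_less: "ereal S < T \<Longrightarrow> t \<le> S \<Longrightarrow> ereal t < T"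
  by (meson ereal_less_eq(3) le_less_trans)

lemma reaction_solution_continuous_on:
  assumes "reaction_solution g c \<epsilon> T u0 u" "ereal S < T"
  shows "continuous_on ({0..S} \<times> UNIV) (\<lambda>(t, x). u t x)"
  using assms unfolding reaction_solution_def
  by (elim conjE, elim continuous_on_subset) (auto dest: ereal_less_le_less)

text \<open>One half of uniqueness; exchanging the two solutions gives the other. The existence
  times differ because an arbitrary local solution will be compared with the constructed global
  one.\<close>

lemma reaction_solution_le:
  assumes g: "mono g"
    and u: "reaction_solution g c \<epsilon> T u0 u" and w: "reaction_solution g c \<epsilon> T' u0 w"
    and t: "0 \<le> t" "ereal t < T" "ereal t < T'"
  shows "u t x \<le> w t x"
proof -
  have S: "0 < s \<Longrightarrow> s \<le> t \<Longrightarrow> 0 < s \<and> ereal s < T \<and> ereal s < T'" for s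
    using t by (auto dest: ereal_less_le_less)
  obtain ut ux uxx where u': "\<forall>t \<zeta>. 0 < t \<and> ereal t < T \<longrightarrow>
           ((\<lambda>s. u s \<zeta>) has_real_derivative ut t \<zeta>) (at t) \<and>
           (u t has_real_derivative ux t \<zeta>) (at \<zeta>) \<and>
           (ux t has_real_derivative uxx t \<zeta>) (at \<zeta>) \<and>
           ut t \<zeta> = uxx t \<zeta> - c * ux t \<zeta> + tanh (\<epsilon> * \<zeta>) * u t \<zeta> - g (u t \<zeta>)"
    using u unfolding reaction_solution_def by blast
  obtain wt wx wxx where w': "\<forall>t \<zeta>. 0 < t \<and> ereal t < T' \<longrightarrow>
           ((\<lambda>s. w s \<zeta>) has_real_derivative wt t \<zeta>) (at t) \<and>
           (w t has_real_derivative wx t \<zeta>) (at \<zeta>) \<and>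
           (wx t has_real_derivative wxx t \<zeta>) (at \<zeta>) \<and>
           wt t \<zeta> = wxx t \<zeta> - c * wx t \<zeta> + tanh (\<epsilon> * \<zeta>) * w t \<zeta> - g (w t \<zeta>)"
    using w unfolding reaction_solution_def by blast
  obtain B where B: "\<And>s x. 0 \<le> s \<Longrightarrow> s \<le> t \<Longrightarrow> \<bar>u s x\<bar> \<le> B"
    using reaction_solution_bounded_on[OF u t(1,2)] by blast
  obtain B' where B': "\<And>s x. 0 \<le> s \<Longrightarrow> s \<le> t \<Longrightarrow> \<bar>w s x\<bar> \<le> B'"
    using reaction_solution_bounded_on[OF w t(1,3)] by blast
  have uw0: "u 0 x = w 0 x" for x using u w unfolding reaction_solution_def by simp
  show ?thesis
  proof (rule reaction_comparison[OF g reaction_solution_continuous_on[OF u t(2)]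
          reaction_solution_continuous_on[OF w t(3)], where B = "B + B'" and c = c and \<epsilon> = \<epsilon>
          and ut = ut and ux = ux and uxx = uxx and pt = wt and px = wx and pxx = wxx])
    show "u s x - w s x \<le> B + B'" if "0 \<le> s" "s \<le> t" for s x
      using B[OF that, of x] B'[OF that, of x] by linarith
    show "u 0 x \<le> w 0 x" for x by (simp add: uw0)
  next
    fix s x assume "0 < s" "s \<le> t"
    from S[OF this] show "((\<lambda>s. u s x) has_real_derivative ut s x) (at s) \<and>
        (u s has_real_derivative ux s x) (at x) \<and> (ux s has_real_derivative uxx s x) (at x) \<and>
        ut s x \<le> uxx s x - c * ux s x + tanh (\<epsilon> * x) * u s x - g (u s x)"
      using u' by (metis order_refl)
  next
    fix s x assume "0 < s" "s \<le> t"
    from S[OF this] show "((\<lambda>s. w s x) has_real_derivative wt s x) (at s) \<and>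
        (w s has_real_derivative wx s x) (at x) \<and> (wx s has_real_derivative wxx s x) (at x) \<and>
        wt s x \<ge> wxx s x - c * wx s x + tanh (\<epsilon> * x) * w s x - g (w s x)"
      using w' by (metis order_refl)
  qed (use t in simp_all)
qed

lemma reaction_solution_unique:
  assumes "mono g" "reaction_solution g c \<epsilon> T u0 u" "reaction_solution g c \<epsilon> T' u0 w"
    and "0 \<le> t" "ereal t < T" "ereal t < T'"
  shows "u t x = w t x"
  using reaction_solution_le[OF assms] reaction_solution_le[OF assms(1,3,2,4,6,5)] by (rule antisym)

lemma mono_cube: "mono (\<lambda>v::real. v ^ 3)"
  by (auto intro!: monoI power_mono_odd)

section \<open>Barriers around a front\<close>

text \<open>The stationary equation as a first order system, with the third component of the orbit
  already in closed form as tanh. Monotonicity carries a lower bound of \<open>U\<close> at one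
  point to everything on its right.\<close>

locale front =
  fixes c \<epsilon> :: real and U U' :: "real \<Rightarrow> real"
  assumes eps: "0 < \<epsilon>"
    and dU: "\<And>x. (U has_real_derivative U' x) (at x)"
    and dU': "\<And>x. (U' has_real_derivative c * U' x - tanh (\<epsilon> * x) * U x + U x ^ 3) (at x)"
    and U_pos: "\<And>x. 0 < U x"
    and U_le_1: "\<And>x. U x \<le> 1"
    and U_mono: "mono U"
begin

lemma continuous_U: "continuous_on A U"
  using DERIV_isCont[OF dU] by (simp add: continuous_at_imp_continuous_on)

text \<open>Linearising at the front and applying the operator to \<open>U + \<eta>\<close> gives
  \<open>- (2 U\<^sup>3 + \<eta> (3 U\<^sup>2 - \<mu>))\<close>. Far to the left this is negative because \<open>\<mu> \<approx> -1\<close>,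
  elsewhere because \<open>U\<close> is bounded away from \<open>0\<close>.\<close>

lemma linearised_supersolution:
  obtains \<eta> \<kappa> where "0 < \<eta>" "\<eta> \<le> 1" "0 < \<kappa>"
    "\<And>x. 2 * \<kappa> * (U x + \<eta>) \<le> 2 * U x ^ 3 + \<eta> * (3 * (U x)\<^sup>2 - tanh (\<epsilon> * x))"
proof -
  have "\<forall>\<^sub>F y in at_bot. tanh y < (- 1 / 2 :: real)"
    by (rule order_tendstoD(2)[OF tanh_real_at_bot]) simp
  then obtain N where N: "\<And>y. y \<le> N \<Longrightarrow> tanh y < (- 1 / 2 :: real)"
    unfolding eventually_at_bot_linorder by blast
  \<comment> \<open>At and left of N / \<epsilon> one has \<mu> < -1/2; right of it U \<ge> m. With
    \<eta> = m^3 the term 2 U^3 \<ge> 2 \<eta> outweighs there the worst loss -\<eta>, and \<kappa>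
    = \<eta> / 8 keeps the quantity to be dominated below \<eta> / 2.\<close>
  define m where "m = U (N / \<epsilon>)"
  have m: "0 < m" "m \<le> 1" unfolding m_def by (rule U_pos, rule U_le_1)
  define \<eta> where "\<eta> = m ^ 3"
  have \<eta>: "0 < \<eta>" "\<eta> \<le> 1" unfolding \<eta>_def using m by (auto intro: power_le_one)
  have "2 * (\<eta> / 8) * (U x + \<eta>) \<le> 2 * U x ^ 3 + \<eta> * (3 * (U x)\<^sup>2 - tanh (\<epsilon> * x))" for x
  proof -
    have "2 * (\<eta> / 8) * (U x + \<eta>) \<le> 2 * (\<eta> / 8) * 2"
      using \<eta> U_le_1[of x] by (intro mult_left_mono) auto
    also have "\<dots> \<le> 2 * U x ^ 3 + \<eta> * (3 * (U x)\<^sup>2 - tanh (\<epsilon> * x))"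
    proof (cases "\<epsilon> * x \<le> N")
      case True
      have "\<eta> * (1 / 2) \<le> \<eta> * (3 * (U x)\<^sup>2 - tanh (\<epsilon> * x))"
      proof (rule mult_left_mono)
        show "1 / 2 \<le> 3 * (U x)\<^sup>2 - tanh (\<epsilon> * x)"
          using N[OF True] zero_le_power2[of "U x"] by linarith
      qed (use \<eta> in simp)
      moreover have "0 < U x ^ 3" using U_pos[of x] by simp
      ultimately show ?thesis by linarith
    next
      case False
      then have "N / \<epsilon> \<le> x" using eps by (simp add: field_simps)
      then have "m \<le> U x" unfolding m_def using U_mono by (simp add: monoD)
      then have "\<eta> \<le> U x ^ 3" unfolding \<eta>_def using m by (intro power_mono) auto
      moreover have "\<eta> * (- 1) \<le> \<eta> * (3 * (U x)\<^sup>2 - tanh (\<epsilon> * x))"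
      proof (rule mult_left_mono)
        show "- 1 \<le> 3 * (U x)\<^sup>2 - tanh (\<epsilon> * x)"
          using abs_tanh_le_1[of "\<epsilon> * x"] zero_le_power2[of "U x"] by linarith
      qed (use \<eta> in simp)
      ultimately show ?thesis using \<eta> by linarith
    qed
    finally show ?thesis .
  qed
  then show ?thesis using \<eta> by (intro that[of \<eta> "\<eta> / 8"]) auto
qed

text \<open>Half of the rate 2 \<kappa> pays for the time derivative of the barriers. In the upper
  barrier the quadratic and cubic terms have the good sign. In the lower one the quadratic term 3 U
  b^2, with b = a (U + \<eta>), has the wrong sign, and 3 U b \<le> 6 A \<le> \<kappa> lets the
  second half absorb it. The condition A \<le> 1/2 keeps both barriers in [-2, 2], where
  \<open>g\<close> is the cube.\<close>

lemma front_attracts: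
  assumes g: "mono g" and g3: "\<And>v. \<bar>v\<bar> \<le> 2 \<Longrightarrow> g v = v ^ 3"
    and \<eta>: "0 < \<eta>" "\<eta> \<le> 1" and \<kappa>: "0 < \<kappa>"
    and super: "\<And>x. 2 * \<kappa> * (U x + \<eta>) \<le> 2 * U x ^ 3 + \<eta> * (3 * (U x)\<^sup>2 - tanh (\<epsilon> * x))"
    and A: "0 \<le> A" "A \<le> 1 / 2" "6 * A \<le> \<kappa>"
    and u: "reaction_solution g c \<epsilon> T u0 u"
    and u0: "\<And>x. \<bar>u0 x - U x\<bar> \<le> A * \<eta>"
    and t: "0 \<le> t" "ereal t < T"
  shows "\<bar>u t x - U x\<bar> \<le> A * exp (- \<kappa> * t) * (U x + \<eta>)"
proof -
  define a where "a s = A * exp (- \<kappa> * s)" for s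
  have a: "0 \<le> a s" "a s \<le> A" if "0 \<le> s" for s
    using A that \<kappa> unfolding a_def by (auto intro: mult_right_le_one_le)
  define p where "p \<sigma> s x = U x + \<sigma> * a s * (U x + \<eta>)" for \<sigma> s x
  define px where "px \<sigma> s x = (1 + \<sigma> * a s) * U' x" for \<sigma> s x
  define pxx where "pxx \<sigma> s x = (1 + \<sigma> * a s) * (c * U' x - tanh (\<epsilon> * x) * U x + U x ^ 3)" for \<sigma> s x
  define pt where "pt \<sigma> s x = - \<kappa> * \<sigma> * a s * (U x + \<eta>)" for \<sigma> s x
  have phi: "0 \<le> U x + \<eta>" "U x + \<eta> \<le> 2" for x using U_pos[of x] U_le_1[of x] \<eta> by linarith+
  have ap: "0 \<le> a s * (U x + \<eta>)" "a s * (U x + \<eta>) \<le> 1" if "0 \<le> s" for s x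
  proof -
    show "0 \<le> a s * (U x + \<eta>)" using a[OF that] phi by simp
    have "a s * (U x + \<eta>) \<le> (1/2) * 2"
      using a[OF that] phi A by (intro mult_mono) auto
    then show "a s * (U x + \<eta>) \<le> 1" by simp
  qed
  have contp: "continuous_on S (\<lambda>(s, x). p \<sigma> s x)" for \<sigma> S
    unfolding p_def a_def case_prod_beta
    by (intro continuous_intros continuous_on_compose2[OF continuous_U[of UNIV]]) auto
  have dp: "((\<lambda>s. p \<sigma> s x) has_real_derivative pt \<sigma> s x) (at s) \<and>
     (p \<sigma> s has_real_derivative px \<sigma> s x) (at x) \<and> (px \<sigma> s has_real_derivative pxx \<sigma> s x) (at x)" for \<sigma> s x
    unfolding p_def[abs_def] pt_def px_def[abs_def] pxx_def a_def
    by (intro conjI; (rule derivative_eq_intros dU dU' refl)+) (simp_all add: algebra_simps)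
  \<comment> \<open>Exact expansion about the front, for both barriers through \<sigma> = 1 and
    \<sigma> = -1: the terms without \<open>a\<close> cancel by the stationary equation, and a
    linear, a quadratic and a cubic part remain.\<close>
  have residual: "pxx \<sigma> s x - c * px \<sigma> s x + tanh (\<epsilon> * x) * p \<sigma> s x - p \<sigma> s x ^ 3 - pt \<sigma> s x
     = - \<sigma> * a s * (2 * U x ^ 3 + \<eta> * (3 * (U x)\<^sup>2 - tanh (\<epsilon> * x)) - \<kappa> * (U x + \<eta>))
       - 3 * U x * (\<sigma> * a s * (U x + \<eta>))\<^sup>2 - (\<sigma> * a s * (U x + \<eta>)) ^ 3" for \<sigma> s x
    unfolding p_def pt_def px_def pxx_def by algebra
  obtain B where B: "\<And>s x. 0 \<le> s \<Longrightarrow> s \<le> t \<Longrightarrow> \<bar>u s x\<bar> \<le> B"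
    using reaction_solution_bounded_on[OF u t] by blast
  obtain ut ux uxx where u': "\<forall>t \<zeta>. 0 < t \<and> ereal t < T \<longrightarrow>
           ((\<lambda>s. u s \<zeta>) has_real_derivative ut t \<zeta>) (at t) \<and>
           (u t has_real_derivative ux t \<zeta>) (at \<zeta>) \<and>
           (ux t has_real_derivative uxx t \<zeta>) (at \<zeta>) \<and>
           ut t \<zeta> = uxx t \<zeta> - c * ux t \<zeta> + tanh (\<epsilon> * \<zeta>) * u t \<zeta> - g (u t \<zeta>)"
    using u unfolding reaction_solution_def by blast
  have u'': "((\<lambda>s. u s x) has_real_derivative ut s x) (at s) \<and>
        (u s has_real_derivative ux s x) (at x) \<and> (ux s has_real_derivative uxx s x) (at x) \<and>
        ut s x = uxx s x - c * ux s x + tanh (\<epsilon> * x) * u s x - g (u s x)"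
      if "0 < s" "s \<le> t" for s x
    using u' ereal_less_le_less[OF t(2) that(2)] that(1) by blast
  have init: "u 0 x = u0 x" for x using u unfolding reaction_solution_def by simp
  \<comment> \<open>Positivity of \<open>U\<close> turns the uniform initial bound A \<eta> into the
    weighted one.\<close>
  have a0: "\<bar>u0 x - U x\<bar> \<le> a 0 * (U x + \<eta>)" for x
  proof -
    have "A * \<eta> \<le> a 0 * (U x + \<eta>)" unfolding a_def using A U_pos[of x] by (simp add: mult_left_mono)
    with u0[of x] show ?thesis by linarith
  qed
  have p_bounds: "\<bar>p 1 s x\<bar> \<le> 2" "\<bar>p (- 1) s x\<bar> \<le> 2" if "0 \<le> s" for s x
    using ap[OF that, of x] U_pos[of x] U_le_1[of x] unfolding p_def by auto
  \<comment> \<open>The surplus left after the decay in time is still at least a \<kappa> (U +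
    \<eta>).\<close>
  have gain: "0 \<le> a s * (2 * U x ^ 3 + \<eta> * (3 * (U x)\<^sup>2 - tanh (\<epsilon> * x)) - \<kappa> * (U x + \<eta>)) - a s * (\<kappa> * (U x + \<eta>))"
    if "0 \<le> s" for s x
    using a(1)[OF that] super[of x] unfolding right_diff_distrib[symmetric] by (intro mult_nonneg_nonneg) auto
  have "u t x \<le> p 1 t x"
  proof (rule reaction_comparison[OF g reaction_solution_continuous_on[OF u t(2)] contp,
        where B = "B + 2" and c = c and \<epsilon> = \<epsilon> and ut = ut and ux = ux and uxx = uxx
          and pt = "pt 1" and px = "px 1" and pxx = "pxx 1"])
    show "u s x - p 1 s x \<le> B + 2" if "0 \<le> s" "s \<le> t" for s x
      using B[OF that, of x] p_bounds(1)[OF that(1), of x] by linarith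
    show "u 0 x \<le> p 1 0 x" for x using a0[of x] by (simp add: init p_def)
  next
    fix s x assume s: "0 < s" "s \<le> t"
    show "((\<lambda>s. u s x) has_real_derivative ut s x) (at s) \<and>
        (u s has_real_derivative ux s x) (at x) \<and> (ux s has_real_derivative uxx s x) (at x) \<and>
        ut s x \<le> uxx s x - c * ux s x + tanh (\<epsilon> * x) * u s x - g (u s x)"
      using u''[OF s, of x] by (metis order_refl)
    have "0 \<le> a s * (\<kappa> * (U x + \<eta>))" using a s \<kappa> phi by simp
    moreover have "0 \<le> U x * (a s * (U x + \<eta>))\<^sup>2" "0 \<le> (a s * (U x + \<eta>)) ^ 3"
      using ap(1)[of s x] s U_pos[of x] by simp_all
    ultimately have "pxx 1 s x - c * px 1 s x + tanh (\<epsilon> * x) * p 1 s x - p 1 s x ^ 3 - pt 1 s x \<le> 0"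
      using gain[of s x] s unfolding residual mult_minus_left mult_1 by linarith
    then show "((\<lambda>s. p 1 s x) has_real_derivative pt 1 s x) (at s) \<and>
        (p 1 s has_real_derivative px 1 s x) (at x) \<and> (px 1 s has_real_derivative pxx 1 s x) (at x) \<and>
        pt 1 s x \<ge> pxx 1 s x - c * px 1 s x + tanh (\<epsilon> * x) * p 1 s x - g (p 1 s x)"
      using dp[of 1 x s] g3[OF p_bounds(1)[of s x]] s by simp
  qed (use t in auto)
  moreover have "p (- 1) t x \<le> u t x"
  proof (rule reaction_comparison[OF g contp reaction_solution_continuous_on[OF u t(2)],
        where B = "B + 2" and c = c and \<epsilon> = \<epsilon> and pt = ut and px = ux and pxx = uxx
          and ut = "pt (- 1)" and ux = "px (- 1)" and uxx = "pxx (- 1)"])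
    show "p (- 1) s x - u s x \<le> B + 2" if "0 \<le> s" "s \<le> t" for s x
      using B[OF that, of x] p_bounds(2)[OF that(1), of x] by linarith
    show "p (- 1) 0 x \<le> u 0 x" for x using a0[of x] by (simp add: init p_def)
  next
    fix s x assume s: "0 < s" "s \<le> t"
    show "((\<lambda>s. u s x) has_real_derivative ut s x) (at s) \<and>
        (u s has_real_derivative ux s x) (at x) \<and> (ux s has_real_derivative uxx s x) (at x) \<and>
        ut s x \<ge> uxx s x - c * ux s x + tanh (\<epsilon> * x) * u s x - g (u s x)"
      using u''[OF s, of x] by (metis order_refl)
    define b where "b = a s * (U x + \<eta>)"
    have b: "0 \<le> b" using ap(1) s unfolding b_def by simp
    have "3 * (U x * b) \<le> 3 * (1 * (A * 2))"
      unfolding b_def using U_pos[of x] U_le_1[of x] a[of s] s phi ap A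
      by (intro mult_left_mono mult_mono) auto
    also have "\<dots> \<le> \<kappa>" using A by simp
    finally have "b * (3 * (U x * b)) \<le> b * \<kappa>" using b by (rule mult_left_mono)
    then have "3 * U x * b\<^sup>2 \<le> a s * (\<kappa> * (U x + \<eta>))"
      unfolding b_def by (simp add: power2_eq_square algebra_simps)
    moreover have "0 \<le> b ^ 3" using b by simp
    moreover have sq: "(- 1 * a s * (U x + \<eta>))\<^sup>2 = b\<^sup>2" and cube: "(- 1 * a s * (U x + \<eta>)) ^ 3 = - (b ^ 3)"
      unfolding b_def by (simp_all add: power2_eq_square power3_eq_cube)
    ultimately have "0 \<le> pxx (- 1) s x - c * px (- 1) s x + tanh (\<epsilon> * x) * p (- 1) s x - p (- 1) s x ^ 3 - pt (- 1) s x"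
      using gain[of s x] s unfolding residual sq cube minus_minus mult_1 by linarith
    then show "((\<lambda>s. p (- 1) s x) has_real_derivative pt (- 1) s x) (at s) \<and>
        (p (- 1) s has_real_derivative px (- 1) s x) (at x) \<and> (px (- 1) s has_real_derivative pxx (- 1) s x) (at x) \<and>
        pt (- 1) s x \<le> pxx (- 1) s x - c * px (- 1) s x + tanh (\<epsilon> * x) * p (- 1) s x - g (p (- 1) s x)"
      using dp[of "- 1" x s] g3[OF p_bounds(2)[of s x]] s by simp
  qed (use t in auto)
  ultimately show ?thesis unfolding p_def a_def by (simp add: abs_le_iff)
qed

end

section \<open>From heteroclinic orbits to fronts\<close>

lemma DERIV_tanh_scaled:
  "((\<lambda>x. tanh (\<epsilon> * x)) has_real_derivative \<epsilon> * (1 - (tanh (\<epsilon> * x :: real))\<^sup>2)) (at x)"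
  by (auto intro!: derivative_eq_intros)

text \<open>The squared difference to tanh solves a linear equation with bounded coefficient and
  vanishes at 0; the integrating factors exp (- K x) and exp (K x) give Gronwall's argument forwards
  and backwards. The bound on \<open>m\<close> makes the coefficient bounded.\<close>

lemma riccati_eq_tanh:
  fixes m :: "real \<Rightarrow> real"
  assumes dm: "\<And>x. (m has_real_derivative \<epsilon> * (1 - (m x)\<^sup>2)) (at x)"
    and "m 0 = 0" and B: "\<And>x. \<bar>m x\<bar> \<le> B"
  shows "m x = tanh (\<epsilon> * x)"
proof -
  define d where "d x = m x - tanh (\<epsilon> * x)" for x
  define K where "K = 2 * \<bar>\<epsilon>\<bar> * (B + 1)"
  have dd: "((\<lambda>x. (d x)\<^sup>2) has_real_derivative - 2 * \<epsilon> * (m x + tanh (\<epsilon> * x)) * (d x)\<^sup>2) (at x)" for x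
    unfolding d_def
    by (rule DERIV_tanh_scaled dm derivative_eq_intros refl)+ (simp_all add: power2_eq_square algebra_simps)
  have K: "\<bar>- 2 * \<epsilon> * (m x + tanh (\<epsilon> * x)) * (d x)\<^sup>2\<bar> \<le> K * (d x)\<^sup>2" for x
  proof -
    have "\<bar>m x + tanh (\<epsilon> * x)\<bar> \<le> B + 1"
      using B[of x] abs_tanh_le_1[of "\<epsilon> * x"] by linarith
    then show ?thesis unfolding K_def abs_mult by (simp add: mult_mono')
  qed
  have "(d x)\<^sup>2 = 0"
  proof (cases "0 \<le> x")
    case True
    have "(d x)\<^sup>2 * exp (- K * x) \<le> (d 0)\<^sup>2 * exp (- K * 0)"
    proof (rule DERIV_nonpos_imp_nonincreasing[OF True])
      fix y
      have "((\<lambda>x. (d x)\<^sup>2 * exp (- K * x)) has_real_derivative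
          (- 2 * \<epsilon> * (m y + tanh (\<epsilon> * y)) * (d y)\<^sup>2 - K * (d y)\<^sup>2) * exp (- K * y)) (at y)"
        by (rule derivative_eq_intros dd refl)+ (simp add: algebra_simps)
      moreover have "(- 2 * \<epsilon> * (m y + tanh (\<epsilon> * y)) * (d y)\<^sup>2 - K * (d y)\<^sup>2) * exp (- K * y) \<le> 0"
        using K[of y] by (intro mult_nonpos_nonneg) auto
      ultimately show "\<exists>l. ((\<lambda>x. (d x)\<^sup>2 * exp (- K * x)) has_real_derivative l) (at y) \<and> l \<le> 0" by blast
    qed
    then show ?thesis using \<open>m 0 = 0\<close> by (simp add: d_def mult_le_0_iff)
  next
    case False
    then have "x \<le> 0" by simp
    have "(d x)\<^sup>2 * exp (K * x) \<le> (d 0)\<^sup>2 * exp (K * 0)"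
    proof (rule DERIV_nonneg_imp_nondecreasing[OF \<open>x \<le> 0\<close>])
      fix y
      have "((\<lambda>x. (d x)\<^sup>2 * exp (K * x)) has_real_derivative
          (- 2 * \<epsilon> * (m y + tanh (\<epsilon> * y)) * (d y)\<^sup>2 + K * (d y)\<^sup>2) * exp (K * y)) (at y)"
        by (rule derivative_eq_intros dd refl)+ (simp add: algebra_simps)
      moreover have "0 \<le> (- 2 * \<epsilon> * (m y + tanh (\<epsilon> * y)) * (d y)\<^sup>2 + K * (d y)\<^sup>2) * exp (K * y)"
        using K[of y] by (intro mult_nonneg_nonneg) auto
      ultimately show "\<exists>l. ((\<lambda>x. (d x)\<^sup>2 * exp (K * x)) has_real_derivative l) (at y) \<and> 0 \<le> l" by blast
    qed
    then show ?thesis using \<open>m 0 = 0\<close> by (simp add: d_def mult_le_0_iff)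
  qed
  then show ?thesis by (simp add: d_def)
qed

lemma continuous_with_limits_bounded:
  fixes f :: "real \<Rightarrow> real"
  assumes cont: "continuous_on UNIV f" and bot: "(f \<longlongrightarrow> a) at_bot" and top: "(f \<longlongrightarrow> b) at_top"
  obtains B where "\<And>x. \<bar>f x\<bar> \<le> B"
proof -
  have "\<forall>\<^sub>F x in at_bot. dist (f x) a < 1" "\<forall>\<^sub>F x in at_top. dist (f x) b < 1"
    by (rule tendstoD[OF bot] tendstoD[OF top], simp)+
  then obtain M N where M: "\<And>x. x \<le> M \<Longrightarrow> dist (f x) a < 1" and N: "\<And>x. N \<le> x \<Longrightarrow> dist (f x) b < 1"
    unfolding eventually_at_bot_linorder eventually_at_top_linorder by blast
  have "bounded (f ` {M..N})"
    by (intro compact_imp_bounded compact_continuous_image continuous_on_subset[OF cont]) auto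
  then obtain C where C: "\<And>x. M \<le> x \<Longrightarrow> x \<le> N \<Longrightarrow> \<bar>f x\<bar> \<le> C"
    unfolding bounded_iff by (metis atLeastAtMost_iff imageI real_norm_def)
  have "\<bar>f x\<bar> \<le> max C (max (\<bar>a\<bar> + 1) (\<bar>b\<bar> + 1))" for x
    using M[of x] N[of x] C[of x] unfolding dist_real_def by linarith
  then show ?thesis by (rule that)
qed

text \<open>The third equation decouples, and \<mu>(0) = 0 fixes its bounded solution as tanh;
  monotonicity and the limit 1 at +\<infinity> give U \<le> 1.\<close>

lemma heteroclinic_front_imp_front:
  assumes eps: "0 < \<epsilon>" and X: "heteroclinic_front c \<epsilon> X"
  shows "front c \<epsilon> (\<lambda>x. fst (X x)) (\<lambda>x. fst (snd (X x)))"
proof -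
  define m where "m x = snd (snd (X x))" for x
  have dX: "(X has_vector_derivative front_field c \<epsilon> (X x)) (at x)" for x
    using X unfolding heteroclinic_front_def by blast
  have field: "front_field c \<epsilon> (X x) =
      (fst (snd (X x)), c * fst (snd (X x)) - m x * fst (X x) + fst (X x) ^ 3, \<epsilon> * (1 - (m x)\<^sup>2))" for x
    unfolding front_field_def m_def by (simp add: case_prod_beta)
  note d1 = bounded_linear.has_vector_derivative[OF bounded_linear_fst dX]
    and d2 = bounded_linear.has_vector_derivative[OF bounded_linear_snd dX]
  note d3 = bounded_linear.has_vector_derivative[OF bounded_linear_fst d2]
    and d4 = bounded_linear.has_vector_derivative[OF bounded_linear_snd d2]
  have dm: "(m has_real_derivative \<epsilon> * (1 - (m x)\<^sup>2)) (at x)" for x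
    using d4[of x] unfolding field has_real_derivative_iff_has_vector_derivative m_def[abs_def] by simp
  have bot: "(X \<longlongrightarrow> (0, 0, - 1)) at_bot" and top: "(X \<longlongrightarrow> (1, 0, 1)) at_top"
    using X unfolding heteroclinic_front_def by blast+
  have "(m \<longlongrightarrow> - 1) at_bot" "(m \<longlongrightarrow> 1) at_top"
    using tendsto_snd[OF tendsto_snd[OF bot]] tendsto_snd[OF tendsto_snd[OF top]]
    unfolding m_def[abs_def] by simp_all
  moreover have "continuous_on UNIV m"
    using DERIV_isCont[OF dm] by (simp add: continuous_at_imp_continuous_on)
  ultimately obtain B where "\<And>x. \<bar>m x\<bar> \<le> B"
    using continuous_with_limits_bounded by blast
  moreover have "m 0 = 0" using X unfolding heteroclinic_front_def m_def by blast
  ultimately have m: "m x = tanh (\<epsilon> * x)" for x using riccati_eq_tanh[OF dm] by blast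
  have mono: "mono (\<lambda>x. fst (X x))" using X unfolding heteroclinic_front_def by blast
  show ?thesis
  proof
    show "0 < \<epsilon>" by (rule eps)
    show "((\<lambda>x. fst (X x)) has_real_derivative fst (snd (X x))) (at x)" for x
      using d1[of x] unfolding field has_real_derivative_iff_has_vector_derivative by simp
    show "((\<lambda>x. fst (snd (X x))) has_real_derivative
        c * fst (snd (X x)) - tanh (\<epsilon> * x) * fst (X x) + fst (X x) ^ 3) (at x)" for x
      using d3[of x] unfolding field has_real_derivative_iff_has_vector_derivative m by simp
    show "0 < fst (X x)" for x using X unfolding heteroclinic_front_def by blast
    show "mono (\<lambda>x. fst (X x))" by (rule mono)
    show "fst (X x) \<le> 1" for x
    proof (rule tendsto_lowerbound)
      show "((\<lambda>x. fst (X x)) \<longlongrightarrow> 1) at_top" using tendsto_fst[OF top] by simp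
      show "\<forall>\<^sub>F y in at_top. fst (X x) \<le> fst (X y)"
        using eventually_ge_at_top[of x] by eventually_elim (rule monoD[OF mono])
    qed simp
  qed
qed

section \<open>Integrals depending on a parameter\<close>

text \<open>In a first countable space the limit can be tested on sequences; conditions that hold
  only near \<open>p\<close> hold along a tail, and the shift by N discards the rest.\<close>

lemma tendsto_integral_dominated:
  fixes f :: "'b::first_countable_topology \<Rightarrow> 'a \<Rightarrow> real"
  assumes meas: "\<forall>\<^sub>F q in at p within S. f q \<in> borel_measurable M"
    and dom: "\<forall>\<^sub>F q in at p within S. AE z in M. norm (f q z) \<le> w z"
    and l: "l \<in> borel_measurable M" and w: "integrable M w"
    and lim: "AE z in M. ((\<lambda>q. f q z) \<longlongrightarrow> l z) (at p within S)"
  shows "((\<lambda>q. integral\<^sup>L M (f q)) \<longlongrightarrow> integral\<^sup>L M l) (at p within S)"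
  unfolding tendsto_at_iff_sequentially
proof (intro allI impI)
  fix X assume X: "\<forall>i. X i \<in> S - {p}" "X \<longlonglongrightarrow> p"
  have flt: "filterlim X (at p within S) sequentially"
    using X by (simp add: filterlim_at)
  have "\<forall>\<^sub>F i in sequentially. f (X i) \<in> borel_measurable M \<and> (AE z in M. norm (f (X i) z) \<le> w z)"
    using eventually_conj[OF meas dom] flt by (rule eventually_compose_filterlim)
  then obtain N where N: "\<And>i. f (X (i + N)) \<in> borel_measurable M"
    "\<And>i. AE z in M. norm (f (X (i + N)) z) \<le> w z"
    unfolding eventually_sequentially by (metis le_add2)
  have "(\<lambda>i. integral\<^sup>L M (f (X (i + N)))) \<longlonglongrightarrow> integral\<^sup>L M l"
  proof (rule integral_dominated_convergence[OF l _ w])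
    show "AE z in M. (\<lambda>i. f (X (i + N)) z) \<longlonglongrightarrow> l z"
      using lim by eventually_elim (rule LIMSEQ_ignore_initial_segment[OF filterlim_compose[OF _ flt]])
  qed (use N in auto)
  then show "((\<lambda>q. integral\<^sup>L M (f q)) \<circ> X) \<longlonglongrightarrow> integral\<^sup>L M l"
    unfolding o_def by (rule LIMSEQ_offset)
qed

text \<open>The majorant may depend on the point: continuity is local, and the kernels below have
  singularities at the edge of the parameter set.\<close>

lemma continuous_on_integral_dominated:
  fixes f :: "'b::first_countable_topology \<Rightarrow> 'a \<Rightarrow> real"
  assumes meas: "\<And>q. q \<in> S \<Longrightarrow> f q \<in> borel_measurable M"
    and dom: "\<And>p. p \<in> S \<Longrightarrow> \<exists>w. integrable M w \<and> (\<forall>\<^sub>F q in at p within S. AE z in M. norm (f q z) \<le> w z)"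
    and cont: "AE z in M. continuous_on S (\<lambda>q. f q z)"
  shows "continuous_on S (\<lambda>q. integral\<^sup>L M (f q))"
  unfolding continuous_on_def
proof
  fix p assume p: "p \<in> S"
  from dom[OF p] obtain w where w: "integrable M w"
    "\<forall>\<^sub>F q in at p within S. AE z in M. norm (f q z) \<le> w z" by blast
  show "((\<lambda>q. integral\<^sup>L M (f q)) \<longlongrightarrow> integral\<^sup>L M (f p)) (at p within S)"
  proof (rule tendsto_integral_dominated[OF _ w(2) meas[OF p] w(1)])
    show "\<forall>\<^sub>F q in at p within S. f q \<in> borel_measurable M"
      using meas by (simp add: eventually_at_filter)
    show "AE z in M. ((\<lambda>q. f q z) \<longlongrightarrow> f p z) (at p within S)"
      using cont by eventually_elim (use p in \<open>auto simp: continuous_on_def\<close>)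
  qed
qed

text \<open>The mean value inequality bounds the difference quotients by the majorant of the
  derivative.\<close>

lemma has_real_derivative_integral_dominated:
  fixes f f' :: "real \<Rightarrow> 'a \<Rightarrow> real"
  assumes d: "0 < d"
    and int: "\<And>y. y \<in> ball x d \<Longrightarrow> integrable M (f y)"
    and der: "AE z in M. \<forall>y\<in>ball x d. ((\<lambda>y. f y z) has_real_derivative f' y z) (at y)"
    and dom: "AE z in M. \<forall>y\<in>ball x d. \<bar>f' y z\<bar> \<le> w z"
    and w: "integrable M w" and meas: "f' x \<in> borel_measurable M"
  shows "((\<lambda>y. integral\<^sup>L M (f y)) has_real_derivative integral\<^sup>L M (f' x)) (at x)"
proof -
  have x: "x \<in> ball x d" using d by simp
  have near: "\<forall>\<^sub>F y in at x. y \<in> ball x d \<and> y \<noteq> x"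
    using d by (auto simp: eventually_at dist_commute intro!: exI[of _ d])
  have "((\<lambda>y. integral\<^sup>L M (\<lambda>z. (f y z - f x z) / (y - x))) \<longlongrightarrow> integral\<^sup>L M (f' x)) (at x)"
  proof (rule tendsto_integral_dominated[OF _ _ meas w])
    show "\<forall>\<^sub>F y in at x. (\<lambda>z. (f y z - f x z) / (y - x)) \<in> borel_measurable M"
      using near
    proof eventually_elim
      case (elim y)
      then show ?case using int[of y] int[OF x] by auto
    qed
    show "\<forall>\<^sub>F y in at x. AE z in M. norm ((f y z - f x z) / (y - x)) \<le> w z"
      using near
    proof eventually_elim
      case (elim y)
      show ?case using der dom
      proof eventually_elim
        case (elim z)
        have "norm (f y z - f x z) \<le> w z * norm (y - x)"
          by (rule field_differentiable_bound[of "ball x d" "\<lambda>y. f y z" "\<lambda>y. f' y z"])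
            (use elim \<open>y \<in> ball x d \<and> y \<noteq> x\<close> x in \<open>auto intro: has_field_derivative_at_within\<close>)
        then show ?case using \<open>y \<in> ball x d \<and> y \<noteq> x\<close> by (simp add: field_simps)
      qed
    qed
    show "AE z in M. ((\<lambda>y. (f y z - f x z) / (y - x)) \<longlongrightarrow> f' x z) (at x)"
      using der by eventually_elim (use x in \<open>auto simp: has_field_derivative_iff\<close>)
  qed
  moreover have "\<forall>\<^sub>F y in at x. integral\<^sup>L M (\<lambda>z. (f y z - f x z) / (y - x))
      = (integral\<^sup>L M (f y) - integral\<^sup>L M (f x)) / (y - x)"
    using near by eventually_elim (use int x in simp)
  ultimately show ?thesis unfolding has_field_derivative_iff
    by (rule Lim_transform_eventually)
qed

text \<open>One Gaussian in y dominates all those whose centre and width are close to a0 and s0.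
  From (y - a0)^2 \<le> 2 (y - a)^2 + 2 (a - a0)^2 and s \<le> 2 s0 one gets (y - a0)^2 \<le> (8 v^2
  + 2) s0^2; division by 32 s0^2 leaves 1/16, which the factor exp 1 covers.\<close>

lemma exp_minus_square_shift:
  fixes v y a a0 s s0 :: real
  assumes "0 < s0" "s0 / 2 \<le> s" "s \<le> 2 * s0" "\<bar>a - a0\<bar> \<le> s0" and v: "v = (y - a) / s"
  shows "exp (- v\<^sup>2 / 4) \<le> exp 1 * exp (- (y - a0)\<^sup>2 / (32 * s0\<^sup>2))"
proof -
  have s: "0 < s" using assms by simp
  have "(y - a0)\<^sup>2 \<le> 2 * (y - a)\<^sup>2 + 2 * (a - a0)\<^sup>2"
    using zero_le_power2[of "y - a - (a - a0)"] by (simp add: power2_eq_square algebra_simps)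
  also have "(a - a0)\<^sup>2 \<le> s0\<^sup>2" using assms(1,4) by (metis power_mono abs_ge_zero power2_abs)
  also have "(y - a)\<^sup>2 = v\<^sup>2 * s\<^sup>2" using s v by (simp add: power_divide)
  also have "v\<^sup>2 * s\<^sup>2 \<le> v\<^sup>2 * (2 * s0)\<^sup>2"
    using assms s by (intro mult_left_mono power_mono) auto
  finally have "(y - a0)\<^sup>2 \<le> (8 * v\<^sup>2 + 2) * s0\<^sup>2" by (simp add: algebra_simps power2_eq_square)
  then have "(y - a0)\<^sup>2 / (32 * s0\<^sup>2) \<le> v\<^sup>2 / 4 + 1 / 16"
    using assms(1) by (simp add: field_simps)
  then have "- v\<^sup>2 / 4 \<le> 1 + - (y - a0)\<^sup>2 / (32 * s0\<^sup>2)" by linarith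
  then show ?thesis by (simp flip: exp_add)
qed

lemma integrable_exp_minus_square:
  assumes "0 < s0"
  shows "integrable lborel (\<lambda>y::real. exp (- (y - a0)\<^sup>2 / (32 * s0\<^sup>2)))"
proof -
  \<comment> \<open>Since 32 s0^2 = 2 (4 s0)^2, this is an unnormalised normal density of standard
    deviation 4 s0.\<close>
  have "(\<lambda>y. exp (- (y - a0)\<^sup>2 / (32 * s0\<^sup>2))) =
      (\<lambda>y. sqrt (2 * pi * (4 * s0)\<^sup>2) * normal_density a0 (4 * s0) y)"
    using assms by (auto simp: normal_density_def fun_eq_iff power_mult_distrib)
  then show ?thesis using integrable_normal_density[of "4 * s0" a0] assms by simp
qed

text \<open>Differentiating \<open>\<integral> \<psi>(z) h(a + s z) dz\<close> along a curve \<open>(a, s)\<close>: in the variable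
  \<open>y = a + s z\<close> all dependence on the parameter sits in \<open>\<psi>\<close>, so \<open>h\<close> need not be
  differentiable.\<close>

lemma DERIV_integral_affine_kernel:
  fixes \<psi> \<psi>' h a s a' s' :: "real \<Rightarrow> real"
  assumes d\<psi>: "\<And>z. (\<psi> has_real_derivative \<psi>' z) (at z)"
    and \<psi>'_cont: "continuous_on UNIV \<psi>'"
    and \<psi>: "\<And>z. \<bar>\<psi> z\<bar> \<le> C * exp (- z\<^sup>2 / 4)"
    and \<psi>': "\<And>z. \<bar>\<psi>' z\<bar> * (1 + \<bar>z\<bar>) \<le> C * exp (- z\<^sup>2 / 4)"
    and h: "continuous_on UNIV h" "\<And>y. \<bar>h y\<bar> \<le> B"
    and U: "open U" "t \<in> U"
    and da: "\<And>t. t \<in> U \<Longrightarrow> (a has_real_derivative a' t) (at t)" and a': "continuous_on U a'"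
    and ds: "\<And>t. t \<in> U \<Longrightarrow> (s has_real_derivative s' t) (at t)" and s': "continuous_on U s'"
    and s: "0 < s t"
  shows "((\<lambda>t. \<integral>z. \<psi> z * h (a t + s t * z) \<partial>lborel) has_real_derivative
     - (\<integral>z. (\<psi>' z * (a' t + z * s' t) + \<psi> z * s' t) / s t * h (a t + s t * z) \<partial>lborel)) (at t)"
proof -
  \<comment> \<open>A bound for the velocities of centre and scale near t. The neighbourhood also
    keeps the scale within a factor 2 of \<open>s t\<close> and the centre within distance
    \<open>s t\<close>, as the Gaussian majorant requires.\<close>
  define N where "N = \<bar>a' t\<bar> + \<bar>s' t\<bar> + 1"
  have "isCont a' t" "isCont s' t" "isCont a t" "isCont s t"
    using continuous_on_eq_continuous_at[OF U(1)] a' s' U(2) DERIV_isCont[OF da[OF U(2)]] DERIV_isCont[OF ds[OF U(2)]]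
    by blast+
  note lims = this[unfolded isCont_def]
  have "\<forall>\<^sub>F q in at t. q \<in> U \<and> dist (a' q) (a' t) < 1 \<and> dist (s' q) (s' t) < 1 \<and> dist (a q) (a t) < s t \<and> dist (s q) (s t) < s t / 2"
    using s eventually_at_in_open'[OF U] by (intro eventually_conj tendstoD[OF lims(1)] tendstoD[OF lims(2)] tendstoD[OF lims(3)] tendstoD[OF lims(4)]) auto
  then obtain d where d: "d > 0" and d': "\<And>q. q \<noteq> t \<Longrightarrow> dist q t < d \<Longrightarrow> q \<in> U \<and> dist (a' q) (a' t) < 1 \<and> dist (s' q) (s' t) < 1 \<and> dist (a q) (a t) < s t \<and> dist (s q) (s t) < s t / 2"
    unfolding eventually_at by blast
  have near: "q \<in> U" "\<bar>a' q\<bar> \<le> N" "\<bar>s' q\<bar> \<le> N" "\<bar>a q - a t\<bar> \<le> s t" "s t / 2 \<le> s q" "s q \<le> 2 * s t" "0 < s q"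
    if "q \<in> ball t d" for q
    using d'[of q] that s U(2) unfolding N_def
    by (cases "q = t"; simp add: dist_commute; auto simp: dist_real_def abs_if split: if_splits)+
  \<comment> \<open>The integrand in the variable y = a + s z, with its Jacobian 1 / s;
    \<open>k'\<close> is the derivative in the parameter. The same substitution leads back at the
    end.\<close>
  define k where "k q y = \<psi> ((y - a q) / s q) / s q * h y" for q y
  define k' where "k' q y = (\<psi>' ((y - a q) / s q) * ((- a' q * s q - (y - a q) * s' q) / (s q * s q)) / s q
      - \<psi> ((y - a q) / s q) * s' q / (s q * s q)) * h y" for q y
  define G where "G y = exp (- (y - a t)\<^sup>2 / (32 * (s t)\<^sup>2))" for y
  have G: "integrable lborel G" unfolding G_def using integrable_exp_minus_square[OF s] .
  have C: "0 \<le> C" using \<psi>[of 0] by simp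
  have B: "0 \<le> B" using h(2)[of 0] by linarith
  have \<psi>_cont: "continuous_on UNIV \<psi>" using DERIV_isCont[OF d\<psi>] by (simp add: continuous_at_imp_continuous_on)
  have kmeas: "k q \<in> borel_measurable lborel" and k'meas: "k' q \<in> borel_measurable lborel" if "q \<in> ball t d" for q
    unfolding k_def k'_def using near(7)[OF that]
    by (auto intro!: borel_measurable_continuous_onI continuous_intros continuous_on_compose2[OF \<psi>_cont]
        continuous_on_compose2[OF \<psi>'_cont] h)
  have G_bound: "exp (- ((y - a q) / s q)\<^sup>2 / 4) \<le> exp 1 * G y" if "q \<in> ball t d" for q y
    unfolding G_def using exp_minus_square_shift[OF s near(5,6,4)[OF that] refl] .
  have k_int: "integrable lborel (k q)" if "q \<in> ball t d" for q
  proof (rule Bochner_Integration.integrable_bound)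
    show "integrable lborel (\<lambda>y. C * exp 1 * B / s q * G y)" using G by simp
    have "norm (k q y) \<le> C * (exp 1 * G y) / s q * B" for y
    proof -
      have "\<bar>\<psi> ((y - a q) / s q)\<bar> \<le> C * (exp 1 * G y)"
        using \<psi>[of "(y - a q) / s q"] mult_left_mono[OF G_bound[OF that, of y] C] by linarith
      then show ?thesis unfolding k_def using near(7)[OF that] h(2)[of y] B C
        by (simp add: abs_mult) (intro mult_mono divide_right_mono, auto simp: G_def)
    qed
    then show "AE y in lborel. norm (k q y) \<le> norm (C * exp 1 * B / s q * G y)"
      using C B near(7)[OF that] by (auto simp: G_def abs_mult mult_ac)
  qed (rule kmeas[OF that])
  have k'_bound: "\<bar>k' q y\<bar> \<le> 2 * C * exp 1 * N / (s t / 2)\<^sup>2 * B * G y" if q: "q \<in> ball t d" for q y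
  proof -
    \<comment> \<open>Expressed in v, the moving scale contributes the product v \<psi>'(v); this is
      why the decay of \<psi>' is assumed with the factor 1 + |z|.\<close>
    define v where "v = (y - a q) / s q"
    have sq: "0 < s q" by (rule near(7)[OF q])
    have N0: "0 \<le> N" unfolding N_def by simp
    have "k' q y = - (\<psi>' v * (a' q + v * s' q) + \<psi> v * s' q) / (s q)\<^sup>2 * h y"
      unfolding k'_def v_def[symmetric] using sq
      by (simp add: v_def power2_eq_square field_simps)
    also have "\<bar>\<dots>\<bar> \<le> (2 * (C * (exp 1 * G y)) * N) / (s t / 2)\<^sup>2 * B"
    proof -
      have "\<bar>\<psi>' v * (a' q + v * s' q) + \<psi> v * s' q\<bar> \<le> \<bar>\<psi>' v\<bar> * ((1 + \<bar>v\<bar>) * N) + \<bar>\<psi> v\<bar> * N"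
      proof -
        have "\<bar>a' q + v * s' q\<bar> \<le> (1 + \<bar>v\<bar>) * N"
          using near(2,3)[OF q] mult_left_mono[OF near(3)[OF q], of "\<bar>v\<bar>"]
          by (simp add: distrib_right abs_mult[symmetric])
        then have "\<bar>\<psi>' v\<bar> * \<bar>a' q + v * s' q\<bar> \<le> \<bar>\<psi>' v\<bar> * ((1 + \<bar>v\<bar>) * N)"
          by (rule mult_left_mono) simp
        moreover have "\<bar>\<psi> v\<bar> * \<bar>s' q\<bar> \<le> \<bar>\<psi> v\<bar> * N"
          using near(3)[OF q] by (rule mult_left_mono) simp
        ultimately show ?thesis
          using abs_triangle_ineq[of "\<psi>' v * (a' q + v * s' q)" "\<psi> v * s' q"] by (simp add: abs_mult)
      qed
      also have "\<dots> = (\<bar>\<psi>' v\<bar> * (1 + \<bar>v\<bar>) + \<bar>\<psi> v\<bar>) * N" by (simp add: algebra_simps)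
      also have "\<dots> \<le> (2 * (C * (exp 1 * G y))) * N"
        using \<psi>[of v] \<psi>'[of v] mult_left_mono[OF G_bound[OF q, of y] C] unfolding v_def[symmetric]
        by (intro mult_right_mono N0) linarith
      finally have "\<bar>\<psi>' v * (a' q + v * s' q) + \<psi> v * s' q\<bar> / (s q)\<^sup>2 \<le> (2 * (C * (exp 1 * G y))) * N / (s t / 2)\<^sup>2"
        using near(5)[OF q] s N0 C by (intro frac_le power_mono) (auto simp: G_def)
      then show ?thesis unfolding abs_mult abs_divide abs_minus_cancel
        using h(2)[of y] N0 C by (intro mult_mono) (auto simp: G_def)
    qed
    finally show ?thesis by (simp add: mult_ac)
  qed
  have deriv: "((\<lambda>q. integral\<^sup>L lborel (k q)) has_real_derivative integral\<^sup>L lborel (k' t)) (at t)"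
  proof (rule has_real_derivative_integral_dominated[OF d k_int _ _ _ k'meas])
    show "AE y in lborel. \<forall>q\<in>ball t d. ((\<lambda>q. k q y) has_real_derivative k' q y) (at q)"
    proof (intro AE_I2 ballI)
      fix y q assume q: "q \<in> ball t d"
      have "((\<lambda>q. (y - a q) / s q) has_real_derivative (- a' q * s q - (y - a q) * s' q) / (s q * s q)) (at q)"
        by (rule da ds derivative_eq_intros refl near(1)[OF q])+ (use near(7)[OF q] in auto)
      then have "((\<lambda>q. \<psi> ((y - a q) / s q)) has_real_derivative
          \<psi>' ((y - a q) / s q) * ((- a' q * s q - (y - a q) * s' q) / (s q * s q))) (at q)"
        by (rule DERIV_chain2[OF d\<psi>])
      from DERIV_divide[OF this ds[OF near(1)[OF q]]] near(7)[OF q]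
      have "((\<lambda>q. \<psi> ((y - a q) / s q) / s q) has_real_derivative
          (\<psi>' ((y - a q) / s q) * ((- a' q * s q - (y - a q) * s' q) / (s q * s q)) * s q
            - \<psi> ((y - a q) / s q) * s' q) / (s q * s q)) (at q)" by simp
      from DERIV_cmult_right[OF this, of "h y"]
      show "((\<lambda>q. k q y) has_real_derivative k' q y) (at q)"
        unfolding k_def k'_def using near(7)[OF q] by (simp add: diff_divide_distrib)
    qed
    show "AE y in lborel. \<forall>q\<in>ball t d. \<bar>k' q y\<bar> \<le> 2 * C * exp 1 * N / (s t / 2)\<^sup>2 * B * G y"
      using k'_bound by auto
    show "integrable lborel (\<lambda>y. 2 * C * exp 1 * N / (s t / 2)\<^sup>2 * B * G y)" using G by simp
  qed (use d in simp_all)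
  have k't: "integral\<^sup>L lborel (k' t) = - (\<integral>z. (\<psi>' z * (a' t + z * s' t) + \<psi> z * s' t) / s t * h (a t + s t * z) \<partial>lborel)"
  proof -
    have "integral\<^sup>L lborel (k' t) = \<bar>s t\<bar> *\<^sub>R (\<integral>z. k' t (a t + s t * z) \<partial>lborel)"
      using s by (intro lborel_integral_real_affine) simp
    also have "\<dots> = (\<integral>z. s t * k' t (a t + s t * z) \<partial>lborel)" using s by simp
    also have "\<dots> = (\<integral>z. - ((\<psi>' z * (a' t + z * s' t) + \<psi> z * s' t) / s t * h (a t + s t * z)) \<partial>lborel)"
      using s by (intro Bochner_Integration.integral_cong) (simp_all add: k'_def field_simps)
    finally show ?thesis by simp
  qed
  have ev: "\<forall>\<^sub>F q in nhds t. integral\<^sup>L lborel (k q) = (\<integral>z. \<psi> z * h (a q + s q * z) \<partial>lborel)"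
  proof -
    have "\<forall>\<^sub>F q in nhds t. q \<in> ball t d" using d by (intro eventually_nhds_in_open) auto
    then show ?thesis
    proof eventually_elim
      case (elim q)
      have "integral\<^sup>L lborel (k q) = \<bar>s q\<bar> *\<^sub>R (\<integral>z. k q (a q + s q * z) \<partial>lborel)"
        using near(7)[OF elim] by (intro lborel_integral_real_affine) simp
      also have "\<dots> = (\<integral>z. s q * k q (a q + s q * z) \<partial>lborel)" using near(7)[OF elim] by simp
      also have "\<dots> = (\<integral>z. \<psi> z * h (a q + s q * z) \<partial>lborel)"
        using near(7)[OF elim] by (intro Bochner_Integration.integral_cong) (simp_all add: k_def)
      finally show ?case .
    qed
  qed
  show ?thesis using deriv unfolding DERIV_cong_ev[OF refl ev refl] k't .
qed

section \<open>The heat semigroup with drift\<close>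

text \<open>Hermite functions: minus the first derivative of the Gaussian density, and in
  \<open>gauss2\<close> its second derivative. With these signs each x derivative of a heat average
  passes to the next weight and divides by sqrt (2 r).\<close>

definition gauss1 :: "real \<Rightarrow> real" where "gauss1 z = z * std_normal_density z"
definition gauss2 :: "real \<Rightarrow> real" where "gauss2 z = (z\<^sup>2 - 1) * std_normal_density z"

lemma DERIV_std_normal: "(std_normal_density has_real_derivative - gauss1 z) (at z)"
proof -
  have "((\<lambda>z::real. exp (- z\<^sup>2 / 2)) has_real_derivative - z * exp (- z\<^sup>2 / 2)) (at z)"
    by (auto intro!: derivative_eq_intros)
  from DERIV_cmult[OF this, of "1 / sqrt (2 * pi)"] show ?thesis
    unfolding std_normal_density_def[abs_def] gauss1_def by (simp add: mult_ac)
qed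

lemma DERIV_gauss1: "(gauss1 has_real_derivative - gauss2 z) (at z)"
  unfolding gauss1_def[abs_def] gauss2_def
  by (rule derivative_eq_intros DERIV_std_normal refl)+ (simp add: gauss1_def power2_eq_square algebra_simps)

lemma continuous_std_normal: "continuous_on UNIV std_normal_density"
  using DERIV_isCont[OF DERIV_std_normal] by (simp add: continuous_at_imp_continuous_on)

lemma continuous_gauss: "continuous_on UNIV gauss1" "continuous_on UNIV gauss2"
  unfolding gauss1_def[abs_def] gauss2_def[abs_def] by (intro continuous_intros continuous_std_normal)+

lemma integrable_gauss: "integrable lborel gauss1" "integrable lborel gauss2"
proof -
  show "integrable lborel gauss1"
    using integrable_std_normal_moment[of 1] unfolding gauss1_def[abs_def] by (simp add: mult.commute)
  have "gauss2 = (\<lambda>z. std_normal_density z * z ^ 2 - std_normal_density z)"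
    by (simp add: gauss2_def fun_eq_iff algebra_simps)
  then show "integrable lborel gauss2"
    using Bochner_Integration.integrable_diff[OF integrable_std_normal_moment[of 2] integrable_normal_density[of 1 0]]
    by simp
qed

text \<open>Half of the Gaussian exponent pays for the polynomial, by squaring 1 + z^2 \<le> 8 exp
  (z^2 / 8). A factor of degree four dominates every polynomial produced by two derivatives and the
  weight 1 + |z|.\<close>

lemma std_normal_decay: "(1 + z\<^sup>2)\<^sup>2 * std_normal_density z \<le> 64 * exp (- z\<^sup>2 / 4)"
proof -
  have "(1 + z\<^sup>2) / 8 \<le> exp (z\<^sup>2 / 8)" using exp_ge_add_one_self[of "z\<^sup>2 / 8"] by (simp add: field_simps)
  then have "((1 + z\<^sup>2) / 8)\<^sup>2 \<le> (exp (z\<^sup>2 / 8))\<^sup>2" by (intro power_mono) auto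
  also have "\<dots> = exp (z\<^sup>2 / 4)" by (simp add: power2_eq_square flip: exp_add)
  finally have "(1 + z\<^sup>2)\<^sup>2 \<le> 64 * exp (z\<^sup>2 / 4)" by (simp add: power_divide)
  moreover have "std_normal_density z \<le> exp (- z\<^sup>2 / 2)"
  proof -
    have "1 \<le> sqrt (2 * pi)" using pi_ge_two by simp
    then show ?thesis unfolding std_normal_density_def by (simp add: field_simps)
  qed
  ultimately have "(1 + z\<^sup>2)\<^sup>2 * std_normal_density z \<le> 64 * exp (z\<^sup>2 / 4) * exp (- z\<^sup>2 / 2)"
    by (intro mult_mono) auto
  also have "\<dots> = 64 * exp (- z\<^sup>2 / 4)" by (simp flip: exp_add add: field_simps)
  finally show ?thesis .
qed

lemma std_normal_poly_bound:
  assumes "\<bar>p\<bar> \<le> k * (1 + z\<^sup>2)\<^sup>2" "0 \<le> k"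
  shows "\<bar>p * std_normal_density z\<bar> \<le> 64 * k * exp (- z\<^sup>2 / 4)"
proof -
  have "\<bar>p * std_normal_density z\<bar> \<le> k * (1 + z\<^sup>2)\<^sup>2 * std_normal_density z"
    using assms by (simp add: abs_mult mult_right_mono)
  also have "\<dots> \<le> k * (64 * exp (- z\<^sup>2 / 4))"
    using mult_left_mono[OF std_normal_decay assms(2), of z] by (simp add: mult.assoc)
  finally show ?thesis by (simp add: mult_ac)
qed

lemma poly_le_square_square:
  fixes z :: real
  shows "1 \<le> (1 + z\<^sup>2)\<^sup>2" "\<bar>z\<bar> \<le> (1 + z\<^sup>2)\<^sup>2" "\<bar>z * (1 + \<bar>z\<bar>)\<bar> \<le> 2 * (1 + z\<^sup>2)\<^sup>2"
    "\<bar>(z\<^sup>2 - 1) * (1 + \<bar>z\<bar>)\<bar> \<le> 2 * (1 + z\<^sup>2)\<^sup>2"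
proof -
  have 1: "1 \<le> 1 + z\<^sup>2" "\<bar>z\<bar> \<le> 1 + z\<^sup>2"
    using sum_squares_bound[of 1 "\<bar>z\<bar>"] by (simp, simp)
  have 2: "1 + z\<^sup>2 \<le> (1 + z\<^sup>2)\<^sup>2" using power_increasing[of 1 2 "1 + z\<^sup>2"] by simp
  show "1 \<le> (1 + z\<^sup>2)\<^sup>2" "\<bar>z\<bar> \<le> (1 + z\<^sup>2)\<^sup>2" using 1 2 by linarith+
  have m: "\<bar>p * (1 + \<bar>z\<bar>)\<bar> \<le> 2 * (1 + z\<^sup>2)\<^sup>2" if "\<bar>p\<bar> \<le> 1 + z\<^sup>2" for p
  proof -
    have "\<bar>p\<bar> * (1 + \<bar>z\<bar>) \<le> (1 + z\<^sup>2) * (2 * (1 + z\<^sup>2))"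
    proof (rule mult_mono)
      show "1 + \<bar>z\<bar> \<le> 2 * (1 + z\<^sup>2)" using add_mono[OF 1] by simp
    qed (use that in auto)
    also have "\<dots> = 2 * (1 + z\<^sup>2)\<^sup>2" by (simp only: power2_eq_square mult.left_commute)
    finally show ?thesis by (simp add: abs_mult)
  qed
  show "\<bar>z * (1 + \<bar>z\<bar>)\<bar> \<le> 2 * (1 + z\<^sup>2)\<^sup>2" by (rule m[OF 1(2)])
  show "\<bar>(z\<^sup>2 - 1) * (1 + \<bar>z\<bar>)\<bar> \<le> 2 * (1 + z\<^sup>2)\<^sup>2" by (rule m) (simp add: abs_le_iff)
qed

text \<open>The decay hypotheses of \<open>DERIV_integral_affine_kernel\<close> for the pairs
  density and \<open>gauss1\<close>, and \<open>gauss1\<close> and \<open>gauss2\<close>; the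
  constant is 64 * 2.\<close>

lemma gauss_bounds:
  "\<bar>std_normal_density z\<bar> \<le> 128 * exp (- z\<^sup>2 / 4)"
  "\<bar>gauss1 z\<bar> \<le> 128 * exp (- z\<^sup>2 / 4)"
  "\<bar>- gauss1 z\<bar> * (1 + \<bar>z\<bar>) \<le> 128 * exp (- z\<^sup>2 / 4)"
  "\<bar>- gauss2 z\<bar> * (1 + \<bar>z\<bar>) \<le> 128 * exp (- z\<^sup>2 / 4)"
proof -
  have e: "0 < exp (- z\<^sup>2 / 4)" by simp
  show "\<bar>std_normal_density z\<bar> \<le> 128 * exp (- z\<^sup>2 / 4)"
    using std_normal_poly_bound[of 1 1 z] poly_le_square_square(1)[of z] e unfolding mult_1 by linarith
  show "\<bar>gauss1 z\<bar> \<le> 128 * exp (- z\<^sup>2 / 4)"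
    using std_normal_poly_bound[of z 1 z] poly_le_square_square(2)[of z] e unfolding gauss1_def by linarith
  show "\<bar>- gauss1 z\<bar> * (1 + \<bar>z\<bar>) \<le> 128 * exp (- z\<^sup>2 / 4)"
    using std_normal_poly_bound[OF poly_le_square_square(3)[of z]] unfolding gauss1_def
    by (simp add: abs_mult mult_ac)
  show "\<bar>- gauss2 z\<bar> * (1 + \<bar>z\<bar>) \<le> 128 * exp (- z\<^sup>2 / 4)"
    using std_normal_poly_bound[OF poly_le_square_square(4)[of z]] unfolding gauss2_def
    by (simp add: abs_mult mult_ac)
qed

text \<open>For \<open>w = std_normal_density\<close> this is the heat semigroup with drift,
  \<open>exp (r (\<partial>\<^sub>x\<^sub>x - c \<partial>\<^sub>x))\<close>, applied to \<open>F s\<close>; the other weights give its derivatives.\<close>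

definition heat_avg ::
    "real \<Rightarrow> (real \<Rightarrow> real) \<Rightarrow> (real \<Rightarrow> real \<Rightarrow> real) \<Rightarrow> real \<Rightarrow> real \<Rightarrow> real \<Rightarrow> real" where
  "heat_avg c w F r s x = (\<integral>z. w z * F s (x - c * r + sqrt (2 * r) * z) \<partial>lborel)"

text \<open>The singularity \<open>s powr (-1/2)\<close> is the one of the gradient of the heat semigroup.\<close>

definition sing_source :: "(real \<Rightarrow> real) \<Rightarrow> (real \<Rightarrow> real \<Rightarrow> real) \<Rightarrow> bool" where
  "sing_source \<beta> F \<longleftrightarrow> mono_on {0<..} \<beta> \<and> continuous_on ({0<..} \<times> UNIV) (\<lambda>(s, x). F s x) \<and>
     (\<forall>s>0. \<forall>x. \<bar>F s x\<bar> \<le> \<beta> s / sqrt s)"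

lemma sing_source_bound: "sing_source \<beta> F \<Longrightarrow> 0 < s \<Longrightarrow> \<bar>F s x\<bar> \<le> \<beta> s / sqrt s"
  unfolding sing_source_def by blast

lemma sing_source_nonneg: "sing_source \<beta> F \<Longrightarrow> 0 < s \<Longrightarrow> 0 \<le> \<beta> s"
  using sing_source_bound[of \<beta> F s 0] by (smt (verit) divide_neg_pos real_sqrt_gt_zero)

lemma sing_source_mono: "sing_source \<beta> F \<Longrightarrow> 0 < s \<Longrightarrow> s \<le> t \<Longrightarrow> \<beta> s \<le> \<beta> t"
  unfolding sing_source_def mono_on_def by auto

lemma sing_source_continuous: "sing_source \<beta> F \<Longrightarrow> 0 < s \<Longrightarrow> continuous_on A (F s)"
  unfolding sing_source_def
  by (auto intro!: continuous_on_compose2[of "{0<..} \<times> UNIV" "\<lambda>(s, x). F s x" A "Pair s", simplified] continuous_intros)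

text \<open>Presents the initial value as a source constant in time, so that the results on
  \<open>heat_avg\<close> apply to it; the time argument is later set to 1, an arbitrary positive
  value.\<close>

lemma sing_source_const:
  assumes "continuous_on UNIV h" "\<And>x. \<bar>h x\<bar> \<le> B"
  shows "sing_source (\<lambda>s. B * sqrt s) (\<lambda>_. h)"
proof -
  have "0 \<le> B" using assms(2)[of 0] by linarith
  then show ?thesis unfolding sing_source_def case_prod_beta using assms
    by (auto intro!: mono_onI mult_left_mono continuous_on_compose2[OF assms(1)] continuous_intros)
qed

lemma heat_avg_integrand:
  assumes w: "integrable lborel w" and F: "sing_source \<beta> F" "0 < s"
  shows "integrable lborel (\<lambda>z. w z * F s (x - c * r + sqrt (2 * r) * z))"
    and "\<bar>heat_avg c w F r s x\<bar> \<le> (\<integral>z. \<bar>w z\<bar> \<partial>lborel) * (\<beta> s / sqrt s)"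
proof -
  have meas: "(\<lambda>z. F s (x - c * r + sqrt (2 * r) * z)) \<in> borel_measurable lborel"
    by (auto intro!: borel_measurable_continuous_onI continuous_on_compose2[OF sing_source_continuous[OF F, of UNIV]] continuous_intros)
  have dom: "\<bar>w z * F s (x - c * r + sqrt (2 * r) * z)\<bar> \<le> \<bar>w z\<bar> * (\<beta> s / sqrt s)" for z
    unfolding abs_mult by (intro mult_left_mono sing_source_bound[OF F]) simp
  have wi: "integrable lborel (\<lambda>z. \<bar>w z\<bar> * (\<beta> s / sqrt s))" using w by simp
  show int: "integrable lborel (\<lambda>z. w z * F s (x - c * r + sqrt (2 * r) * z))"
    by (rule Bochner_Integration.integrable_bound[OF wi])
      (use meas w dom sing_source_nonneg[OF F] F(2) in \<open>auto simp: abs_mult\<close>)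
  have "\<bar>heat_avg c w F r s x\<bar> \<le> (\<integral>z. \<bar>w z\<bar> * (\<beta> s / sqrt s) \<partial>lborel)"
    unfolding heat_avg_def
    by (rule order.trans[OF integral_abs_bound]) (rule integral_mono[OF integrable_abs[OF int] wi dom])
  then show "\<bar>heat_avg c w F r s x\<bar> \<le> (\<integral>z. \<bar>w z\<bar> \<partial>lborel) * (\<beta> s / sqrt s)" by simp
qed

text \<open>In the normalised variable z the formula has no singularity in r, so continuity extends
  to r = 0, where the average is plain evaluation. Attainment of the initial value rests on
  this.\<close>

lemma continuous_heat_avg:
  assumes w: "integrable lborel w" and F: "sing_source \<beta> F"
  shows "continuous_on (UNIV \<times> {0<..} \<times> UNIV) (\<lambda>(r, s, x). heat_avg c w F r s x)"
  unfolding heat_avg_def case_prod_beta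
proof (rule continuous_on_integral_dominated)
  fix p :: "real \<times> real \<times> real" assume p: "p \<in> UNIV \<times> {0<..} \<times> UNIV"
  then show "(\<lambda>z. w z * F (fst (snd p)) (snd (snd p) - c * fst p + sqrt (2 * fst p) * z)) \<in> borel_measurable lborel"
    by (intro borel_measurable_integrable heat_avg_integrand(1)[OF w F]) auto
  define s0 where "s0 = fst (snd p)"
  have s0: "0 < s0" using p unfolding s0_def by auto
  define b where "b = \<beta> (2 * s0) / sqrt (s0 / 2)"
  have near: "\<forall>\<^sub>F q in at p within UNIV \<times> {0<..} \<times> UNIV. fst (snd q) \<in> {s0 / 2<..<2 * s0}"
  proof (rule topological_tendstoD)
    show "((\<lambda>q. fst (snd q)) \<longlongrightarrow> s0) (at p within UNIV \<times> {0<..} \<times> UNIV)"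
      unfolding s0_def by (intro tendsto_intros)
  qed (use s0 in auto)
  show "\<exists>v. integrable lborel v \<and> (\<forall>\<^sub>F q in at p within UNIV \<times> {0<..} \<times> UNIV. AE z in lborel.
      norm (w z * F (fst (snd q)) (snd (snd q) - c * fst q + sqrt (2 * fst q) * z)) \<le> v z)"
  proof (intro exI conjI)
    show "integrable lborel (\<lambda>z. \<bar>w z\<bar> * b)" using w by simp
    show "\<forall>\<^sub>F q in at p within UNIV \<times> {0<..} \<times> UNIV. AE z in lborel.
      norm (w z * F (fst (snd q)) (snd (snd q) - c * fst q + sqrt (2 * fst q) * z)) \<le> \<bar>w z\<bar> * b"
      using near
    proof eventually_elim
      case (elim q)
      have "\<bar>F (fst (snd q)) y\<bar> \<le> b" for y
      proof -
        have q: "0 < fst (snd q)" using elim s0 by auto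
        have "\<beta> (fst (snd q)) / sqrt (fst (snd q)) \<le> b" unfolding b_def
          using elim s0 q sing_source_mono[OF F q] sing_source_nonneg[OF F]
          by (intro frac_le) auto
        then show ?thesis using sing_source_bound[OF F q, of y] by linarith
      qed
      then show ?case by (simp add: abs_mult mult_left_mono)
    qed
  qed
next
  show "AE z in lborel. continuous_on (UNIV \<times> {0<..} \<times> UNIV)
      (\<lambda>q. w z * F (fst (snd q)) (snd (snd q) - c * fst q + sqrt (2 * fst q) * z))"
  proof (intro AE_I2)
    fix z
    have contF: "continuous_on ({0<..} \<times> UNIV) (\<lambda>(s, x). F s x)" using F unfolding sing_source_def by blast
    have "continuous_on (UNIV \<times> {0<..} \<times> UNIV)
        (\<lambda>q. (\<lambda>(s, x). F s x) (fst (snd q), snd (snd q) - c * fst q + sqrt (2 * fst q) * z))"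
      by (rule continuous_on_compose2[OF contF]) (auto intro!: continuous_intros)
    then show "continuous_on (UNIV \<times> {0<..} \<times> UNIV)
      (\<lambda>q. w z * F (fst (snd q)) (snd (snd q) - c * fst q + sqrt (2 * fst q) * z))"
      by (intro continuous_intros) simp
  qed
qed

lemma continuous_heat_avg_compose:
  assumes "integrable lborel w" "sing_source \<beta> F"
    and "continuous_on A r" "continuous_on A s" "continuous_on A x" "\<And>q. q \<in> A \<Longrightarrow> 0 < s q"
  shows "continuous_on A (\<lambda>q. heat_avg c w F (r q) (s q) (x q))"
proof -
  have "continuous_on A (\<lambda>q. (\<lambda>(r, s, x). heat_avg c w F r s x) (r q, s q, x q))"
    by (rule continuous_on_compose2[OF continuous_heat_avg[OF assms(1,2)]])
      (use assms in \<open>auto intro!: continuous_intros\<close>)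
  then show ?thesis by simp
qed

text \<open>Only the centre moves, at unit speed, and the derivative falls on the Gaussian
  weight.\<close>

lemma heat_avg_deriv_x:
  assumes F: "sing_source \<beta> F" and "0 < s" "0 < r"
  shows "(heat_avg c std_normal_density F r s has_real_derivative heat_avg c gauss1 F r s x / sqrt (2 * r)) (at x)"
    and "(heat_avg c gauss1 F r s has_real_derivative heat_avg c gauss2 F r s x / sqrt (2 * r)) (at x)"
proof -
  have "(heat_avg c \<psi> F r s has_real_derivative heat_avg c \<psi>' F r s x / sqrt (2 * r)) (at x)"
    if "\<And>z. (\<psi> has_real_derivative - \<psi>' z) (at z)" "continuous_on UNIV \<psi>'"
      "\<And>z. \<bar>\<psi> z\<bar> \<le> 128 * exp (- z\<^sup>2 / 4)" "\<And>z. \<bar>- \<psi>' z\<bar> * (1 + \<bar>z\<bar>) \<le> 128 * exp (- z\<^sup>2 / 4)"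
    for \<psi> \<psi>'
  proof -
    have "((\<lambda>x. \<integral>z. \<psi> z * F s (x - c * r + sqrt (2 * r) * z) \<partial>lborel) has_real_derivative
      - (\<integral>z. (- \<psi>' z * (1 + z * 0) + \<psi> z * 0) / sqrt (2 * r) * F s (x - c * r + sqrt (2 * r) * z) \<partial>lborel)) (at x)"
    proof (rule DERIV_integral_affine_kernel[OF that(1) _ that(3,4) sing_source_continuous[OF F \<open>0 < s\<close>]
        sing_source_bound[OF F \<open>0 < s\<close>] open_UNIV UNIV_I])
      show "((\<lambda>x. x - c * r) has_real_derivative 1) (at x)" for x
        by (auto intro!: derivative_eq_intros)
    qed (use \<open>0 < r\<close> that(2) in \<open>auto intro!: continuous_intros\<close>)
    then show ?thesis unfolding heat_avg_def[abs_def] by simp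
  qed
  from this[OF DERIV_std_normal continuous_gauss(1) gauss_bounds(1,3)] this[OF DERIV_gauss1 continuous_gauss(2) gauss_bounds(2,4)]
  show "(heat_avg c std_normal_density F r s has_real_derivative heat_avg c gauss1 F r s x / sqrt (2 * r)) (at x)"
    "(heat_avg c gauss1 F r s has_real_derivative heat_avg c gauss2 F r s x / sqrt (2 * r)) (at x)" .
qed

text \<open>Both the width sqrt (2 r) and the centre x - c r move. The width contributes z
  \<open>gauss1\<close> minus the density, which is \<open>gauss2\<close> and thus the second space
  derivative; the centre contributes the drift. This is the heat equation with drift.\<close>

lemma heat_avg_deriv_r:
  assumes F: "sing_source \<beta> F" and "0 < s" "0 < r"
  shows "((\<lambda>r. heat_avg c std_normal_density F r s x) has_real_derivative
    heat_avg c gauss2 F r s x / (2 * r) - c * (heat_avg c gauss1 F r s x / sqrt (2 * r))) (at r)"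
proof -
  have eq: "sqrt (2 * r) * sqrt (2 * r) = 2 * r" using \<open>0 < r\<close> by simp
  have "((\<lambda>r. \<integral>z. std_normal_density z * F s (x - c * r + sqrt (2 * r) * z) \<partial>lborel) has_real_derivative
     - (\<integral>z. (- gauss1 z * (- c + z * (1 / sqrt (2 * r))) + std_normal_density z * (1 / sqrt (2 * r))) / sqrt (2 * r)
        * F s (x - c * r + sqrt (2 * r) * z) \<partial>lborel)) (at r)"
  proof (rule DERIV_integral_affine_kernel[OF DERIV_std_normal _ gauss_bounds(1,3) sing_source_continuous[OF F \<open>0 < s\<close>]
        sing_source_bound[OF F \<open>0 < s\<close>], of "{0<..}" r "\<lambda>r. x - c * r" "\<lambda>_. - c" "\<lambda>r. sqrt (2 * r)" "\<lambda>r. 1 / sqrt (2 * r)"])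
    show "((\<lambda>r. sqrt (2 * r)) has_real_derivative 1 / sqrt (2 * t)) (at t)" if "t \<in> {0<..}" for t
      using that by (auto intro!: derivative_eq_intros simp: field_simps)
    show "((\<lambda>r. x - c * r) has_real_derivative - c) (at t)" for t
      by (auto intro!: derivative_eq_intros)
  qed (use \<open>0 < r\<close> in \<open>auto intro!: continuous_intros continuous_gauss\<close>)
  also have "(\<integral>z. (- gauss1 z * (- c + z * (1 / sqrt (2 * r))) + std_normal_density z * (1 / sqrt (2 * r))) / sqrt (2 * r)
        * F s (x - c * r + sqrt (2 * r) * z) \<partial>lborel)
    = (\<integral>z. c / sqrt (2 * r) * (gauss1 z * F s (x - c * r + sqrt (2 * r) * z))
        - 1 / (2 * r) * (gauss2 z * F s (x - c * r + sqrt (2 * r) * z)) \<partial>lborel)"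
  proof (intro Bochner_Integration.integral_cong refl)
    fix z
    have "(- (z * n) * (- c + z * (1 / q)) + n * (1 / q)) / q = c / q * (z * n) - 1 / (q * q) * ((z\<^sup>2 - 1) * n)"
      if "q \<noteq> 0" for n q :: real
      using that by (simp add: field_simps power2_eq_square)
    from this[of "sqrt (2 * r)" "std_normal_density z"]
    have "(- gauss1 z * (- c + z * (1 / sqrt (2 * r))) + std_normal_density z * (1 / sqrt (2 * r))) / sqrt (2 * r)
      = c / sqrt (2 * r) * gauss1 z - 1 / (2 * r) * gauss2 z"
      unfolding gauss1_def gauss2_def eq using \<open>0 < r\<close> by simp
    then show "(- gauss1 z * (- c + z * (1 / sqrt (2 * r))) + std_normal_density z * (1 / sqrt (2 * r))) / sqrt (2 * r)
        * F s (x - c * r + sqrt (2 * r) * z) = c / sqrt (2 * r) * (gauss1 z * F s (x - c * r + sqrt (2 * r) * z))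
        - 1 / (2 * r) * (gauss2 z * F s (x - c * r + sqrt (2 * r) * z))"
      by (simp add: left_diff_distrib)
  qed
  also have "\<dots> = c / sqrt (2 * r) * heat_avg c gauss1 F r s x - 1 / (2 * r) * heat_avg c gauss2 F r s x"
    using heat_avg_integrand(1)[OF integrable_gauss(1) F \<open>0 < s\<close>, of x c r]
      heat_avg_integrand(1)[OF integrable_gauss(2) F \<open>0 < s\<close>, of x c r] unfolding heat_avg_def by simp
  finally show ?thesis unfolding heat_avg_def by simp
qed

section \<open>The Duhamel integral\<close>

lemma integrable_std_normal: "integrable lborel std_normal_density"
  by simp

text \<open>Here r is the time elapsed since the source acted. Factor \<open>k\<close> and weight
  \<open>w\<close> are free so that derivatives stay in the same family: 1 with the density is the
  Duhamel integral itself, 1 / sqrt (2 r) with \<open>gauss1\<close> its space derivative.\<close>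

definition duhamel ::
    "real \<Rightarrow> (real \<Rightarrow> real) \<Rightarrow> (real \<Rightarrow> real) \<Rightarrow> (real \<Rightarrow> real \<Rightarrow> real) \<Rightarrow> real \<Rightarrow> real \<Rightarrow> real" where
  "duhamel c k w F t x = (\<integral>r. indicator {0<..<t} r * (k r * heat_avg c w F r (t - r) x) \<partial>lborel)"

section \<open>Inverse square root singularities at both ends\<close>

lemma integrable_inverse_sqrt: "integrable lborel (\<lambda>r. indicator {0<..<t} r / sqrt r)"
proof (cases "0 < t")
  case True
  have "(\<lambda>x. x powr (- 1 / 2)) absolutely_integrable_on {0..t}"
    using True by (intro nonnegative_absolutely_integrable_1 integrable_on_powr_from_0) auto
  then have "integrable lebesgue (\<lambda>x. indicator {0..t} x *\<^sub>R x powr (- 1 / 2))"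
    by (simp add: set_integrable_def)
  then have "integrable lborel (\<lambda>x. indicator {0..t} x *\<^sub>R x powr (- 1 / 2))"
    by (subst (asm) integrable_completion) auto
  then show ?thesis
  proof (rule Bochner_Integration.integrable_bound)
    show "AE x in lborel. norm (indicator {0<..<t} x / sqrt x) \<le> norm (indicator {0..t} x *\<^sub>R x powr (- 1 / 2))"
      by (auto simp: indicator_def powr_minus_divide powr_half_sqrt)
  qed auto
qed (auto simp: indicator_def)

text \<open>Separates the two end point singularities, by sqrt t \<le> sqrt r + sqrt (t -
  r).\<close>

lemma inverse_sqrt_sqrt_le:
  assumes "0 < r" "r < t"
  shows "1 / (sqrt r * sqrt (t - r)) \<le> (1 / sqrt r + 1 / sqrt (t - r)) / sqrt t"
proof -
  define a b where "a = sqrt r" and "b = sqrt (t - r)"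
  have ab: "0 < a" "0 < b" using assms unfolding a_def b_def by auto
  have "t = a\<^sup>2 + b\<^sup>2" using assms unfolding a_def b_def by simp
  then have "sqrt t \<le> a + b" using ab by (intro real_le_lsqrt) (auto simp: power2_sum)
  moreover have "0 < sqrt t" using assms by simp
  ultimately have "1 * sqrt t \<le> (a + b)" by simp
  then have "1 / (a * b) \<le> ((a + b) / (a * b)) / sqrt t"
    using ab \<open>0 < sqrt t\<close> by (simp add: field_simps)
  also have "(a + b) / (a * b) = 1 / a + 1 / b" using ab by (simp add: field_simps)
  finally show ?thesis unfolding a_def b_def .
qed

lemma integrable_arcsine:
  "integrable lborel (\<lambda>r. indicator {0<..<t} r / (sqrt r * sqrt (t - r)))"
proof -
  have "integrable lborel (\<lambda>r. indicator {0<..<t} (t + - 1 * r) / sqrt (t + - 1 * r))"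
    by (rule lborel_integrable_real_affine[OF integrable_inverse_sqrt]) simp
  then have "integrable lborel (\<lambda>r. (indicator {0<..<t} r / sqrt r + indicator {0<..<t} (t - r) / sqrt (t - r)) / sqrt t)"
    using integrable_inverse_sqrt[of t] by simp
  then show ?thesis
  proof (rule Bochner_Integration.integrable_bound)
    show "AE r in lborel. norm (indicator {0<..<t} r / (sqrt r * sqrt (t - r)))
      \<le> norm ((indicator {0<..<t} r / sqrt r + indicator {0<..<t} (t - r) / sqrt (t - r)) / sqrt t)"
    proof (intro AE_I2)
      fix r
      show "norm (indicator {0<..<t} r / (sqrt r * sqrt (t - r)))
      \<le> norm ((indicator {0<..<t} r / sqrt r + indicator {0<..<t} (t - r) / sqrt (t - r)) / sqrt t)"
        using inverse_sqrt_sqrt_le[of r t] by (cases "0 < r \<and> r < t") (auto simp: indicator_def)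
    qed
  qed auto
qed

text \<open>The Beta integral B(1/2, 1/2) = \<pi>. By scaling, the mass over (0, t) is the same for
  every t > 0.\<close>

definition arcsine_mass :: real where
  "arcsine_mass = (\<integral>r. indicator {0<..<1} r / (sqrt r * sqrt (1 - r)) \<partial>lborel)"

lemma indicator_scaled: "0 < t \<Longrightarrow> indicator {0<..<t} (t * r) = (indicator {0<..<1} r :: real)" for t r :: real
  by (auto simp: indicator_def zero_less_mult_iff)

lemma integral_arcsine:
  assumes "0 < t"
  shows "(\<integral>r. indicator {0<..<t} r / (sqrt r * sqrt (t - r)) \<partial>lborel) = arcsine_mass"
proof -
  have "(\<integral>r. indicator {0<..<t} r / (sqrt r * sqrt (t - r)) \<partial>lborel) =
    \<bar>t\<bar> *\<^sub>R (\<integral>r. indicator {0<..<t} (0 + t * r) / (sqrt (0 + t * r) * sqrt (t - (0 + t * r))) \<partial>lborel)"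
    using assms by (intro lborel_integral_real_affine) simp
  also have "\<dots> = (\<integral>r. t * (indicator {0<..<t} (t * r) / (sqrt (t * r) * sqrt (t - t * r))) \<partial>lborel)"
    using assms by (simp del: times_divide_eq_right)
  also have "\<dots> = arcsine_mass" unfolding arcsine_mass_def
  proof (intro Bochner_Integration.integral_cong refl)
    fix r
    have "t - t * r = t * (1 - r)" by (simp add: algebra_simps)
    then have "sqrt (t * r) * sqrt (t - t * r) = t * (sqrt r * sqrt (1 - r))"
      using assms by (simp add: real_sqrt_mult)
    then show "t * (indicator {0<..<t} (t * r) / (sqrt (t * r) * sqrt (t - t * r)))
        = indicator {0<..<1} r / (sqrt r * sqrt (1 - r))"
      using assms by (simp add: indicator_scaled)
  qed
  finally show ?thesis .
qed

text \<open>A kernel is regarded as a source that is constant in space, so that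
  \<open>sing_source\<close> also records the admissible singularity at the other end of the Duhamel
  integral.\<close>

lemma sing_kernel_continuous:
  assumes "sing_source \<alpha> (\<lambda>r _. k r)" shows "continuous_on {0<..} k"
proof -
  have "continuous_on ({0<..} \<times> (UNIV :: real set)) (\<lambda>(s, x). k s)"
    using assms unfolding sing_source_def by blast
  then have "continuous_on {0<..} (\<lambda>r. (\<lambda>(s, x). k s) (r, 0 :: real))"
    by (rule continuous_on_compose2) (auto intro!: continuous_intros)
  then show ?thesis by simp
qed

text \<open>The kernel is singular at r = 0 and the source at r = t, each like an inverse square
  root. The horizon T makes the constant common to all t \<le> T, as continuity in t
  requires.\<close>

lemma duhamel_integrand_bound:
  assumes w: "integrable lborel w" and F: "sing_source \<beta> F" and k: "sing_source \<alpha> (\<lambda>r _. k r)"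
    and r: "0 < r" "r < t" "t \<le> T"
  shows "\<bar>k r * heat_avg c w F r (t - r) x\<bar> \<le> \<alpha> T * ((\<integral>z. \<bar>w z\<bar> \<partial>lborel) * \<beta> T) / (sqrt r * sqrt (t - r))"
proof -
  have "\<bar>k r * heat_avg c w F r (t - r) x\<bar> \<le> (\<alpha> r / sqrt r) * ((\<integral>z. \<bar>w z\<bar> \<partial>lborel) * (\<beta> (t - r) / sqrt (t - r)))"
    unfolding abs_mult using r sing_source_nonneg[OF k, of r]
    by (intro mult_mono sing_source_bound[OF k] heat_avg_integrand(2)[OF w F]) auto
  also have "\<dots> \<le> (\<alpha> T / sqrt r) * ((\<integral>z. \<bar>w z\<bar> \<partial>lborel) * (\<beta> T / sqrt (t - r)))"
    using r sing_source_nonneg[OF k, of r] sing_source_nonneg[OF F, of "t - r"]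
      sing_source_nonneg[OF k, of T] sing_source_nonneg[OF F, of T]
    by (intro mult_mono mult_left_mono divide_right_mono sing_source_mono[OF k] sing_source_mono[OF F]) auto
  finally show ?thesis by simp
qed

lemma duhamel_integrand_measurable:
  assumes w: "integrable lborel w" and F: "sing_source \<beta> F" and k: "sing_source \<alpha> (\<lambda>r _. k r)"
  shows "(\<lambda>r. indicator {0<..<t} r * (k r * heat_avg c w F r (t - r) x)) \<in> borel_measurable borel"
proof -
  have "continuous_on {0<..<t} (\<lambda>r. k r * heat_avg c w F r (t - r) x)"
    by (intro continuous_intros continuous_on_subset[OF sing_kernel_continuous[OF k]]
        continuous_heat_avg_compose[OF w F]) auto
  from borel_measurable_continuous_on_indicator[OF _ this] show ?thesis by simp
qed

lemma duhamel_integrable: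
  assumes w: "integrable lborel w" and F: "sing_source \<beta> F" and k: "sing_source \<alpha> (\<lambda>r _. k r)"
  shows "integrable lborel (\<lambda>r. indicator {0<..<t} r * (k r * heat_avg c w F r (t - r) x))"
proof (rule Bochner_Integration.integrable_bound)
  show "integrable lborel (\<lambda>r. \<alpha> t * ((\<integral>z. \<bar>w z\<bar> \<partial>lborel) * \<beta> t) * (indicator {0<..<t} r / (sqrt r * sqrt (t - r))))"
    by (intro integrable_mult_right integrable_arcsine)
  show "AE r in lborel. norm (indicator {0<..<t} r * (k r * heat_avg c w F r (t - r) x)) \<le>
    norm (\<alpha> t * ((\<integral>z. \<bar>w z\<bar> \<partial>lborel) * \<beta> t) * (indicator {0<..<t} r / (sqrt r * sqrt (t - r))))"
  proof (intro AE_I2)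
    fix r
    show "norm (indicator {0<..<t} r * (k r * heat_avg c w F r (t - r) x)) \<le>
      norm (\<alpha> t * ((\<integral>z. \<bar>w z\<bar> \<partial>lborel) * \<beta> t) * (indicator {0<..<t} r / (sqrt r * sqrt (t - r))))"
      using duhamel_integrand_bound[OF w F k, of r t t c x]
      by (cases "0 < r \<and> r < t") (auto simp: indicator_def intro!: order.trans[OF _ divide_right_mono[OF abs_ge_self]])
  qed
qed (use duhamel_integrand_measurable[OF w F k] in simp)

lemma duhamel_bound:
  assumes w: "integrable lborel w" and F: "sing_source \<beta> F" and k: "sing_source \<alpha> (\<lambda>r _. k r)" and t: "0 < t"
  shows "\<bar>duhamel c k w F t x\<bar> \<le> \<alpha> t * ((\<integral>z. \<bar>w z\<bar> \<partial>lborel) * \<beta> t) * arcsine_mass"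
proof -
  have "\<bar>duhamel c k w F t x\<bar> \<le> (\<integral>r. \<bar>indicator {0<..<t} r * (k r * heat_avg c w F r (t - r) x)\<bar> \<partial>lborel)"
    unfolding duhamel_def by (rule integral_abs_bound)
  also have "\<dots> \<le> (\<integral>r. \<alpha> t * ((\<integral>z. \<bar>w z\<bar> \<partial>lborel) * \<beta> t) * (indicator {0<..<t} r / (sqrt r * sqrt (t - r))) \<partial>lborel)"
  proof (rule integral_mono)
    fix r
    show "\<bar>indicator {0<..<t} r * (k r * heat_avg c w F r (t - r) x)\<bar>
      \<le> \<alpha> t * ((\<integral>z. \<bar>w z\<bar> \<partial>lborel) * \<beta> t) * (indicator {0<..<t} r / (sqrt r * sqrt (t - r)))"
      using duhamel_integrand_bound[OF w F k, of r t t c x]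
      by (cases "0 < r \<and> r < t") (auto simp: indicator_def)
  qed (intro integrable_abs duhamel_integrable[OF w F k] integrable_mult_right integrable_arcsine)+
  also have "\<dots> = \<alpha> t * ((\<integral>z. \<bar>w z\<bar> \<partial>lborel) * \<beta> t) * arcsine_mass"
    by (simp only: integral_mult_right_zero integral_arcsine[OF t])
  finally show ?thesis .
qed

text \<open>Rescaling to a fixed interval moves the singular end point \<open>t\<close> out of the way.\<close>

lemma duhamel_scaled:
  assumes "0 < t"
  shows "duhamel c k w F t x =
    (\<integral>r. indicator {0<..<1} r * (t * (k (t * r) * heat_avg c w F (t * r) (t - t * r) x)) \<partial>lborel)"
proof -
  have "duhamel c k w F t x = \<bar>t\<bar> *\<^sub>R (\<integral>r. indicator {0<..<t} (0 + t * r) *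
      (k (0 + t * r) * heat_avg c w F (0 + t * r) (t - (0 + t * r)) x) \<partial>lborel)"
    unfolding duhamel_def using assms by (intro lborel_integral_real_affine) simp
  also have "\<dots> = (\<integral>r. t * (indicator {0<..<t} (t * r) * (k (t * r) * heat_avg c w F (t * r) (t - t * r) x)) \<partial>lborel)"
    using assms by simp
  finally show ?thesis using assms by (simp add: indicator_scaled mult.left_commute)
qed

text \<open>In the scaled form the factor t cancels against the t coming out of the two square
  roots, so that near each point one multiple of the arcsine density on (0, 1) dominates. The
  horizon is twice the time of that point.\<close>

lemma continuous_duhamel:
  assumes w: "integrable lborel w" and F: "sing_source \<beta> F" and k: "sing_source \<alpha> (\<lambda>r _. k r)"
  shows "continuous_on ({0<..} \<times> UNIV) (\<lambda>(t, x). duhamel c k w F t x)"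
proof -
  define S where "S = {0 :: real<..} \<times> (UNIV :: real set)"
  define f where "f q r = indicator {0<..<1} r *
      (fst q * (k (fst q * r) * heat_avg c w F (fst q * r) (fst q - fst q * r) (snd q)))" for q :: "real \<times> real" and r
  have fst_pos: "0 < fst q" if "q \<in> S" for q using that unfolding S_def by auto
  have pos: "0 < fst q * r" "fst q * r < fst q" if "q \<in> S" "0 < r" "r < 1" for q r
    using fst_pos[OF that(1)] that(2,3) by auto
  have "continuous_on S (\<lambda>q. integral\<^sup>L lborel (f q))"
  proof (rule continuous_on_integral_dominated)
    fix q assume q: "q \<in> S"
    have "continuous_on {0<..<1} (\<lambda>r. fst q * (k (fst q * r) * heat_avg c w F (fst q * r) (fst q - fst q * r) (snd q)))"
      using pos[OF q]
      by (intro continuous_intros continuous_on_compose2[OF sing_kernel_continuous[OF k]]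
          continuous_heat_avg_compose[OF w F]) auto
    from borel_measurable_continuous_on_indicator[OF _ this]
    show "f q \<in> borel_measurable lborel" unfolding f_def by simp
  next
    fix p assume p: "p \<in> S"
    define T where "T = 2 * fst p"
    have near: "\<forall>\<^sub>F q in at p within S. fst q \<in> {..<T}"
    proof (rule topological_tendstoD)
      show "(fst \<longlongrightarrow> fst p) (at p within S)" by (intro tendsto_intros)
    qed (use fst_pos[OF p] in \<open>auto simp: T_def\<close>)
    define b where "b = \<alpha> T * ((\<integral>z. \<bar>w z\<bar> \<partial>lborel) * \<beta> T)"
    show "\<exists>v. integrable lborel v \<and> (\<forall>\<^sub>F q in at p within S. AE r in lborel. norm (f q r) \<le> v r)"
    proof (intro exI conjI)
      show "integrable lborel (\<lambda>r. b * (indicator {0<..<1} r / (sqrt r * sqrt (1 - r))))"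
        by (intro integrable_mult_right integrable_arcsine)
      have inS: "\<forall>\<^sub>F q in at p within S. q \<in> S" by (simp add: eventually_at_filter)
      show "\<forall>\<^sub>F q in at p within S. AE r in lborel. norm (f q r) \<le> b * (indicator {0<..<1} r / (sqrt r * sqrt (1 - r)))"
        using near inS
      proof eventually_elim
        case (elim q)
        define t where "t = fst q"
        have t: "0 < t" "t \<le> T" using elim fst_pos unfolding t_def by auto
        have "norm (f q r) \<le> b * (indicator {0<..<1} r / (sqrt r * sqrt (1 - r)))" for r
        proof (cases "0 < r \<and> r < 1")
          case True
          have "t - t * r = t * (1 - r)" by (simp add: algebra_simps)
          then have eq: "sqrt (t * r) * sqrt (t - t * r) = t * (sqrt r * sqrt (1 - r))"
            using t by (simp add: real_sqrt_mult)
          have "\<bar>k (t * r) * heat_avg c w F (t * r) (t - t * r) (snd q)\<bar> \<le> b / (sqrt (t * r) * sqrt (t - t * r))"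
            unfolding b_def using True t by (intro duhamel_integrand_bound[OF w F k]) auto
          then have "t * \<bar>k (t * r) * heat_avg c w F (t * r) (t - t * r) (snd q)\<bar> \<le> t * (b / (t * (sqrt r * sqrt (1 - r))))"
            unfolding eq using t by (intro mult_left_mono) auto
          also have "\<dots> = b / (sqrt r * sqrt (1 - r))" using t by simp
          finally show ?thesis unfolding f_def t_def[symmetric] using True t by (simp add: abs_mult)
        qed (auto simp: f_def indicator_def)
        then show ?case by simp
      qed
    qed
  next
    have "continuous_on S (\<lambda>q. f q r)" for r
    proof (cases "0 < r \<and> r < 1")
      case True
      then show ?thesis unfolding f_def using pos
        by (intro continuous_intros continuous_on_compose2[OF sing_kernel_continuous[OF k]]
          continuous_heat_avg_compose[OF w F]) auto
    qed (auto simp: f_def indicator_def)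
    then show "AE r in lborel. continuous_on S (\<lambda>q. f q r)" by simp
  qed
  moreover have "integral\<^sup>L lborel (f q) = (case q of (t, x) \<Rightarrow> duhamel c k w F t x)" if "q \<in> S" for q
    unfolding f_def using duhamel_scaled[OF fst_pos[OF that], of c k w F "snd q"] by (simp add: case_prod_beta)
  ultimately show ?thesis unfolding S_def by (subst continuous_on_cong[OF refl]) auto
qed

text \<open>Stated for two independent triples of kernel, weight and source, because the derivative
  may fall on the Gaussian or on the source. Domination only asks that the new triple has the same
  admissible singularities.\<close>

lemma duhamel_deriv_x:
  assumes w: "integrable lborel w" and F: "sing_source \<beta> F" and k: "sing_source \<alpha> (\<lambda>r _. k r)"
    and w': "integrable lborel w'" and F': "sing_source \<beta>' F'" and k': "sing_source \<alpha>' (\<lambda>r _. k' r)"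
    and d: "\<And>r y. 0 < r \<Longrightarrow> r < t \<Longrightarrow> ((\<lambda>y. k r * heat_avg c w F r (t - r) y) has_real_derivative k' r * heat_avg c w' F' r (t - r) y) (at y)"
  shows "(duhamel c k w F t has_real_derivative duhamel c k' w' F' t x) (at x)"
  unfolding duhamel_def[abs_def]
proof (rule has_real_derivative_integral_dominated[where d = 1])
  define b where "b = \<alpha>' t * ((\<integral>z. \<bar>w' z\<bar> \<partial>lborel) * \<beta>' t)"
  show "integrable lborel (\<lambda>r. b * (indicator {0<..<t} r / (sqrt r * sqrt (t - r))))"
    by (intro integrable_mult_right integrable_arcsine)
  show "AE r in lborel. \<forall>y\<in>ball x 1. \<bar>indicator {0<..<t} r * (k' r * heat_avg c w' F' r (t - r) y)\<bar>
      \<le> b * (indicator {0<..<t} r / (sqrt r * sqrt (t - r)))"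
  proof (intro AE_I2 ballI)
    fix r y
    show "\<bar>indicator {0<..<t} r * (k' r * heat_avg c w' F' r (t - r) y)\<bar>
      \<le> b * (indicator {0<..<t} r / (sqrt r * sqrt (t - r)))"
      using duhamel_integrand_bound[OF w' F' k', of r t t c y] unfolding b_def
      by (cases "0 < r \<and> r < t") (auto simp: indicator_def)
  qed
  show "AE r in lborel. \<forall>y\<in>ball x 1. ((\<lambda>y. indicator {0<..<t} r * (k r * heat_avg c w F r (t - r) y)) has_real_derivative
      indicator {0<..<t} r * (k' r * heat_avg c w' F' r (t - r) y)) (at y)"
  proof (intro AE_I2 ballI)
    fix r y
    show "((\<lambda>y. indicator {0<..<t} r * (k r * heat_avg c w F r (t - r) y)) has_real_derivative
      indicator {0<..<t} r * (k' r * heat_avg c w' F' r (t - r) y)) (at y)"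
      using d[of r y] by (cases "0 < r \<and> r < t") (auto simp: indicator_def)
  qed
qed (use duhamel_integrable[OF w F k] duhamel_integrand_measurable[OF w' F' k'] in auto)

lemma sing_kernel_one: "sing_source sqrt (\<lambda>r _. 1)"
  unfolding sing_source_def by (auto intro!: mono_onI)

lemma sing_kernel_inverse_sqrt: "sing_source (\<lambda>_. 1) (\<lambda>r _. 1 / sqrt (2 * r))"
  unfolding sing_source_def case_prod_beta
  by (auto intro!: mono_onI continuous_intros simp: frac_le)

text \<open>The derivative falls on the Gaussian, at the price r^(-1/2) and with \<open>F\<close>
  merely continuous. A second one taken in this way would cost r^(-1), which is not
  integrable.\<close>

lemma duhamel_deriv_x_smoothing:
  assumes F: "sing_source \<beta> F"
  shows "(duhamel c (\<lambda>_. 1) std_normal_density F t has_real_derivative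
     duhamel c (\<lambda>r. 1 / sqrt (2 * r)) gauss1 F t x) (at x)"
proof (rule duhamel_deriv_x[OF _ F sing_kernel_one integrable_gauss(1) F sing_kernel_inverse_sqrt])
  fix r y assume "0 < r" "r < t"
  then show "((\<lambda>y. 1 * heat_avg c std_normal_density F r (t - r) y) has_real_derivative
      1 / sqrt (2 * r) * heat_avg c gauss1 F r (t - r) y) (at y)"
    using heat_avg_deriv_x(1)[OF F, of "t - r" r c y] by simp
qed simp

lemma heat_avg_deriv_source:
  assumes w: "integrable lborel w" and F: "sing_source \<beta> F" and F1: "sing_source \<beta>1 F1" and s: "0 < s"
    and d: "\<And>y. (F s has_real_derivative F1 s y) (at y)"
  shows "(heat_avg c w F r s has_real_derivative heat_avg c w F1 r s x) (at x)"
  unfolding heat_avg_def[abs_def]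
proof (rule has_real_derivative_integral_dominated[where d = 1])
  show "integrable lborel (\<lambda>z. \<bar>w z\<bar> * (\<beta>1 s / sqrt s))" using w by simp
  show "AE z in lborel. \<forall>y\<in>ball x 1. \<bar>w z * F1 s (y - c * r + sqrt (2 * r) * z)\<bar> \<le> \<bar>w z\<bar> * (\<beta>1 s / sqrt s)"
    unfolding abs_mult by (intro AE_I2 ballI mult_left_mono sing_source_bound[OF F1 s]) simp
  show "AE z in lborel. \<forall>y\<in>ball x 1. ((\<lambda>y. w z * F s (y - c * r + sqrt (2 * r) * z)) has_real_derivative
      w z * F1 s (y - c * r + sqrt (2 * r) * z)) (at y)"
  proof (intro AE_I2 ballI)
    fix z y
    have "((\<lambda>y. F s (y - c * r + sqrt (2 * r) * z)) has_real_derivative F1 s (y - c * r + sqrt (2 * r) * z) * 1) (at y)"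
      by (rule DERIV_chain2[OF d]) (auto intro!: derivative_eq_intros)
    then show "((\<lambda>y. w z * F s (y - c * r + sqrt (2 * r) * z)) has_real_derivative
      w z * F1 s (y - c * r + sqrt (2 * r) * z)) (at y)" by (auto intro: DERIV_cmult)
  qed
qed (use heat_avg_integrand(1)[OF w F s] heat_avg_integrand(1)[OF w F1 s] in auto)

text \<open>The derivative falls on the source, whose gradient may blow up like s^(-1/2), and the
  kernel stays free to take one more.\<close>

lemma duhamel_deriv_x_source:
  assumes F: "sing_source \<beta> F" and F1: "sing_source \<beta>1 F1"
    and d: "\<And>s y. 0 < s \<Longrightarrow> (F s has_real_derivative F1 s y) (at y)"
  shows "(duhamel c (\<lambda>_. 1) std_normal_density F t has_real_derivative
     duhamel c (\<lambda>_. 1) std_normal_density F1 t x) (at x)"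
proof (rule duhamel_deriv_x[OF _ F sing_kernel_one _ F1 sing_kernel_one])
  fix r y assume "0 < r" "r < t"
  then show "((\<lambda>y. 1 * heat_avg c std_normal_density F r (t - r) y) has_real_derivative
      1 * heat_avg c std_normal_density F1 r (t - r) y) (at y)"
    using heat_avg_deriv_source[OF integrable_std_normal F F1 _ d, of "t - r" c r y] by simp
qed simp_all

text \<open>With one of the two space derivatives on the source, 1 / (2 r) becomes 1 / sqrt (2 r),
  integrable at r = 0. Instead of integrating by parts, the proof compares two derivatives of the
  same function and uses their uniqueness.\<close>

lemma heat_avg_deriv_r_source:
  assumes F: "sing_source \<beta> F" and F1: "sing_source \<beta>1 F1" and s: "0 < s" and r: "0 < r"
    and d: "\<And>y. (F s has_real_derivative F1 s y) (at y)"
  shows "((\<lambda>r. heat_avg c std_normal_density F r s x) has_real_derivative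
    heat_avg c gauss1 F1 r s x / sqrt (2 * r) - c * heat_avg c std_normal_density F1 r s x) (at r)"
proof -
  have 1: "heat_avg c gauss1 F r s x / sqrt (2 * r) = heat_avg c std_normal_density F1 r s x"
    using heat_avg_deriv_x(1)[OF F s r] heat_avg_deriv_source[OF integrable_normal_density F F1 s d]
    by (rule DERIV_unique) simp
  have 2: "heat_avg c gauss2 F r s x / sqrt (2 * r) = heat_avg c gauss1 F1 r s x"
    using heat_avg_deriv_x(2)[OF F s r] heat_avg_deriv_source[OF integrable_gauss(1) F F1 s d]
    by (rule DERIV_unique)
  have "heat_avg c gauss2 F r s x / (2 * r) = heat_avg c gauss2 F r s x / sqrt (2 * r) / sqrt (2 * r)"
    using r by simp
  then show ?thesis using heat_avg_deriv_r[OF F s r, of c x] unfolding 1 2 by simp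
qed

text \<open>Splitting at the fixed point a = t / 2 puts the singularity at 0 into a constant; on
  [a, b] the integrand is continuous and the classical fundamental theorem applies.\<close>

lemma DERIV_integral_initial_segment:
  fixes f :: "real \<Rightarrow> real"
  assumes cont: "continuous_on {0<..} f"
    and int: "\<And>t. 0 < t \<Longrightarrow> integrable lborel (\<lambda>s. indicator {0<..<t} s * f s)"
    and t: "0 < t"
  shows "((\<lambda>t. \<integral>s. indicator {0<..<t} s * f s \<partial>lborel) has_real_derivative f t) (at t)"
proof -
  define a where "a = t / 2"
  define b where "b = 2 * t"
  have ab: "0 < a" "a < t" "t < b" using t unfolding a_def b_def by auto
  have cont': "continuous_on {a..b} f" using ab by (intro continuous_on_subset[OF cont]) auto
  have "((\<lambda>u. integral {a..u} f) has_real_derivative f t) (at t within {a..b})"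
    using ab by (intro integral_has_real_derivative[OF cont']) auto
  then have d: "((\<lambda>u. integral {a..u} f) has_real_derivative f t) (at t)"
    unfolding at_within_Icc_at[OF ab(2,3)] .
  have eq: "(\<integral>s. indicator {0<..<u} s * f s \<partial>lborel) = (\<integral>s. indicator {0<..<a} s * f s \<partial>lborel) + integral {a..u} f"
    if u: "u \<in> {a<..<b}" for u
  proof -
    have u': "a < u" "u < b" using u by auto
    have si: "set_integrable lborel {a..<u} f"
      unfolding set_integrable_def
    proof (rule Bochner_Integration.integrable_bound[OF int[of u]])
      have "continuous_on {a..<u} f" using cont' u' by (elim continuous_on_subset) auto
      from borel_measurable_continuous_on_indicator[OF _ this]
      show "(\<lambda>s. indicator {a..<u} s *\<^sub>R f s) \<in> borel_measurable lborel" by simp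
      show "AE s in lborel. norm (indicator {a..<u} s *\<^sub>R f s) \<le> norm (indicator {0<..<u} s * f s)"
        using ab by (auto simp: indicator_def)
    qed (use ab u' in auto)
    have "(\<integral>s. indicator {0<..<u} s * f s \<partial>lborel)
      = (\<integral>s. indicator {0<..<a} s * f s + indicator {a..<u} s *\<^sub>R f s \<partial>lborel)"
      using ab u' by (intro Bochner_Integration.integral_cong) (auto simp: indicator_def)
    also have "\<dots> = (\<integral>s. indicator {0<..<a} s * f s \<partial>lborel) + (LINT s:{a..<u}|lborel. f s)"
      unfolding set_lebesgue_integral_def
      by (rule Bochner_Integration.integral_add[OF int[OF ab(1)] si[unfolded set_integrable_def]])
    also have "(LINT s:{a..<u}|lborel. f s) = integral {a..<u} f"
      by (rule set_borel_integral_eq_integral(2)[OF si])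
    also have "\<dots> = integral {a..u} f"
    proof (rule integral_spike_set)
      show "negligible {x \<in> {a..<u} - {a..u}. f x \<noteq> 0}" by (rule negligible_subset[of "{}"]) auto
      show "negligible {x \<in> {a..u} - {a..<u}. f x \<noteq> 0}" by (rule negligible_subset[of "{u}"]) auto
    qed
    finally show ?thesis .
  qed
  have ev: "\<forall>\<^sub>F u in nhds t. (\<integral>s. indicator {0<..<u} s * f s \<partial>lborel) =
      (\<integral>s. indicator {0<..<a} s * f s \<partial>lborel) + integral {a..u} f"
    by (rule eventually_mono[OF eventually_nhds_in_open[of "{a<..<b}" t] eq]) (use ab in auto)
  show ?thesis unfolding DERIV_cong_ev[OF refl ev refl]
    using DERIV_add[OF DERIV_const d] by simp
qed

lemma heat_avg_zero: "heat_avg c std_normal_density F 0 s x = F s x"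
  unfolding heat_avg_def by simp

lemma integrable_indicator_inverse_sqrt_shift:
  "integrable lborel (\<lambda>y. indicator {0<..<T} (y - s) * (1 / sqrt (y - s) + b))"
proof -
  have "integrable lborel (indicator {0<..<T} :: real \<Rightarrow> real)"
    by (intro integrable_real_indicator emeasure_bounded_finite bounded_subset[OF bounded_closed_interval[of 0 T]]) auto
  then have "integrable lborel (\<lambda>q. indicator {0<..<T} q / sqrt q + b * indicator {0<..<T} q)"
    by (intro Bochner_Integration.integrable_add integrable_inverse_sqrt integrable_mult_right)
  then have "integrable lborel (\<lambda>q. indicator {0<..<T} q * (1 / sqrt q + b))"
    by (simp add: distrib_left mult.commute)
  from lborel_integrable_real_affine[OF this, of 1 "- s"] show ?thesis by simp
qed

text \<open>Writing the semigroup acting on \<open>F s\<close> as \<open>F s\<close> plus the integral of its time derivative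
  and exchanging the order of integration turns the Duhamel integral into
  \<open>\<integral>\<^sub>0\<^sup>t (F + \<partial>\<^sub>x\<^sub>x D - c \<partial>\<^sub>x D)\<close>, which can be differentiated although \<open>F\<close> is
  only continuous in time.\<close>

lemma duhamel_deriv_t:
  assumes F: "sing_source \<beta> F" and F1: "sing_source \<beta>1 F1"
    and d: "\<And>s y. 0 < s \<Longrightarrow> (F s has_real_derivative F1 s y) (at y)"
    and t: "0 < t"
  shows "((\<lambda>t. duhamel c (\<lambda>_. 1) std_normal_density F t x) has_real_derivative
     F t x + (duhamel c (\<lambda>r. 1 / sqrt (2 * r)) gauss1 F1 t x - c * duhamel c (\<lambda>_. 1) std_normal_density F1 t x)) (at t)"
proof -
  \<comment> \<open>The derivative, at elapsed time q, of the semigroup acting on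
    \<open>F s\<close>, in the form integrable at q = 0.\<close>
  define g where "g s q = heat_avg c gauss1 F1 q s x / sqrt (2 * q) - c * heat_avg c std_normal_density F1 q s x" for s q
  define A where "A u = duhamel c (\<lambda>r. 1 / sqrt (2 * r)) gauss1 F1 u x - c * duhamel c (\<lambda>_. 1) std_normal_density F1 u x" for u
  define D where "D u = duhamel c (\<lambda>_. 1) std_normal_density F u x" for u
  define W where "W = (\<integral>z. \<bar>gauss1 z\<bar> \<partial>lborel)"
  have W: "0 \<le> W" unfolding W_def by simp
  note kn = sing_kernel_one and ks = sing_kernel_inverse_sqrt
  have A_eq: "A u = (\<integral>s. indicator {0<..<u} s * g s (u - s) \<partial>lborel)" for u
  proof -
    have "A u = (\<integral>r. indicator {0<..<u} r * (1 / sqrt (2 * r) * heat_avg c gauss1 F1 r (u - r) x)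
       - c * (indicator {0<..<u} r * (1 * heat_avg c std_normal_density F1 r (u - r) x)) \<partial>lborel)"
      unfolding A_def duhamel_def
      using duhamel_integrable[OF integrable_gauss(1) F1 ks, of u c x] duhamel_integrable[OF integrable_std_normal F1 kn, of u c x]
      by simp
    also have "\<dots> = (\<integral>r. indicator {0<..<u} r * g (u - r) r \<partial>lborel)"
      unfolding g_def by (intro Bochner_Integration.integral_cong) (auto simp: algebra_simps)
    also have "\<dots> = \<bar>- 1\<bar> *\<^sub>R (\<integral>s. indicator {0<..<u} (u + - 1 * s) * g (u - (u + - 1 * s)) (u + - 1 * s) \<partial>lborel)"
      by (rule lborel_integral_real_affine) simp
    also have "\<dots> = (\<integral>s. indicator {0<..<u} s * g s (u - s) \<partial>lborel)"
      by (simp, intro Bochner_Integration.integral_cong) (auto simp: indicator_def)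
    finally show ?thesis .
  qed
  have D_eq: "D u = (\<integral>s. indicator {0<..<u} s * heat_avg c std_normal_density F (u - s) s x \<partial>lborel)" for u
  proof -
    have "D u = \<bar>- 1\<bar> *\<^sub>R (\<integral>s. indicator {0<..<u} (u + - 1 * s) *
        (1 * heat_avg c std_normal_density F (u + - 1 * s) (u - (u + - 1 * s)) x) \<partial>lborel)"
      unfolding D_def duhamel_def by (rule lborel_integral_real_affine) simp
    also have "\<dots> = (\<integral>s. indicator {0<..<u} s * heat_avg c std_normal_density F (u - s) s x \<partial>lborel)"
      by (simp, intro Bochner_Integration.integral_cong) (auto simp: indicator_def)
    finally show ?thesis .
  qed
  \<comment> \<open>The singularity of the gradient in s and that of the kernel in q enter as a
    product, which makes the double integral finite; the summand 1 comes from the drift.\<close>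
  have g_bound: "\<bar>g s q\<bar> \<le> (W + \<bar>c\<bar>) * (\<beta>1 T / sqrt s) * (1 / sqrt q + 1)" if "0 < s" "s \<le> T" "0 < q" for s q T
  proof -
    define m where "m = \<beta>1 T / sqrt s"
    have ms: "\<beta>1 s / sqrt s \<le> m" unfolding m_def
      using that by (intro divide_right_mono sing_source_mono[OF F1]) auto
    have "0 \<le> \<beta>1 s / sqrt s" using sing_source_nonneg[OF F1 that(1)] that(1) by simp
    with ms have m0: "0 \<le> m" by linarith
    have "\<bar>heat_avg c gauss1 F1 q s x\<bar> \<le> W * (\<beta>1 s / sqrt s)"
      unfolding W_def by (rule heat_avg_integrand(2)[OF integrable_gauss(1) F1 that(1)])
    also have "\<dots> \<le> W * m" using ms W by (rule mult_left_mono)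
    finally have 1: "\<bar>heat_avg c gauss1 F1 q s x\<bar> / sqrt (2 * q) \<le> W * m / sqrt q"
      using that W m0 by (intro frac_le) auto
    have "\<bar>heat_avg c std_normal_density F1 q s x\<bar> \<le> 1 * (\<beta>1 s / sqrt s)"
      using heat_avg_integrand(2)[OF integrable_std_normal F1 that(1), of c q x] by simp
    then have 2: "\<bar>c\<bar> * \<bar>heat_avg c std_normal_density F1 q s x\<bar> \<le> \<bar>c\<bar> * m"
      using ms by (intro mult_left_mono) auto
    have "\<bar>g s q\<bar> \<le> \<bar>heat_avg c gauss1 F1 q s x\<bar> / sqrt (2 * q) + \<bar>c\<bar> * \<bar>heat_avg c std_normal_density F1 q s x\<bar>"
      unfolding g_def using that abs_triangle_ineq4[of "heat_avg c gauss1 F1 q s x / sqrt (2 * q)" "c * heat_avg c std_normal_density F1 q s x"]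
      by (simp add: abs_mult)
    also have "\<dots> \<le> W * m / sqrt q + \<bar>c\<bar> * m" using 1 2 by linarith
    also have "\<dots> \<le> W * m / sqrt q + \<bar>c\<bar> * m + (W * m + \<bar>c\<bar> * m / sqrt q)"
      using W m0 that by simp
    also have "\<dots> = (W + \<bar>c\<bar>) * m * (1 / sqrt q + 1)" by (simp add: algebra_simps)
    finally show ?thesis unfolding m_def .
  qed
  have FTC: "(\<integral>\<tau>. indicator {s<..<u} \<tau> * g s (\<tau> - s) \<partial>lborel) = heat_avg c std_normal_density F (u - s) s x - F s x"
    and g_int: "integrable lborel (\<lambda>\<tau>. indicator {s<..<u} \<tau> * g s (\<tau> - s))"
    if s: "0 < s" "s < u" for s u
  proof -
    have gcont: "continuous_on {s<..<u} (\<lambda>\<tau>. g s (\<tau> - s))"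
      unfolding g_def using s
      by (intro continuous_intros continuous_heat_avg_compose[OF integrable_gauss(1) F1]
          continuous_heat_avg_compose[OF integrable_std_normal F1]) auto
    show int: "integrable lborel (\<lambda>\<tau>. indicator {s<..<u} \<tau> * g s (\<tau> - s))"
    proof (rule Bochner_Integration.integrable_bound)
      show "integrable lborel (\<lambda>\<tau>. (W + \<bar>c\<bar>) * (\<beta>1 s / sqrt s) * (indicator {0<..<u} (\<tau> - s) * (1 / sqrt (\<tau> - s) + 1)))"
        by (intro integrable_mult_right integrable_indicator_inverse_sqrt_shift)
      show "(\<lambda>\<tau>. indicator {s<..<u} \<tau> * g s (\<tau> - s)) \<in> borel_measurable lborel"
        using borel_measurable_continuous_on_indicator[OF _ gcont] by simp
      show "AE \<tau> in lborel. norm (indicator {s<..<u} \<tau> * g s (\<tau> - s)) \<le>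
        norm ((W + \<bar>c\<bar>) * (\<beta>1 s / sqrt s) * (indicator {0<..<u} (\<tau> - s) * (1 / sqrt (\<tau> - s) + 1)))"
      proof (intro AE_I2)
        fix \<tau>
        show "norm (indicator {s<..<u} \<tau> * g s (\<tau> - s)) \<le>
          norm ((W + \<bar>c\<bar>) * (\<beta>1 s / sqrt s) * (indicator {0<..<u} (\<tau> - s) * (1 / sqrt (\<tau> - s) + 1)))"
          using g_bound[of s s "\<tau> - s"] s
          by (cases "s < \<tau> \<and> \<tau> < u") (auto simp: indicator_def intro!: order.trans[OF _ divide_right_mono[OF abs_ge_self]])
      qed
    qed
    \<comment> \<open>The integrand may blow up at \<tau> = s, so the fundamental theorem is used
      with limits at the ends; at \<tau> = s the limit is \<open>F s x\<close>.\<close>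
    have "(LBINT \<tau>=ereal s..ereal u. g s (\<tau> - s)) = heat_avg c std_normal_density F (u - s) s x - F s x"
    proof (rule interval_integral_FTC_integrable[where F = "\<lambda>\<tau>. heat_avg c std_normal_density F (\<tau> - s) s x"])
      show "ereal s < ereal u" using s by simp
      fix \<tau> assume \<tau>: "ereal s < ereal \<tau>" "ereal \<tau> < ereal u"
      have "((\<lambda>\<tau>. heat_avg c std_normal_density F (\<tau> - s) s x) has_real_derivative g s (\<tau> - s) * 1) (at \<tau>)"
        unfolding g_def
      proof (rule DERIV_chain2[where f = "\<lambda>r. heat_avg c std_normal_density F r s x"])
        show "((\<lambda>r. heat_avg c std_normal_density F r s x) has_real_derivative
            heat_avg c gauss1 F1 (\<tau> - s) s x / sqrt (2 * (\<tau> - s)) - c * heat_avg c std_normal_density F1 (\<tau> - s) s x) (at (\<tau> - s))"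
          by (rule heat_avg_deriv_r_source[OF F F1 s(1) _ d[OF s(1)]]) (use \<tau> in simp)
      qed (auto intro!: derivative_eq_intros)
      then show "((\<lambda>\<tau>. heat_avg c std_normal_density F (\<tau> - s) s x) has_vector_derivative g s (\<tau> - s)) (at \<tau>)"
        by (simp add: has_real_derivative_iff_has_vector_derivative)
      show "isCont (\<lambda>\<tau>. g s (\<tau> - s)) \<tau>"
        using gcont \<tau> by (simp add: continuous_on_eq_continuous_at)
    next
      show "set_integrable lborel (einterval (ereal s) (ereal u)) (\<lambda>\<tau>. g s (\<tau> - s))"
        using int by (simp add: set_integrable_def einterval_eq)
      have c: "continuous_on UNIV (\<lambda>\<tau>. heat_avg c std_normal_density F (\<tau> - s) s x)"
        using s by (intro continuous_heat_avg_compose[OF integrable_std_normal F] continuous_intros) auto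
      then have "isCont (\<lambda>\<tau>. heat_avg c std_normal_density F (\<tau> - s) s x) \<tau>" for \<tau>
        by (simp add: continuous_on_eq_continuous_at)
      then have l: "((\<lambda>\<tau>. heat_avg c std_normal_density F (\<tau> - s) s x) \<longlongrightarrow> heat_avg c std_normal_density F (\<tau> - s) s x) (at \<tau> within S)" for \<tau> S
        unfolding isCont_def by (rule tendsto_within_subset) simp
      show "(((\<lambda>\<tau>. heat_avg c std_normal_density F (\<tau> - s) s x) \<circ> real_of_ereal) \<longlongrightarrow> F s x) (at_right (ereal s))"
        unfolding ereal_tendsto_simps using l[of s] by (simp add: heat_avg_zero)
      show "(((\<lambda>\<tau>. heat_avg c std_normal_density F (\<tau> - s) s x) \<circ> real_of_ereal) \<longlongrightarrow> heat_avg c std_normal_density F (u - s) s x) (at_left (ereal u))"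
        unfolding ereal_tendsto_simps by (rule l)
    qed
    moreover have "(LBINT \<tau>=ereal s..ereal u. g s (\<tau> - s)) = (\<integral>\<tau>. indicator {s<..<u} \<tau> * g s (\<tau> - s) \<partial>lborel)"
      using s by (simp add: interval_lebesgue_integral_def set_lebesgue_integral_def einterval_eq)
    ultimately show "(\<integral>\<tau>. indicator {s<..<u} \<tau> * g s (\<tau> - s) \<partial>lborel) = heat_avg c std_normal_density F (u - s) s x - F s x"
      by simp
  qed
  have F_int: "integrable lborel (\<lambda>s. indicator {0<..<u} s * F s x)" for u
  proof (rule Bochner_Integration.integrable_bound)
    show "integrable lborel (\<lambda>s. \<beta> u * (indicator {0<..<u} s / sqrt s))"
      by (intro integrable_mult_right integrable_inverse_sqrt)
    have "continuous_on {0<..<u} (\<lambda>s. heat_avg c std_normal_density F 0 s x)"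
      by (intro continuous_heat_avg_compose[OF integrable_std_normal F] continuous_intros) auto
    from borel_measurable_continuous_on_indicator[OF _ this]
    show "(\<lambda>s. indicator {0<..<u} s * F s x) \<in> borel_measurable lborel" by (simp add: heat_avg_zero)
    show "AE s in lborel. norm (indicator {0<..<u} s * F s x) \<le> norm (\<beta> u * (indicator {0<..<u} s / sqrt s))"
    proof (intro AE_I2)
      fix s
      show "norm (indicator {0<..<u} s * F s x) \<le> norm (\<beta> u * (indicator {0<..<u} s / sqrt s))"
      proof (cases "0 < s \<and> s < u")
        case True
        then have "\<bar>F s x\<bar> \<le> \<beta> s / sqrt s" "\<beta> s / sqrt s \<le> \<beta> u / sqrt s"
          by (auto intro!: sing_source_bound[OF F] divide_right_mono sing_source_mono[OF F])
        then show ?thesis using True by (auto simp: indicator_def intro!: order.trans[OF _ divide_right_mono[OF abs_ge_self]])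
      qed (auto simp: indicator_def)
    qed
  qed
  have main: "integrable lborel (\<lambda>\<tau>. indicator {0<..<u} \<tau> * (F \<tau> x + A \<tau>)) \<and>
      D u = (\<integral>\<tau>. indicator {0<..<u} \<tau> * (F \<tau> x + A \<tau>) \<partial>lborel)" if u: "0 < u" for u
  proof -
    \<comment> \<open>The triangle 0 < s < \<tau> < u. Integrating over the source time s first
      gives \<open>A\<close> \<tau>; integrating over \<tau> first gives the increment of the
      semigroup acting on \<open>F s\<close>.\<close>
    define S where "S = {p :: real \<times> real. 0 < fst p \<and> fst p < snd p \<and> snd p < u}"
    define f where "f p = indicator S p * g (fst p) (snd p - fst p)" for p
    have "open S"
    proof -
      have "S = {p. 0 < fst p} \<inter> {p. fst p < snd p} \<inter> {p. snd p < u}" unfolding S_def by auto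
      moreover have "open \<dots>"
        by (intro open_Int open_Collect_less continuous_intros)
      ultimately show ?thesis by simp
    qed
    moreover have "continuous_on S (\<lambda>p. g (fst p) (snd p - fst p))"
      unfolding g_def
      by (intro continuous_intros continuous_heat_avg_compose[OF integrable_gauss(1) F1]
          continuous_heat_avg_compose[OF integrable_std_normal F1]) (auto simp: S_def)
    ultimately have fmeas: "f \<in> borel_measurable (lborel \<Otimes>\<^sub>M lborel)"
      using borel_measurable_continuous_on_indicator[of S "\<lambda>p. g (fst p) (snd p - fst p)"]
      unfolding f_def lborel_prod by simp
    \<comment> \<open>A majorant on a larger region, where the integral over the second variable is
      a constant independent of s.\<close>
    define h where "h p = (indicator {0<..<u} (fst p) / sqrt (fst p)) *
        (indicator {0<..<u} (snd p - fst p) * (1 / sqrt (snd p - fst p) + 1))" for p :: "real \<times> real"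
    have hmeas: "h \<in> borel_measurable (lborel \<Otimes>\<^sub>M lborel)"
      unfolding h_def by measurable
    have hint: "integrable (lborel \<Otimes>\<^sub>M lborel) h"
    proof (rule lborel_pair.Fubini_integrable[OF hmeas])
      define I where "I = (\<integral>q. indicator {0<..<u} q * (1 / sqrt q + 1) \<partial>lborel)"
      have "(\<integral>y. norm (h (s, y)) \<partial>lborel) = indicator {0<..<u} s / sqrt s * I" for s
      proof -
        have "(\<integral>y. norm (h (s, y)) \<partial>lborel) =
           (\<integral>y. (indicator {0<..<u} s / sqrt s) * (indicator {0<..<u} (- s + 1 * y) * (1 / sqrt (- s + 1 * y) + 1)) \<partial>lborel)"
          unfolding h_def by (intro Bochner_Integration.integral_cong) (auto simp: indicator_def)
        also have "\<dots> = (indicator {0<..<u} s / sqrt s) * (\<integral>y. indicator {0<..<u} (- s + 1 * y) * (1 / sqrt (- s + 1 * y) + 1) \<partial>lborel)"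
          by (rule integral_mult_right_zero)
        also have "(\<integral>y. indicator {0<..<u} (- s + 1 * y) * (1 / sqrt (- s + 1 * y) + 1) \<partial>lborel) = I"
          unfolding I_def using lborel_integral_real_affine[of 1 "\<lambda>q. indicator {0<..<u} q * (1 / sqrt q + 1) :: real" "- s"] by simp
        finally show ?thesis .
      qed
      then show "integrable lborel (\<lambda>s. \<integral>y. norm (h (s, y)) \<partial>lborel)"
        by (simp only:) (intro integrable_mult_left integrable_inverse_sqrt)
      show "AE s in lborel. integrable lborel (\<lambda>y. h (s, y))"
        unfolding h_def fst_conv snd_conv
        by (intro AE_I2 integrable_mult_right integrable_indicator_inverse_sqrt_shift)
    qed
    have fint: "integrable (lborel \<Otimes>\<^sub>M lborel) f"
    proof (rule Bochner_Integration.integrable_bound[OF _ fmeas])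
      show "integrable (lborel \<Otimes>\<^sub>M lborel) (\<lambda>p. (W + \<bar>c\<bar>) * \<beta>1 u * h p)" using hint by simp
      show "AE p in lborel \<Otimes>\<^sub>M lborel. norm (f p) \<le> norm ((W + \<bar>c\<bar>) * \<beta>1 u * h p)"
      proof (intro AE_I2)
        fix p :: "real \<times> real"
        show "norm (f p) \<le> norm ((W + \<bar>c\<bar>) * \<beta>1 u * h p)"
        proof (cases "p \<in> S")
          case True
          then have p: "0 < fst p" "fst p < snd p" "snd p < u" unfolding S_def by auto
          have "\<bar>g (fst p) (snd p - fst p)\<bar> \<le> (W + \<bar>c\<bar>) * (\<beta>1 u / sqrt (fst p)) * (1 / sqrt (snd p - fst p) + 1)"
            using p by (intro g_bound) auto
          also have "\<dots> = (W + \<bar>c\<bar>) * \<beta>1 u * h p"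
            unfolding h_def using p by (auto simp: indicator_def)
          finally show ?thesis using True unfolding f_def by (auto intro: order.trans[OF _ abs_ge_self])
        qed (simp add: f_def)
      qed
    qed
    have inner_s: "(\<integral>s. f (s, \<tau>) \<partial>lborel) = indicator {0<..<u} \<tau> * A \<tau>" for \<tau>
    proof -
      have "(\<integral>s. f (s, \<tau>) \<partial>lborel) = (\<integral>s. indicator {0<..<u} \<tau> * (indicator {0<..<\<tau>} s * g s (\<tau> - s)) \<partial>lborel)"
        unfolding f_def S_def by (intro Bochner_Integration.integral_cong) (auto simp: indicator_def)
      then show ?thesis unfolding A_eq by simp
    qed
    have inner_t: "(\<integral>\<tau>. f (s, \<tau>) \<partial>lborel) = indicator {0<..<u} s * (heat_avg c std_normal_density F (u - s) s x - F s x)" for s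
    proof -
      have "(\<integral>\<tau>. f (s, \<tau>) \<partial>lborel) = (\<integral>\<tau>. indicator {0<..<u} s * (indicator {s<..<u} \<tau> * g s (\<tau> - s)) \<partial>lborel)"
        unfolding f_def S_def by (intro Bochner_Integration.integral_cong) (auto simp: indicator_def)
      also have "\<dots> = indicator {0<..<u} s * (\<integral>\<tau>. indicator {s<..<u} \<tau> * g s (\<tau> - s) \<partial>lborel)" by simp
      also have "\<dots> = indicator {0<..<u} s * (heat_avg c std_normal_density F (u - s) s x - F s x)"
        using FTC[of s u] by (auto simp: indicator_def)
      finally show ?thesis .
    qed
    have A_int: "integrable lborel (\<lambda>\<tau>. indicator {0<..<u} \<tau> * A \<tau>)"
      using lborel_pair.integrable_snd[of "\<lambda>s \<tau>. f (s, \<tau>)"] fint by (simp add: inner_s)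
    have D_int: "integrable lborel (\<lambda>s. indicator {0<..<u} s * (heat_avg c std_normal_density F (u - s) s x - F s x))"
      using lborel_pair.integrable_fst[of "\<lambda>s \<tau>. f (s, \<tau>)"] fint by (simp add: inner_t)
    have swap: "(\<integral>\<tau>. indicator {0<..<u} \<tau> * A \<tau> \<partial>lborel) =
       (\<integral>s. indicator {0<..<u} s * (heat_avg c std_normal_density F (u - s) s x - F s x) \<partial>lborel)"
      using lborel_pair.Fubini_integral[of "\<lambda>s \<tau>. f (s, \<tau>)"] fint by (simp add: inner_s inner_t)
    have "D u = (\<integral>s. indicator {0<..<u} s * F s x +
        indicator {0<..<u} s * (heat_avg c std_normal_density F (u - s) s x - F s x) \<partial>lborel)"
      unfolding D_eq by (simp add: algebra_simps)
    also have "\<dots> = (\<integral>s. indicator {0<..<u} s * F s x \<partial>lborel) + (\<integral>\<tau>. indicator {0<..<u} \<tau> * A \<tau> \<partial>lborel)"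
      unfolding swap by (rule Bochner_Integration.integral_add[OF F_int D_int])
    also have "\<dots> = (\<integral>\<tau>. indicator {0<..<u} \<tau> * F \<tau> x + indicator {0<..<u} \<tau> * A \<tau> \<partial>lborel)"
      by (rule Bochner_Integration.integral_add[symmetric, OF F_int A_int])
    finally show ?thesis
      using Bochner_Integration.integrable_add[OF F_int A_int] by (simp add: distrib_left)
  qed
  have "continuous_on {0<..} (\<lambda>\<tau>. (\<lambda>(t, x). duhamel c (\<lambda>r. 1 / sqrt (2 * r)) gauss1 F1 t x) (\<tau>, x))"
    by (rule continuous_on_compose2[OF continuous_duhamel[OF integrable_gauss(1) F1 ks]]) (auto intro!: continuous_intros)
  moreover have "continuous_on {0<..} (\<lambda>\<tau>. (\<lambda>(t, x). duhamel c (\<lambda>_. 1) std_normal_density F1 t x) (\<tau>, x))"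
    by (rule continuous_on_compose2[OF continuous_duhamel[OF integrable_std_normal F1 kn]]) (auto intro!: continuous_intros)
  moreover have "continuous_on {0<..} (\<lambda>s. heat_avg c std_normal_density F 0 s x)"
    by (intro continuous_heat_avg_compose[OF integrable_std_normal F] continuous_intros) auto
  ultimately have "continuous_on {0<..} (\<lambda>\<tau>. F \<tau> x + A \<tau>)"
    unfolding A_def by (auto simp: heat_avg_zero intro!: continuous_intros)
  from DERIV_integral_initial_segment[OF this conjunct1[OF main] t]
  have deriv: "((\<lambda>u. \<integral>\<tau>. indicator {0<..<u} \<tau> * (F \<tau> x + A \<tau>) \<partial>lborel) has_real_derivative F t x + A t) (at t)" .
  have ev: "\<forall>\<^sub>F u in nhds t. D u = (\<integral>\<tau>. indicator {0<..<u} \<tau> * (F \<tau> x + A \<tau>) \<partial>lborel)"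
    by (rule eventually_mono[OF eventually_nhds_in_open[of "{0<..}" t]]) (use t main in auto)
  from deriv have "(D has_real_derivative F t x + A t) (at t)"
    unfolding DERIV_cong_ev[OF refl ev refl] .
  then show ?thesis unfolding D_def[abs_def] A_def .
qed

section \<open>Global solutions for a Lipschitz reaction term\<close>

lemma mono_on_exp_sqrt:
  assumes "0 \<le> (C :: real)" "0 \<le> l"
  shows "mono_on {0<..} (\<lambda>s. C * exp (l * s) * sqrt s)"
  using assms by (intro mono_onI mult_mono) (auto simp: mult_left_mono)

lemma abs_reaction_le:
  fixes g :: "real \<Rightarrow> real"
  assumes "\<And>a b. \<bar>g a - g b\<bar> \<le> L * \<bar>a - b\<bar>"
  shows "\<bar>(tanh y * a - g a) - (tanh y * b - g b)\<bar> \<le> (1 + L) * \<bar>a - b\<bar>"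
proof -
  have "\<bar>tanh y * (a - b)\<bar> \<le> 1 * \<bar>a - b\<bar>"
    unfolding abs_mult using abs_tanh_le_1 by (intro mult_right_mono) auto
  then show ?thesis using assms[of a b] by (simp add: algebra_simps)
qed

locale reaction_term =
  fixes c \<epsilon> L :: real and g g' :: "real \<Rightarrow> real"
  assumes dg: "\<And>v. (g has_real_derivative g' v) (at v)"
    and g'_cont: "continuous_on UNIV g'"
    and g'_bound: "\<And>v. \<bar>g' v\<bar> \<le> L"
    and g_0: "g 0 = 0"
begin

lemma L_nonneg: "0 \<le> L"
  using g'_bound[of 0] by linarith

lemma g_lipschitz: "\<bar>g a - g b\<bar> \<le> L * \<bar>a - b\<bar>"
  using field_differentiable_bound[of UNIV g g' L a b] dg g'_bound by auto

lemma g_cont: "continuous_on UNIV g"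
  using DERIV_isCont[OF dg] by (simp add: continuous_at_imp_continuous_on)

definition R :: "real \<Rightarrow> real \<Rightarrow> real" where
  "R x v = tanh (\<epsilon> * x) * v - g v"

lemma R_lipschitz: "\<bar>R x a - R x b\<bar> \<le> (1 + L) * \<bar>a - b\<bar>"
  unfolding R_def by (rule abs_reaction_le[OF g_lipschitz])

lemma R_bound: "\<bar>R x a\<bar> \<le> (1 + L) * \<bar>a\<bar>"
  using R_lipschitz[of x a 0] by (simp add: R_def g_0)

lemma continuous_R:
  assumes "continuous_on A p" "continuous_on A q"
  shows "continuous_on A (\<lambda>z. R (p z) (q z))"
  unfolding R_def using assms
  by (auto intro!: continuous_intros continuous_on_compose2[OF g_cont] simp: cosh_real_nonzero)

text \<open>A bootstrap: smoothing yields \<open>vx\<close> with a bound of order t^(-1/2) near 0,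
  so the source F = R(v) has a gradient \<open>F1\<close> of admissible singularity, and smoothing
  applied to \<open>F1\<close> yields the second derivative. The time derivative comes from
  \<open>duhamel_deriv_t\<close>, for which continuity of the source in time suffices.\<close>

lemma mild_solution_regular:
  assumes u0: "continuous_on UNIV u0" "\<And>x. \<bar>u0 x\<bar> \<le> B"
    and v_cont: "continuous_on ({0<..} \<times> UNIV) (\<lambda>(t, x). v t x)"
    and v_bound: "\<And>t x. 0 < t \<Longrightarrow> \<bar>v t x\<bar> \<le> M * exp (l * t)" and l: "0 \<le> l"
    and mild: "\<And>t x. 0 < t \<Longrightarrow> v t x = heat_avg c std_normal_density (\<lambda>_. u0) t 1 x
       + duhamel c (\<lambda>_. 1) std_normal_density (\<lambda>s y. R y (v s y)) t x"
  shows "\<exists>vt vx vxx. continuous_on ({0<..} \<times> UNIV) (\<lambda>(t, x). vt t x) \<and>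
     continuous_on ({0<..} \<times> UNIV) (\<lambda>(t, x). vx t x) \<and> continuous_on ({0<..} \<times> UNIV) (\<lambda>(t, x). vxx t x) \<and>
     (\<forall>t x. 0 < t \<longrightarrow> ((\<lambda>s. v s x) has_real_derivative vt t x) (at t) \<and>
        (v t has_real_derivative vx t x) (at x) \<and> (vx t has_real_derivative vxx t x) (at x) \<and>
        vt t x = vxx t x - c * vx t x + R x (v t x))"
proof -
  define F where "F s y = R y (v s y)" for s y
  define W where "W = (\<integral>z. \<bar>gauss1 z\<bar> \<partial>lborel)"
  have W: "0 \<le> W" unfolding W_def by simp
  have arc: "0 \<le> arcsine_mass" unfolding arcsine_mass_def by (intro integral_nonneg_AE AE_I2) (auto simp: indicator_def)
  have B: "0 \<le> B" using u0(2)[of 0] by linarith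
  have M: "0 \<le> M"
  proof -
    have "0 \<le> M * exp (l * 1)" using v_bound[of 1 0] by linarith
    then show ?thesis by (simp add: zero_le_mult_iff)
  qed
  note U0 = sing_source_const[OF u0]
  define \<beta> where "\<beta> s = (1 + L) * M * exp (l * s) * sqrt s" for s
  have \<beta>_mono: "mono_on {0<..} \<beta>" unfolding \<beta>_def using M L_nonneg l by (intro mono_on_exp_sqrt) auto
  have \<beta>_nonneg: "0 \<le> \<beta> s" if "0 < s" for s unfolding \<beta>_def using that M L_nonneg by simp
  have F: "sing_source \<beta> F"
    unfolding sing_source_def
  proof (intro conjI allI impI \<beta>_mono)
    show "continuous_on ({0<..} \<times> UNIV) (\<lambda>(s, x). F s x)"
      unfolding F_def case_prod_beta using v_cont unfolding case_prod_beta
      by (intro continuous_R continuous_intros)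
    fix s x :: real assume s: "0 < s"
    have "\<bar>F s x\<bar> \<le> (1 + L) * \<bar>v s x\<bar>" unfolding F_def by (rule R_bound)
    also have "\<dots> \<le> (1 + L) * (M * exp (l * s))" using v_bound[OF s] L_nonneg by (intro mult_left_mono) auto
    also have "\<dots> = \<beta> s / sqrt s" unfolding \<beta>_def using s by simp
    finally show "\<bar>F s x\<bar> \<le> \<beta> s / sqrt s" .
  qed
  define vx where "vx t x = heat_avg c gauss1 (\<lambda>_. u0) t 1 x / sqrt (2 * t)
     + duhamel c (\<lambda>r. 1 / sqrt (2 * r)) gauss1 F t x" for t x
  have mild': "v t = (\<lambda>x. heat_avg c std_normal_density (\<lambda>_. u0) t 1 x + duhamel c (\<lambda>_. 1) std_normal_density F t x)"
    if "0 < t" for t using mild[OF that] unfolding F_def[abs_def] by blast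
  have d_vx: "(v t has_real_derivative vx t x) (at x)" if "0 < t" for t x
    unfolding mild'[OF that] vx_def
    by (intro DERIV_add heat_avg_deriv_x(1)[OF U0 zero_less_one that] duhamel_deriv_x_smoothing[OF F])
  have heat_cont: "continuous_on ({0<..} \<times> UNIV) (\<lambda>q. heat_avg c w (\<lambda>_. u0) (fst q) 1 (snd q))"
    if "integrable lborel w" for w
    by (intro continuous_heat_avg_compose[OF that U0] continuous_intros) auto
  have duh_cont: "continuous_on ({0<..} \<times> UNIV) (\<lambda>q. duhamel c k w F (fst q) (snd q))"
    if "integrable lborel w" "sing_source \<beta> F" "sing_source \<alpha> (\<lambda>r _. k r)" for w F k \<beta> \<alpha>
    using continuous_duhamel[OF that] by (simp add: case_prod_beta)
  have vx_cont: "continuous_on ({0<..} \<times> UNIV) (\<lambda>(t, x). vx t x)"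
    unfolding vx_def case_prod_beta
    by (intro continuous_intros heat_cont[OF integrable_gauss(1)] duh_cont[OF integrable_gauss(1) F sing_kernel_inverse_sqrt]) auto
  \<comment> \<open>The first summand is the gradient of the heat evolution of \<open>u0\<close>, of
    order t^(-1/2); the second is the locally bounded Duhamel part, multiplied by sqrt s to fit the
    form of \<open>sing_source\<close>.\<close>
  define \<beta>' where "\<beta>' s = W * B + W * \<beta> s * arcsine_mass * sqrt s" for s
  have vx_bound: "\<bar>vx t x\<bar> \<le> \<beta>' t / sqrt t" if t: "0 < t" for t x
  proof -
    have "\<bar>heat_avg c gauss1 (\<lambda>_. u0) t 1 x\<bar> \<le> W * B"
      using heat_avg_integrand(2)[OF integrable_gauss(1) U0 zero_less_one, of c t x] unfolding W_def by simp
    then have "\<bar>heat_avg c gauss1 (\<lambda>_. u0) t 1 x\<bar> / sqrt (2 * t) \<le> W * B / sqrt t"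
      using t W B by (intro frac_le) auto
    moreover have "\<bar>duhamel c (\<lambda>r. 1 / sqrt (2 * r)) gauss1 F t x\<bar> \<le> W * \<beta> t * arcsine_mass"
      using duhamel_bound[OF integrable_gauss(1) F sing_kernel_inverse_sqrt t, of c x] unfolding W_def by simp
    moreover have "\<bar>vx t x\<bar> \<le> \<bar>heat_avg c gauss1 (\<lambda>_. u0) t 1 x\<bar> / sqrt (2 * t) + \<bar>duhamel c (\<lambda>r. 1 / sqrt (2 * r)) gauss1 F t x\<bar>"
      unfolding vx_def using t
        abs_triangle_ineq[of "heat_avg c gauss1 (\<lambda>_. u0) t 1 x / sqrt (2 * t)"] by simp
    moreover have "W * B / sqrt t + W * \<beta> t * arcsine_mass = \<beta>' t / sqrt t"
      unfolding \<beta>'_def using t by (simp add: add_divide_distrib)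
    ultimately show ?thesis by linarith
  qed
  define F1 where "F1 s y = \<epsilon> * (1 - (tanh (\<epsilon> * y))\<^sup>2) * v s y + (tanh (\<epsilon> * y) - g' (v s y)) * vx s y" for s y
  define \<beta>1 where "\<beta>1 s = \<bar>\<epsilon>\<bar> * M * exp (l * s) * sqrt s + (1 + L) * \<beta>' s" for s
  have d_F: "(F s has_real_derivative F1 s y) (at y)" if "0 < s" for s y
  proof -
    have "((\<lambda>y. tanh (\<epsilon> * y) * v s y - g (v s y)) has_real_derivative
      (\<epsilon> * (1 - (tanh (\<epsilon> * y))\<^sup>2)) * v s y + vx s y * tanh (\<epsilon> * y) - g' (v s y) * vx s y) (at y)"
      by (intro DERIV_diff DERIV_mult DERIV_tanh_scaled d_vx[OF that] DERIV_chain2[OF dg])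
    then show ?thesis unfolding F_def[abs_def] R_def F1_def by (simp add: algebra_simps)
  qed
  have F1: "sing_source \<beta>1 F1"
    unfolding sing_source_def
  proof (intro conjI allI impI)
    have \<beta>'_mono: "mono_on {0<..} \<beta>'" unfolding \<beta>'_def
      using W B arc \<beta>_nonneg by (intro mono_onI add_mono mult_mono mono_onD[OF \<beta>_mono]) auto
    show "mono_on {0<..} \<beta>1" unfolding \<beta>1_def
      using L_nonneg M l
      by (intro mono_onI add_mono mult_left_mono mono_onD[OF mono_on_exp_sqrt]) (auto intro!: mono_onD[OF \<beta>'_mono])
    show "continuous_on ({0<..} \<times> UNIV) (\<lambda>(s, x). F1 s x)"
      unfolding F1_def case_prod_beta using v_cont vx_cont unfolding case_prod_beta
      by (auto intro!: continuous_intros continuous_on_compose2[OF g'_cont] simp: cosh_real_nonzero)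
    fix s x :: real assume s: "0 < s"
    have "\<bar>1 - (tanh (\<epsilon> * x))\<^sup>2\<bar> \<le> 1"
      using abs_tanh_le_1[of "\<epsilon> * x"] by (simp add: abs_square_le_1)
    then have 1: "\<bar>\<epsilon> * (1 - (tanh (\<epsilon> * x))\<^sup>2) * v s x\<bar> \<le> \<bar>\<epsilon>\<bar> * 1 * (M * exp (l * s))"
      unfolding abs_mult using v_bound[OF s] M by (intro mult_mono) auto
    have "\<bar>tanh (\<epsilon> * x) - g' (v s x)\<bar> \<le> 1 + L"
      using abs_tanh_le_1[of "\<epsilon> * x"] g'_bound[of "v s x"] by linarith
    then have 2: "\<bar>(tanh (\<epsilon> * x) - g' (v s x)) * vx s x\<bar> \<le> (1 + L) * (\<beta>' s / sqrt s)"
      unfolding abs_mult using vx_bound[OF s] L_nonneg by (intro mult_mono) auto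
    have "\<beta>1 s / sqrt s = \<bar>\<epsilon>\<bar> * 1 * (M * exp (l * s)) + (1 + L) * (\<beta>' s / sqrt s)"
      unfolding \<beta>1_def using s by (simp add: add_divide_distrib)
    then show "\<bar>F1 s x\<bar> \<le> \<beta>1 s / sqrt s" unfolding F1_def using 1 2 by linarith
  qed
  \<comment> \<open>Uniqueness of derivatives rewrites the gradient with a nonsingular kernel, ready
    for a second smoothing step.\<close>
  have duh_x: "duhamel c (\<lambda>r. 1 / sqrt (2 * r)) gauss1 F t x = duhamel c (\<lambda>_. 1) std_normal_density F1 t x" for t x
    by (rule DERIV_unique[OF duhamel_deriv_x_smoothing[OF F] duhamel_deriv_x_source[OF F F1 d_F]])
  define vxx where "vxx t x = heat_avg c gauss2 (\<lambda>_. u0) t 1 x / (2 * t)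
     + duhamel c (\<lambda>r. 1 / sqrt (2 * r)) gauss1 F1 t x" for t x
  have d_vxx: "(vx t has_real_derivative vxx t x) (at x)" if t: "0 < t" for t x
  proof -
    have "((\<lambda>x. heat_avg c gauss1 (\<lambda>_. u0) t 1 x / sqrt (2 * t) + duhamel c (\<lambda>_. 1) std_normal_density F1 t x) has_real_derivative
      heat_avg c gauss2 (\<lambda>_. u0) t 1 x / sqrt (2 * t) / sqrt (2 * t) + duhamel c (\<lambda>r. 1 / sqrt (2 * r)) gauss1 F1 t x) (at x)"
      by (intro DERIV_add DERIV_cdivide heat_avg_deriv_x(2)[OF U0 zero_less_one t] duhamel_deriv_x_smoothing[OF F1])
    then show ?thesis unfolding vx_def[abs_def] vxx_def duh_x using t by simp
  qed
  define vt where "vt t x = vxx t x - c * vx t x + F t x" for t x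
  have d_vt: "((\<lambda>s. v s x) has_real_derivative vt t x) (at t)" if t: "0 < t" for t x
  proof -
    have ev: "\<forall>\<^sub>F s in nhds t. v s x = heat_avg c std_normal_density (\<lambda>_. u0) s 1 x + duhamel c (\<lambda>_. 1) std_normal_density F s x"
      by (rule eventually_mono[OF eventually_nhds_in_open[of "{0<..}" t]]) (use t mild' in auto)
    have "((\<lambda>s. heat_avg c std_normal_density (\<lambda>_. u0) s 1 x + duhamel c (\<lambda>_. 1) std_normal_density F s x) has_real_derivative
       (heat_avg c gauss2 (\<lambda>_. u0) t 1 x / (2 * t) - c * (heat_avg c gauss1 (\<lambda>_. u0) t 1 x / sqrt (2 * t)))
       + (F t x + (duhamel c (\<lambda>r. 1 / sqrt (2 * r)) gauss1 F1 t x - c * duhamel c (\<lambda>_. 1) std_normal_density F1 t x))) (at t)"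
      by (intro DERIV_add heat_avg_deriv_r[OF U0 zero_less_one t] duhamel_deriv_t[OF F F1 d_F t])
    then show ?thesis unfolding DERIV_cong_ev[OF refl ev refl] vt_def vxx_def vx_def duh_x
      by (simp add: algebra_simps)
  qed
  have vxx_cont: "continuous_on ({0<..} \<times> UNIV) (\<lambda>(t, x). vxx t x)"
    unfolding vxx_def case_prod_beta
    by (intro continuous_intros heat_cont[OF integrable_gauss(2)] duh_cont[OF integrable_gauss(1) F1 sing_kernel_inverse_sqrt]) auto
  have F_cont: "continuous_on ({0<..} \<times> UNIV) (\<lambda>(t, x). F t x)" using F unfolding sing_source_def by blast
  have vt_cont: "continuous_on ({0<..} \<times> UNIV) (\<lambda>(t, x). vt t x)"
    unfolding vt_def case_prod_beta using vxx_cont vx_cont F_cont unfolding case_prod_beta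
    by (intro continuous_intros)
  show ?thesis
    by (intro exI[of _ vt] exI[of _ vx] exI[of _ vxx] conjI allI impI vt_cont vx_cont vxx_cont d_vt d_vx d_vxx)
      (simp_all add: vt_def F_def)
qed

end

section \<open>Mild solutions by contraction in a weighted space\<close>

lemma heat_avg_diff:
  assumes w: "integrable lborel w" and F: "sing_source \<beta> F" and G: "sing_source \<beta>' G" and s: "0 < s"
  shows "heat_avg c w (\<lambda>s y. F s y - G s y) r s x = heat_avg c w F r s x - heat_avg c w G r s x"
  unfolding heat_avg_def right_diff_distrib
  by (rule Bochner_Integration.integral_diff[OF heat_avg_integrand(1)[OF w F s] heat_avg_integrand(1)[OF w G s]])

lemma duhamel_diff:
  assumes w: "integrable lborel w" and F: "sing_source \<beta> F" and G: "sing_source \<beta>' G" and k: "sing_source \<alpha> (\<lambda>r _. k r)"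
  shows "duhamel c k w (\<lambda>s y. F s y - G s y) t x = duhamel c k w F t x - duhamel c k w G t x"
proof -
  have "duhamel c k w (\<lambda>s y. F s y - G s y) t x = (\<integral>r. indicator {0<..<t} r * (k r * heat_avg c w F r (t - r) x)
      - indicator {0<..<t} r * (k r * heat_avg c w G r (t - r) x) \<partial>lborel)"
    unfolding duhamel_def
    by (intro Bochner_Integration.integral_cong refl)
      (auto simp: indicator_def heat_avg_diff[OF w F G] right_diff_distrib)
  then show ?thesis unfolding duhamel_def
    by (simp only: Bochner_Integration.integral_diff[OF duhamel_integrable[OF w F k] duhamel_integrable[OF w G k]])
qed

text \<open>Averaging does not enlarge a source of size C exp (l s), which leaves an elementary
  integral. The factor 1 / l produces the contraction, and the vanishing at t = 0 produces
  continuity up to the initial time.\<close>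

lemma duhamel_exp_bound:
  assumes F: "sing_source (\<lambda>s. C * exp (l * s) * sqrt s) F" and l: "0 < l" and t: "0 \<le> t"
  shows "\<bar>duhamel c (\<lambda>_. 1) std_normal_density F t x\<bar> \<le> C * (exp (l * t) - 1) / l"
proof -
  have C: "0 \<le> C" using sing_source_nonneg[OF F, of 1] by (simp add: zero_le_mult_iff)
  have fi: "has_bochner_integral lborel (\<lambda>r. C * exp (l * (t - r)) * indicator {0..t} r)
      (- C / l * exp (l * (t - t)) - (- C / l * exp (l * (t - 0))))"
  proof (rule has_bochner_integral_FTC_Icc_real[OF t])
    show "((\<lambda>r. - C / l * exp (l * (t - r))) has_real_derivative C * exp (l * (t - r))) (at r)" for r
    proof -
      have "((\<lambda>r. exp (l * (t - r))) has_real_derivative exp (l * (t - r)) * (l * (0 - 1))) (at r)"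
        by (intro DERIV_fun_exp DERIV_cmult DERIV_diff DERIV_const DERIV_ident)
      from DERIV_cmult[OF this, of "- C / l"] show ?thesis using l by simp
    qed
    show "isCont (\<lambda>r. C * exp (l * (t - r))) r" for r
      by (intro continuous_intros)
  qed
  have "\<bar>duhamel c (\<lambda>_. 1) std_normal_density F t x\<bar> \<le>
      (\<integral>r. \<bar>indicator {0<..<t} r * (1 * heat_avg c std_normal_density F r (t - r) x)\<bar> \<partial>lborel)"
    unfolding duhamel_def by (rule integral_abs_bound)
  also have "\<dots> \<le> (\<integral>r. C * exp (l * (t - r)) * indicator {0..t} r \<partial>lborel)"
  proof (rule integral_mono)
    fix r
    show "\<bar>indicator {0<..<t} r * (1 * heat_avg c std_normal_density F r (t - r) x)\<bar> \<le> C * exp (l * (t - r)) * indicator {0..t} r"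
      using heat_avg_integrand(2)[OF integrable_std_normal F, of "t - r" c r x] C
      by (cases "0 < r \<and> r < t") (auto simp: indicator_def)
  next
    show "integrable lborel (\<lambda>r. C * exp (l * (t - r)) * indicator {0..t} r)"
      using fi by (rule has_bochner_integral_iff[THEN iffD1, THEN conjunct1])
  qed (intro integrable_abs duhamel_integrable[OF integrable_std_normal F sing_kernel_one])
  also have "\<dots> = C * (exp (l * t) - 1) / l"
    unfolding has_bochner_integral_integral_eq[OF fi] by (simp add: right_diff_distrib diff_divide_distrib)
  finally show ?thesis .
qed

lemma continuous_duhamel_closed:
  assumes F: "sing_source (\<lambda>s. C * exp (l * s) * sqrt s) F" and l: "0 < l"
  shows "continuous_on ({0..} \<times> UNIV) (\<lambda>(t, x). duhamel c (\<lambda>_. 1) std_normal_density F t x)"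
    (is "continuous_on _ ?h")
  unfolding continuous_on_def
proof
  fix p :: "real \<times> real" assume p: "p \<in> {0..} \<times> UNIV"
  show "(?h \<longlongrightarrow> ?h p) (at p within {0..} \<times> UNIV)"
  proof (cases "0 < fst p")
    case True
    have "open ({0 :: real<..} \<times> (UNIV :: real set))" by (intro open_Times) auto
    note continuous_on_eq_continuous_at[OF this, THEN iffD1, OF continuous_duhamel[OF integrable_std_normal F sing_kernel_one]]
    moreover have "p \<in> {0<..} \<times> UNIV" using True by (simp add: mem_Times_iff)
    ultimately have "isCont ?h p" by (rule bspec)
    then show ?thesis unfolding isCont_def by (rule tendsto_within_subset) simp
  next
    case False
    then have p0: "fst p = 0" using p by (auto simp: mem_Times_iff)
    have "?h p = 0" using p0 by (simp add: case_prod_beta duhamel_def)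
    moreover have "(?h \<longlongrightarrow> 0) (at p within {0..} \<times> UNIV)"
    proof (rule Lim_null_comparison)
      have "\<forall>\<^sub>F q in at p within {0..} \<times> UNIV. q \<in> {0..} \<times> (UNIV :: real set)" by (simp add: eventually_at_filter)
      then show "\<forall>\<^sub>F q in at p within {0..} \<times> UNIV. norm (?h q) \<le> C * (exp (l * fst q) - 1) / l"
      proof eventually_elim
        case (elim q)
        then have "0 \<le> fst q" by (simp add: mem_Times_iff)
        from duhamel_exp_bound[OF F l this, of c "snd q"] show ?case by (simp add: case_prod_beta)
      qed
      have "((\<lambda>q. C * (exp (l * fst q) - 1) / l) \<longlongrightarrow> C * (exp (l * fst p) - 1) / l) (at p within {0..} \<times> UNIV)"
        using l by (intro tendsto_intros) auto
      then show "((\<lambda>q. C * (exp (l * fst q) - 1) / l) \<longlongrightarrow> 0) (at p within {0..} \<times> UNIV)"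
        by (simp add: p0)
    qed
    ultimately show ?thesis by simp
  qed
qed

context reaction_term
begin

text \<open>\<open>V\<close> is the solution times exp (- l t). The Lipschitz constant 1 + L of the
  reaction and the factor 1 / l of the Duhamel bound give a contraction with constant (1 + L) / l =
  1/2 on all times at once, so the solution is global from the start.\<close>

lemma mild_solution_exists:
  assumes u0: "continuous_on UNIV u0" "\<And>x. \<bar>u0 x\<bar> \<le> B" and l: "l = 2 * (1 + L)"
  obtains V :: "(real \<times> real) \<Rightarrow>\<^sub>C real" where
    "\<And>t x. 0 \<le> t \<Longrightarrow> exp (l * t) * V (t, x) = heat_avg c std_normal_density (\<lambda>_. u0) t 1 x
       + duhamel c (\<lambda>_. 1) std_normal_density (\<lambda>s y. R y (exp (l * s) * V (s, y))) t x"
proof -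
  define K where "K = 1 + L"
  have K: "0 < K" using L_nonneg unfolding K_def by simp
  have lK: "l = 2 * K" "0 < l" using l K unfolding K_def by auto
  note U0 = sing_source_const[OF u0]
  define F where "F V s y = R y (exp (l * s) * apply_bcontfun V (s, y))" for V :: "(real \<times> real) \<Rightarrow>\<^sub>C real" and s y
  \<comment> \<open>Freezing negative times at 0 extends the map to the whole plane, so that the
    complete space of bounded continuous functions there serves as domain.\<close>
  define H where "H V q = exp (- l * max 0 (fst q)) * (heat_avg c std_normal_density (\<lambda>_. u0) (max 0 (fst q)) 1 (snd q)
       + duhamel c (\<lambda>_. 1) std_normal_density (F V) (max 0 (fst q)) (snd q))" for V and q :: "real \<times> real"
  have cont_V: "continuous_on A (\<lambda>q. exp (l * fst q) * apply_bcontfun V q)" for V :: "(real \<times> real) \<Rightarrow>\<^sub>C real" and A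
    by (intro continuous_intros continuous_on_apply_bcontfun)
  have cont_F: "continuous_on A (\<lambda>(s, y). F V s y)" for V A
    unfolding F_def case_prod_beta using cont_V[of A V] by (intro continuous_R continuous_intros) simp
  have F_diff: "sing_source (\<lambda>s. K * dist V V' * exp (l * s) * sqrt s) (\<lambda>s y. F V s y - F V' s y)" for V V'
    unfolding sing_source_def
  proof (intro conjI allI impI)
    show "mono_on {0<..} (\<lambda>s. K * dist V V' * exp (l * s) * sqrt s)"
      using K lK by (intro mono_on_exp_sqrt) auto
    show "continuous_on ({0<..} \<times> UNIV) (\<lambda>(s, y). F V s y - F V' s y)"
      using cont_F unfolding case_prod_beta by (intro continuous_intros)
    fix s y :: real assume s: "0 < s"
    have "\<bar>F V s y - F V' s y\<bar> \<le> K * \<bar>exp (l * s) * V (s, y) - exp (l * s) * V' (s, y)\<bar>"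
      unfolding F_def K_def by (rule R_lipschitz)
    also have "\<bar>exp (l * s) * V (s, y) - exp (l * s) * V' (s, y)\<bar> = exp (l * s) * dist (V (s, y)) (V' (s, y))"
      by (simp add: dist_real_def abs_mult flip: right_diff_distrib)
    also have "K * \<dots> \<le> K * (exp (l * s) * dist V V')"
      using K by (intro mult_left_mono dist_bounded) auto
    finally show "\<bar>F V s y - F V' s y\<bar> \<le> K * dist V V' * exp (l * s) * sqrt s / sqrt s"
      using s by (simp add: mult_ac)
  qed
  \<comment> \<open>As \<open>g\<close> vanishes at 0, so does the source of the zero function, and
    the difference estimate also bounds a single source.\<close>
  have "F 0 = (\<lambda>s y. 0)" by (simp add: F_def fun_eq_iff R_def g_0)
  then have F_source: "sing_source (\<lambda>s. K * dist V 0 * exp (l * s) * sqrt s) (F V)" for V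
    using F_diff[of V 0] by simp
  have "H V \<in> bcontfun" for V
  proof (rule bcontfun_normI)
    have "continuous_on UNIV (\<lambda>q. (\<lambda>(t, x). duhamel c (\<lambda>_. 1) std_normal_density (F V) t x) (max 0 (fst q), snd q))"
      by (rule continuous_on_compose2[OF continuous_duhamel_closed[OF F_source lK(2)]]) (auto intro!: continuous_intros)
    moreover have "continuous_on UNIV (\<lambda>q. heat_avg c std_normal_density (\<lambda>_. u0) (max 0 (fst q)) 1 (snd q))"
      by (intro continuous_heat_avg_compose[OF integrable_std_normal U0] continuous_intros) auto
    ultimately show "continuous_on UNIV (H V)"
      unfolding H_def split_conv by (intro continuous_intros)
    fix q :: "real \<times> real"
    define t where "t = max 0 (fst q)"
    have t: "0 \<le> t" unfolding t_def by simp
    have "\<bar>duhamel c (\<lambda>_. 1) std_normal_density (F V) t (snd q)\<bar> \<le> K * dist V 0 * (exp (l * t) - 1) / l"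
      by (rule duhamel_exp_bound[OF F_source lK(2) t])
    also have "\<dots> \<le> K * dist V 0 * exp (l * t) / l"
      using K lK by (intro divide_right_mono mult_left_mono) auto
    also have "\<dots> = dist V 0 / 2 * exp (l * t)" unfolding lK(1) using K by simp
    finally have 1: "\<bar>duhamel c (\<lambda>_. 1) std_normal_density (F V) t (snd q)\<bar> \<le> dist V 0 / 2 * exp (l * t)" .
    have "\<bar>heat_avg c std_normal_density (\<lambda>_. u0) t 1 (snd q)\<bar> \<le> B"
      using heat_avg_integrand(2)[OF integrable_std_normal U0 zero_less_one, of c t "snd q"] by simp
    also have "B \<le> B * exp (l * t)"
    proof -
      have "0 \<le> B" using u0(2)[of 0] by linarith
      then show ?thesis using lK t by (intro mult_le_cancel_left1[THEN iffD2]) auto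
    qed
    finally have "\<bar>heat_avg c std_normal_density (\<lambda>_. u0) t 1 (snd q) + duhamel c (\<lambda>_. 1) std_normal_density (F V) t (snd q)\<bar>
        \<le> (B + dist V 0 / 2) * exp (l * t)"
      using 1 unfolding distrib_right by linarith
    then have "exp (- l * t) * \<bar>heat_avg c std_normal_density (\<lambda>_. u0) t 1 (snd q) + duhamel c (\<lambda>_. 1) std_normal_density (F V) t (snd q)\<bar>
        \<le> exp (- l * t) * ((B + dist V 0 / 2) * exp (l * t))"
      by (intro mult_left_mono) auto
    also have "\<dots> = B + dist V 0 / 2" by (simp add: exp_minus)
    finally show "norm (H V q) \<le> B + dist V 0 / 2"
      unfolding H_def t_def[symmetric] by (simp add: abs_mult)
  qed
  then have H: "apply_bcontfun (Bcontfun (H V)) q = H V q" for V q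
    by (simp add: Bcontfun_inverse)
  have "\<exists>!V. Bcontfun (H V) = V"
  proof (rule banach_fix_type[of "1 / 2"])
    show "\<forall>V V'. dist (Bcontfun (H V)) (Bcontfun (H V')) \<le> 1 / 2 * dist V V'"
    proof (intro allI dist_bound)
      fix V V' and q :: "real \<times> real"
      define t where "t = max 0 (fst q)"
      have t: "0 \<le> t" unfolding t_def by simp
      have "dist (H V q) (H V' q) = exp (- l * t) * \<bar>duhamel c (\<lambda>_. 1) std_normal_density (F V) t (snd q)
          - duhamel c (\<lambda>_. 1) std_normal_density (F V') t (snd q)\<bar>"
        unfolding H_def t_def[symmetric] dist_real_def by (simp add: abs_mult flip: right_diff_distrib)
      also have "\<dots> = exp (- l * t) * \<bar>duhamel c (\<lambda>_. 1) std_normal_density (\<lambda>s y. F V s y - F V' s y) t (snd q)\<bar>"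
        by (simp only: duhamel_diff[OF integrable_std_normal F_source F_source sing_kernel_one])
      also have "\<dots> \<le> exp (- l * t) * (K * dist V V' * (exp (l * t) - 1) / l)"
        by (intro mult_left_mono duhamel_exp_bound[OF F_diff lK(2) t]) simp
      also have "\<dots> \<le> exp (- l * t) * (K * dist V V' * exp (l * t) / l)"
        using K lK by (intro mult_left_mono divide_right_mono) auto
      also have "\<dots> = 1 / 2 * dist V V'" unfolding lK(1) using K by (simp add: exp_minus)
      finally show "dist (Bcontfun (H V) q) (Bcontfun (H V') q) \<le> 1 / 2 * dist V V'" unfolding H .
    qed
  qed auto
  then obtain V where V: "Bcontfun (H V) = V" by blast
  show ?thesis
  proof (rule that)
    fix t x :: real assume t: "0 \<le> t"
    have "V (t, x) = H V (t, x)" using H[of V "(t, x)"] unfolding V .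
    then show "exp (l * t) * V (t, x) = heat_avg c std_normal_density (\<lambda>_. u0) t 1 x
       + duhamel c (\<lambda>_. 1) std_normal_density (\<lambda>s y. R y (exp (l * s) * V (s, y))) t x"
      using t unfolding H_def F_def[abs_def] by (simp add: exp_minus)
  qed
qed

text \<open>Removes the weight. The initial value is attained because \<open>V\<close> is jointly
  continuous on the plane, the heat average at elapsed time 0 is evaluation, and the Duhamel
  integral over an empty interval is 0.\<close>

theorem reaction_solution_exists:
  assumes u0: "continuous_on UNIV u0" "\<And>x. \<bar>u0 x\<bar> \<le> B"
  shows "\<exists>u. reaction_solution g c \<epsilon> \<infinity> u0 u"
proof -
  define l where "l = 2 * (1 + L)"
  have l: "0 \<le> l" unfolding l_def using L_nonneg by simp
  obtain V :: "(real \<times> real) \<Rightarrow>\<^sub>C real" where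
    V: "\<And>t x. 0 \<le> t \<Longrightarrow> exp (l * t) * V (t, x) = heat_avg c std_normal_density (\<lambda>_. u0) t 1 x
       + duhamel c (\<lambda>_. 1) std_normal_density (\<lambda>s y. R y (exp (l * s) * V (s, y))) t x"
    using mild_solution_exists[OF u0 l_def] by blast
  define v where "v t x = exp (l * t) * V (t, x)" for t x
  have v_cont: "continuous_on A (\<lambda>(t, x). v t x)" for A
    unfolding v_def case_prod_beta prod.collapse
    by (intro continuous_intros continuous_on_apply_bcontfun)
  have v_bound: "\<bar>v t x\<bar> \<le> norm V * exp (l * t)" for t x
    using norm_bounded[of V "(t, x)"] unfolding v_def by (simp add: abs_mult mult.commute)
  have v0: "v 0 = u0"
    using V[of 0] by (auto simp: v_def fun_eq_iff heat_avg_zero duhamel_def)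
  have "\<exists>vt vx vxx. continuous_on ({0<..} \<times> UNIV) (\<lambda>(t, x). vt t x) \<and>
     continuous_on ({0<..} \<times> UNIV) (\<lambda>(t, x). vx t x) \<and> continuous_on ({0<..} \<times> UNIV) (\<lambda>(t, x). vxx t x) \<and>
     (\<forall>t x. 0 < t \<longrightarrow> ((\<lambda>s. v s x) has_real_derivative vt t x) (at t) \<and>
        (v t has_real_derivative vx t x) (at x) \<and> (vx t has_real_derivative vxx t x) (at x) \<and>
        vt t x = vxx t x - c * vx t x + R x (v t x))"
    by (rule mild_solution_regular[OF u0 v_cont v_bound l]) (use V in \<open>auto simp: v_def\<close>)
  then obtain vt vx vxx where reg: "continuous_on ({0<..} \<times> UNIV) (\<lambda>(t, x). vt t x)"
     "continuous_on ({0<..} \<times> UNIV) (\<lambda>(t, x). vx t x)" "continuous_on ({0<..} \<times> UNIV) (\<lambda>(t, x). vxx t x)"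
     "\<And>t x. 0 < t \<Longrightarrow> ((\<lambda>s. v s x) has_real_derivative vt t x) (at t) \<and>
        (v t has_real_derivative vx t x) (at x) \<and> (vx t has_real_derivative vxx t x) (at x) \<and>
        vt t x = vxx t x - c * vx t x + R x (v t x)"
    by blast
  have bdd: "bounded ((\<lambda>(t, \<zeta>). v t \<zeta>) ` ({0..S} \<times> UNIV))" for S
  proof -
    have "norm y \<le> norm V * exp (l * S)" if "y \<in> (\<lambda>(t, \<zeta>). v t \<zeta>) ` ({0..S} \<times> UNIV)" for y
    proof -
      from that obtain t x where tx: "y = v t x" "0 \<le> t" "t \<le> S" by auto
      have "norm V * exp (l * t) \<le> norm V * exp (l * S)"
        using tx l by (intro mult_left_mono) (auto simp: mult_left_mono)
      with v_bound[of t x] show ?thesis unfolding tx(1) by simp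
    qed
    then show ?thesis unfolding bounded_iff by blast
  qed
  have sets: "{t. 0 < t \<and> ereal t < \<infinity>} = {0<..}" by auto
  have eqn: "\<forall>t x. 0 < t \<and> ereal t < \<infinity> \<longrightarrow> ((\<lambda>s. v s x) has_real_derivative vt t x) (at t) \<and>
      (v t has_real_derivative vx t x) (at x) \<and> (vx t has_real_derivative vxx t x) (at x) \<and>
      vt t x = vxx t x - c * vx t x + tanh (\<epsilon> * x) * v t x - g (v t x)"
    using reg(4)[unfolded R_def add_diff_eq] by blast
  have "reaction_solution g c \<epsilon> \<infinity> u0 v"
    unfolding reaction_solution_def sets
    by (intro conjI v0 v_cont, use bdd in blast,
        rule exI[of _ vt], rule exI[of _ vx], rule exI[of _ vxx], intro conjI reg(1-3) eqn)
  then show ?thesis by blast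
qed

end

section \<open>Exponential stability\<close>

text \<open>Integrating 3 v^2 with v clamped to [-2, 2] continues the cube along its tangents as a
  C^1 function with slope between 0 and 3 * 2^2. Monotonicity serves the comparison principle, the
  bounded slope the contraction.\<close>

lemma truncated_cube:
  obtains g g' :: "real \<Rightarrow> real" where
    "\<And>v. (g has_real_derivative g' v) (at v)" "continuous_on UNIV g'"
    "\<And>v. 0 \<le> g' v" "\<And>v. g' v \<le> 12" "\<And>v. \<bar>v\<bar> \<le> 2 \<Longrightarrow> g v = v ^ 3"
proof -
  define m where "m v = max (- 2) (min 2 v)" for v :: real
  have m_cont: "continuous_on UNIV m" unfolding m_def by (intro continuous_intros)
  have "\<exists>G. \<forall>x :: real. - \<infinity> < ereal x \<longrightarrow> ereal x < \<infinity> \<longrightarrow> (G has_vector_derivative 3 * (m x)\<^sup>2) (at x)"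
    using m_cont by (intro einterval_antiderivative) (auto intro!: continuous_intros simp: continuous_on_eq_continuous_at)
  then obtain G where G: "\<And>x. (G has_real_derivative 3 * (m x)\<^sup>2) (at x)"
    by (auto simp: has_real_derivative_iff_has_vector_derivative)
  define g where "g v = G v - G 0" for v
  have dg: "(g has_real_derivative 3 * (m v)\<^sup>2) (at v)" for v
    unfolding g_def[abs_def] using DERIV_diff[OF G DERIV_const] by simp
  show ?thesis
  proof (rule that[of g "\<lambda>v. 3 * (m v)\<^sup>2"])
    show "(g has_real_derivative 3 * (m v)\<^sup>2) (at v)" for v by (rule dg)
    show "continuous_on UNIV (\<lambda>v. 3 * (m v)\<^sup>2)" by (intro continuous_intros m_cont)
    show "0 \<le> 3 * (m v)\<^sup>2" for v by simp
    show "3 * (m v)\<^sup>2 \<le> 12" for v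
    proof -
      have "\<bar>m v\<bar> \<le> 2" unfolding m_def by auto
      then have "\<bar>m v\<bar>\<^sup>2 \<le> 2\<^sup>2" by (intro power_mono) auto
      then show ?thesis by simp
    qed
    fix v :: real assume v: "\<bar>v\<bar> \<le> 2"
    have "((\<lambda>v. g v - v ^ 3) has_real_derivative 0) (at y within {- 2..2})" if "y \<in> {- 2..2}" for y
    proof -
      have "((\<lambda>v. g v - v ^ 3) has_real_derivative 3 * (m y)\<^sup>2 - 3 * y\<^sup>2) (at y)"
        by (rule derivative_eq_intros dg refl)+ simp
      moreover have "m y = y" using that unfolding m_def by auto
      ultimately show ?thesis by (auto intro: has_field_derivative_at_within)
    qed
    then obtain k where k: "\<And>y. y \<in> {- 2..2} \<Longrightarrow> g y - y ^ 3 = k"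
      using has_field_derivative_zero_constant[of "{- 2..2}" "\<lambda>v. g v - v ^ 3"] by auto
    from k[of 0] k[of v] v show "g v = v ^ 3" by (simp add: g_def abs_le_iff)
  qed
qed

lemma BC0_norm_bound:
  assumes "f \<in> bcontfun"
  shows "\<bar>f x\<bar> \<le> BC0_norm f"
  using norm_bounded[of "Bcontfun f" x] unfolding BC0_norm_def by (simp add: Bcontfun_inverse[OF assms])

lemma BC0_norm_le:
  assumes "f \<in> bcontfun" "\<And>x. \<bar>f x\<bar> \<le> b"
  shows "BC0_norm f \<le> b"
  unfolding BC0_norm_def by (rule norm_bound) (simp add: Bcontfun_inverse[OF assms(1)] assms(2))

lemma reaction_solution_cong:
  assumes u: "reaction_solution g c \<epsilon> T u0 u"
    and eq: "\<And>t x. 0 \<le> t \<Longrightarrow> ereal t < T \<Longrightarrow> g (u t x) = g' (u t x)"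
  shows "reaction_solution g' c \<epsilon> T u0 u"
  using u eq unfolding reaction_solution_def by (simp add: less_imp_le)

context front
begin

lemma exponentially_stable: "exponentially_asymptotically_stable c \<epsilon> U"
proof -
  obtain \<eta> \<kappa> where \<eta>: "0 < \<eta>" "\<eta> \<le> 1" and \<kappa>: "0 < \<kappa>"
    and super: "\<And>x. 2 * \<kappa> * (U x + \<eta>) \<le> 2 * U x ^ 3 + \<eta> * (3 * (U x)\<^sup>2 - tanh (\<epsilon> * x))"
    using linearised_supersolution by blast
  obtain g g' where dg: "\<And>v. (g has_real_derivative g' v) (at v)" and g'_cont: "continuous_on UNIV g'"
    and g'_nonneg: "\<And>v. 0 \<le> g' v" and g'_le: "\<And>v. g' v \<le> 12" and g3: "\<And>v. \<bar>v\<bar> \<le> 2 \<Longrightarrow> g v = v ^ 3"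
    using truncated_cube by blast
  have g_mono: "mono g"
    by (rule monoI, rule DERIV_nonneg_imp_nondecreasing) (use dg g'_nonneg in blast)+
  interpret reaction_term c \<epsilon> 12 g g'
    by unfold_locales (use dg g'_cont g'_nonneg g'_le g3[of 0] in \<open>auto simp: abs_of_nonneg\<close>)
  \<comment> \<open>The two smallness conditions on A in \<open>front_attracts\<close>. With A = n /
    \<eta> the radius \<delta>0 = a \<eta> guarantees both.\<close>
  define a where "a = min (1 / 2) (\<kappa> / 6)"
  have a: "0 < a" unfolding a_def using \<kappa> by simp
  have stable: "(\<exists>u. classical_solution c \<epsilon> \<infinity> u0 u) \<and>
      (\<forall>T>0. \<forall>u. classical_solution c \<epsilon> T u0 u \<longrightarrow>
         (\<exists>w. classical_solution c \<epsilon> \<infinity> u0 w \<and>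
              (\<forall>t \<zeta>. 0 \<le> t \<and> ereal t < T \<longrightarrow> w t \<zeta> = u t \<zeta>) \<and>
              (\<forall>t\<ge>0. (\<lambda>\<zeta>. w t \<zeta> - U \<zeta>) \<in> bcontfun \<and>
                 BC0_norm (\<lambda>\<zeta>. w t \<zeta> - U \<zeta>)
                   \<le> (1 + \<eta>) / \<eta> * exp (- \<kappa> * t) * BC0_norm (\<lambda>\<zeta>. u0 \<zeta> - U \<zeta>))))"
    if u0: "(\<lambda>\<zeta>. u0 \<zeta> - U \<zeta>) \<in> bcontfun \<and> BC0_norm (\<lambda>\<zeta>. u0 \<zeta> - U \<zeta>) \<le> a * \<eta>" for u0
  proof -
    define n where "n = BC0_norm (\<lambda>x. u0 x - U x)"
    have bc: "(\<lambda>x. u0 x - U x) \<in> bcontfun" and n_le: "n \<le> a * \<eta>" using u0 unfolding n_def by auto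
    define A where "A = n / \<eta>"
    have u0_n: "\<bar>u0 x - U x\<bar> \<le> n" for x unfolding n_def by (rule BC0_norm_bound[OF bc])
    have n0: "0 \<le> n" using u0_n[of 0] by linarith
    have Aa: "0 \<le> A" "A \<le> a" unfolding A_def using n0 n_le \<eta> by (simp_all add: field_simps)
    then have A: "0 \<le> A" "A \<le> 1 / 2" "6 * A \<le> \<kappa>" unfolding a_def by auto
    have u0_A: "\<bar>u0 x - U x\<bar> \<le> A * \<eta>" for x using u0_n[of x] \<eta> unfolding A_def by simp
    have decay: "\<bar>u t x - U x\<bar> \<le> A * exp (- \<kappa> * t) * (U x + \<eta>)"
      if "reaction_solution h c \<epsilon> T u0 u" "mono h" "\<And>v. \<bar>v\<bar> \<le> 2 \<Longrightarrow> h v = v ^ 3" "0 \<le> t" "ereal t < T"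
      for h T u t x
      by (rule front_attracts[OF that(2,3) \<eta> \<kappa> super A that(1) u0_A that(4,5)])
    \<comment> \<open>The weight U + \<eta> is at most 1 + \<eta>; together with A = n / \<eta> this
      produces the constant K = (1 + \<eta>) / \<eta>.\<close>
    have decay': "A * exp (- \<kappa> * t) * (U x + \<eta>) \<le> (1 + \<eta>) / \<eta> * exp (- \<kappa> * t) * n" for t x
    proof -
      have "A * exp (- \<kappa> * t) * (U x + \<eta>) \<le> A * exp (- \<kappa> * t) * (1 + \<eta>)"
        using A U_le_1[of x] by (intro mult_left_mono) auto
      then show ?thesis unfolding A_def by (simp add: mult_ac)
    qed
    have u0_cont: "continuous_on UNIV u0"
    proof -
      have "continuous_on UNIV (\<lambda>x. u0 x - U x)" using bc by (simp add: bcontfun_def)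
      from continuous_on_add[OF this continuous_U] show ?thesis by simp
    qed
    have "\<bar>u0 x\<bar> \<le> n + 1" for x using u0_n[of x] U_pos[of x] U_le_1[of x] by linarith
    from reaction_solution_exists[OF u0_cont this] obtain w where w: "reaction_solution g c \<epsilon> \<infinity> u0 w" by blast
    \<comment> \<open>The barriers are valid for the truncated equation, since \<open>g\<close> is
      the cube on their range. They confine \<open>w\<close> to [-2, 2], so \<open>w\<close> solves
      the original equation.\<close>
    have w_small: "\<bar>w t x\<bar> \<le> 2" if t: "0 \<le> t" for t x
    proof -
      have "A * exp (- \<kappa> * t) * (U x + \<eta>) \<le> 1 / 2 * 1 * 2"
        using A \<kappa> t \<eta> U_pos[of x] U_le_1[of x] by (intro mult_mono) auto
      then show ?thesis using decay[OF w g_mono g3 t, of x] U_pos[of x] U_le_1[of x] by auto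
    qed
    have "reaction_solution (\<lambda>v. v ^ 3) c \<epsilon> \<infinity> u0 w"
      by (rule reaction_solution_cong[OF w]) (rule g3[OF w_small])
    then have wc: "classical_solution c \<epsilon> \<infinity> u0 w" unfolding reaction_solution_cube .
    have w_decay: "(\<lambda>x. w t x - U x) \<in> bcontfun \<and>
        BC0_norm (\<lambda>x. w t x - U x) \<le> (1 + \<eta>) / \<eta> * exp (- \<kappa> * t) * n" if t: "0 \<le> t" for t
    proof -
      have b: "\<bar>w t x - U x\<bar> \<le> (1 + \<eta>) / \<eta> * exp (- \<kappa> * t) * n" for x
        using decay[OF w g_mono g3 t, of x] decay'[of t x] by simp
      have "continuous_on UNIV (\<lambda>x. (\<lambda>(t, x). w t x) (t, x))"
        by (rule continuous_on_compose2[OF reaction_solution_continuous_on[OF w, of t]])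
          (use t in \<open>auto intro!: continuous_intros\<close>)
      then have "(\<lambda>x. w t x - U x) \<in> bcontfun"
        using b by (intro bcontfun_normI continuous_intros continuous_U) auto
      then show ?thesis using BC0_norm_le b by blast
    qed
    show ?thesis
    proof (intro conjI allI impI)
      show "\<exists>u. classical_solution c \<epsilon> \<infinity> u0 u" using wc by blast
      fix T u assume T: "0 < T" and u: "classical_solution c \<epsilon> T u0 u"
      \<comment> \<open>Nothing confines an arbitrary local solution to [-2, 2] beforehand, so
        uniqueness is applied to the equation with the cube itself.\<close>
      have "w t x = u t x" if "0 \<le> t \<and> ereal t < T" for t x
        by (rule reaction_solution_unique[OF mono_cube wc[folded reaction_solution_cube] u[folded reaction_solution_cube]])
          (use that in auto)
      then show "\<exists>w. classical_solution c \<epsilon> \<infinity> u0 w \<and>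
                (\<forall>t \<zeta>. 0 \<le> t \<and> ereal t < T \<longrightarrow> w t \<zeta> = u t \<zeta>) \<and>
                (\<forall>t\<ge>0. (\<lambda>\<zeta>. w t \<zeta> - U \<zeta>) \<in> bcontfun \<and>
                   BC0_norm (\<lambda>\<zeta>. w t \<zeta> - U \<zeta>)
                     \<le> (1 + \<eta>) / \<eta> * exp (- \<kappa> * t) * BC0_norm (\<lambda>\<zeta>. u0 \<zeta> - U \<zeta>))"
        using wc w_decay unfolding n_def by blast
    qed
  qed
  have "0 < a * \<eta>" "0 < (1 + \<eta>) / \<eta>" using a \<eta> by simp_all
  then show ?thesis unfolding exponentially_asymptotically_stable_def
    using \<kappa> stable by blast
qed

end

theorem mainTheorem3:
  fixes c :: real and X :: "real \<Rightarrow> real \<Rightarrow> real \<times> real \<times> real"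
  assumes "0 \<le> c" and "c < 2"
    and "front_family c X"
  shows "\<exists>\<epsilon>0>0. \<forall>\<epsilon>. 0 < \<epsilon> \<and> \<epsilon> < \<epsilon>0 \<longrightarrow>
           exponentially_asymptotically_stable c \<epsilon> (\<lambda>\<zeta>. fst (X \<epsilon> \<zeta>))"
proof -
  have "\<forall>\<^sub>F \<epsilon> in at_right 0. heteroclinic_front c \<epsilon> (X \<epsilon>)"
    using assms(3) unfolding front_family_def by blast
  then obtain \<epsilon>0 where "0 < \<epsilon>0" "\<And>\<epsilon>. 0 < \<epsilon> \<Longrightarrow> \<epsilon> < \<epsilon>0 \<Longrightarrow> heteroclinic_front c \<epsilon> (X \<epsilon>)"
    unfolding eventually_at_right_field by blast
  then show ?thesis
    using front.exponentially_stable[OF heteroclinic_front_imp_front] by blast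
qed

end
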